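(* For any $0\le s<3/2$ and any $\epsilon>0$, the perturbed 2D Euler system around the Couette flow on $\mathbb{T}\times\mathbb{R}$ admits a nontrivial traveling wave solution $\omega$ satisfying $$\|w+1\|_{H^s(\mathbb{T}\times\mathbb{R})}\equiv\|\omega\|_{H^s(\mathbb{T}\times\mathbb{R})}<\epsilon,$$ with $\omega\in C^\infty(\mathbb{T}\times\mathbb{R})$ compactly supported, and whose speed is of order $1$ with respect to $\epsilon$.
   Context: $\mathbb{T}=\mathbb{R}/2\pi\mathbb{Z}$. The perturbed 2D Euler system around the Couette flow (velocity $(y,0)$, vorticity $-1$) is: for the perturbation vorticity $\omega(x,y,t)$ on $\mathbb{T}\times\mathbb{R}$, $$\partial_t\omega+y\,\partial_x\omega+\mathbf u\cdot\nabla\omega=0,\qquad \mathbf u=\nabla^\perp\psi=(-\partial_y\psi,\partial_x\psi),$$ where $\psi(x,y,t)=\frac{1}{4\pi}\int_{\mathbb{T}\times\mathbb{R}}\log\big(\cosh(y-\bar y)-\cos(x-\bar x)\big)\,\omega(\bar x,\bar y,t)\,d\bar x\,d\bar y$ (so $\Delta\psi=\omega$); the total vorticity is $w=-1+\omega$. A traveling wave is a solution of the form $\omega(x,y,t)=\Omega(x+\lambda t,y)$ for a fixed profile $\Omega$ and speed $\lambda\in\mathbb{R}$; it is nontrivial if $\Omega$ depends on $x$. *)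

theory Defs
  imports "HOL-Analysis.Analysis"
begin

text \<open>Functions on T x R are represented as functions real => real => real
  (first argument x, second y) that are 2pi-periodic in x.\<close>

definition periodic_x :: "(real \<Rightarrow> real \<Rightarrow> real) \<Rightarrow> bool" where
  "periodic_x f \<longleftrightarrow> (\<forall>x y. f (x + 2 * pi) y = f x y)"

coinductive smooth2 :: "(real \<times> real \<Rightarrow> real) \<Rightarrow> bool" where
  "(\<And>p. (f has_derivative (\<lambda>h. fst h * fx p + snd h * fy p)) (at p))
    \<Longrightarrow> smooth2 fx \<Longrightarrow> smooth2 fy \<Longrightarrow> smooth2 f"

definition smooth_Txr :: "(real \<Rightarrow> real \<Rightarrow> real) \<Rightarrow> bool" where
  "smooth_Txr f \<longleftrightarrow> smooth2 (\<lambda>(x, y). f x y)"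

text \<open>Compact support in T x R (T is compact, so: bounded support in y).\<close>
definition compact_supp_Txr :: "(real \<Rightarrow> real \<Rightarrow> real) \<Rightarrow> bool" where
  "compact_supp_Txr f \<longleftrightarrow> (\<exists>R. \<forall>x y. R < \<bar>y\<bar> \<longrightarrow> f x y = 0)"

definition stream :: "(real \<Rightarrow> real \<Rightarrow> real) \<Rightarrow> real \<Rightarrow> real \<Rightarrow> real" where
  "stream w x y = (1 / (4 * pi)) *
     integral ({0..2*pi} \<times> UNIV)
       (\<lambda>(xb, yb). ln (cosh (y - yb) - cos (x - xb)) * w xb yb)"

definition euler_couette_sol :: "(real \<Rightarrow> real \<Rightarrow> real \<Rightarrow> real) \<Rightarrow> bool" where
  "euler_couette_sol w \<longleftrightarrow>
     (\<forall>t x y. \<exists>wt wx wy px py.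
        ((\<lambda>t'. w t' x y) has_real_derivative wt) (at t) \<and>
        ((\<lambda>x'. w t x' y) has_real_derivative wx) (at x) \<and>
        ((\<lambda>y'. w t x y') has_real_derivative wy) (at y) \<and>
        ((\<lambda>x'. stream (w t) x' y) has_real_derivative px) (at x) \<and>
        ((\<lambda>y'. stream (w t) x y') has_real_derivative py) (at y) \<and>
        wt + y * wx + ((- py) * wx + px * wy) = 0)"

definition fourier_Txr :: "(real \<Rightarrow> real \<Rightarrow> real) \<Rightarrow> int \<Rightarrow> real \<Rightarrow> complex" where
  "fourier_Txr f k \<xi> = integral ({0..2*pi} \<times> UNIV)
      (\<lambda>(x, y). complex_of_real (f x y) * cis (- (real_of_int k * x + \<xi> * y)))"

definition Hs_norm :: "real \<Rightarrow> (real \<Rightarrow> real \<Rightarrow> real) \<Rightarrow> real" where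
  "Hs_norm s f = sqrt ((1 / (4 * pi\<^sup>2)) *
     (\<Sum>\<^sub>\<infinity> k::int. integral\<^sup>L lborel
        (\<lambda>\<xi>. (1 + (real_of_int k)\<^sup>2 + \<xi>\<^sup>2) powr s * (cmod (fourier_Txr f k \<xi>))\<^sup>2)))"

definition traveling :: "(real \<Rightarrow> real \<Rightarrow> real) \<Rightarrow> real \<Rightarrow> real \<Rightarrow> real \<Rightarrow> real \<Rightarrow> real" where
  "traveling \<Omega> lam t x y = \<Omega> (x + lam * t) y"

end

theory Submission
  imports Defs "HOL-Computational_Algebra.Polynomial"
begin

text \<open>
  A shift in \<open>y\<close> changes the speed of a traveling wave at will, so it suffices to find small steady states, that is
  vorticities that are a function of \<open>y\<^sup>2/2 - \<psi>\<close>. We look for a thin cat's eye: \<open>\<psi> = \<delta>\<^sup>2 \<phi>\<close> and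
  \<open>\<omega> = - 4 \<pi> \<delta> \<nu> h(1 - y\<^sup>2/(2 \<delta>\<^sup>2) + \<phi>)\<close>, supported in \<open>\<bar>y\<bar> \<le> 2 \<delta>\<close>, where \<open>h(t) = exp(-1/t)\<close> for \<open>t > 0\<close> and
  \<open>h = 0\<close> otherwise. As \<open>\<delta> \<rightarrow> 0\<close> the kernel becomes \<open>ln (1 - cos x)\<close>, with Fourier symbol \<open>-2\<pi>/\<bar>k\<bar>\<close> for
  \<open>k \<noteq> 0\<close>, and the linearised problem is resonant exactly at \<open>cos x\<close>. Prescribing the amplitude \<open>a\<close> of \<open>cos x\<close> and
  solving for the strength \<open>\<nu>\<close> removes the resonance; what remains is a contraction in the sup norm, because
  \<open>ln (2 - 2 cos x) + 2 cos x - 1/2\<close> has \<open>L\<^sup>1\<close> norm less than \<open>2 \<pi>\<close>. The amplitude is fixed first and \<open>\<delta>\<close> is then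
  sent to \<open>0\<close>. Since \<open>\<phi>\<close> is a convolution of the vorticity with the logarithmic kernel, the solution is smooth, an
  \<open>x\<close>-derivative of it costs only \<open>\<delta>\<^sup>-\<^sup>\<eta>\<close> for any \<open>\<eta> > 0\<close> and a \<open>y\<close>-derivative costs \<open>1/\<delta>\<close>. Three derivatives in each
  direction give a pointwise bound on the Fourier transform and an \<open>H\<^sup>s\<close> norm of order \<open>\<delta>\<^sup>3\<^sup>/\<^sup>2\<^sup>-\<^sup>s\<^sup>-\<^sup>3\<^sup>\<eta>\<close>.
\<close>

section \<open>The bump function\<close>

text \<open>The threshold \<open>2 \<pi>\<close> comes from the resonant mode itself. Convolving
  \<open>2 cos u\<close> with \<open>cos\<close> gives \<open>2 \<pi> cos\<close>, so with M =
  \<open>bump_mass\<close> the strength is \<open>\<nu>\<close> = 1 / (2 \<pi> M) to leading order,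
  while the remaining kernel \<open>ell\<close> has Lipschitz constant M times its L1 norm. Their
  product is below 1 as soon as that norm is below \<open>2 \<pi>\<close>. The explicit bound 9/5
  \<pi> gives the ratio 9/10; the spare tenth pays for the nonlinear terms, controlled by the
  amplitude, and for the thickness of the layer, controlled by sqrt \<delta>. The second obstacle is
  that the logarithmic kernel grows linearly in |y|, so the relation between vorticity and stream
  function is imposed only in the layer |y| <= 2 \<delta>. Because |\<phi>| <= 1/2, the vorticity
  already vanishes for |y| >= 9/5 \<delta>, so the relation can be cut off at the edge of the layer
  without loss of smoothness.\<close>

definition expinv :: "real poly \<Rightarrow> real \<Rightarrow> real" where
  "expinv p t = (if 0 < t then poly p (1 / t) * exp (- (1 / t)) else 0)"

text \<open>The functions p(1/t) exp(-1/t) are closed under differentiation: the inner derivative of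
  1/t brings out X^2 and turns p into p - p'. Every derivative of the bump is thus an instance of
  \<open>expinv\<close>, bounded and zero on the same half-line.\<close>

definition expinv_deriv :: "real poly \<Rightarrow> real poly" where
  "expinv_deriv p = [:0, 0, 1:] * (p - pderiv p)"

lemma power_times_exp_minus_le:
  fixes u :: real assumes "0 \<le> u" shows "u ^ n * exp (- u) \<le> real n ^ n"
proof (cases "n = 0")
  case False
  have "(u / n) ^ n \<le> exp (u / n) ^ n"
    proof (intro power_mono)
    show "u / n \<le> exp (u / n)" using exp_ge_add_one_self[of "u / n"] by linarith
  qed (use assms in auto)
  also have "\<dots> = exp u" using False by (simp flip: exp_of_nat_mult)
  finally have "u ^ n \<le> n ^ n * exp u" using False by (simp add: power_divide field_simps)
  then show ?thesis by (simp add: exp_minus field_simps)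
qed (use assms in auto)

text \<open>The power u^n is carried along because removing the constant coefficient of p leaves u
  times a shorter polynomial; the induction hypothesis is then used at n + 1.\<close>

lemma poly_times_exp_minus_bounded:
  fixes p :: "real poly"
  shows "\<exists>C. \<forall>u\<ge>0. \<bar>u ^ n * poly p u * exp (- u)\<bar> \<le> C"
proof (induction p arbitrary: n)
  case 0 then show ?case by auto
next
  case (pCons c p)
  obtain C where C: "\<bar>u ^ Suc n * poly p u * exp (- u)\<bar> \<le> C" if "u \<ge> 0" for u
    using pCons(2)[of "Suc n"] by auto
  show ?case
  proof (intro exI[of _ "\<bar>c\<bar> * real n ^ n + C"] allI impI)
    fix u :: real assume u: "0 \<le> u"
    have "u ^ n * poly (pCons c p) u * exp (- u) = c * (u ^ n * exp (- u)) + u ^ Suc n * poly p u * exp (- u)"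
      by (simp add: algebra_simps)
    also have "\<bar>\<dots>\<bar> \<le> \<bar>c\<bar> * (u ^ n * exp (- u)) + C"
      using C[OF u] u by (intro order_trans[OF abs_triangle_ineq] add_mono) (auto simp: abs_mult)
    also have "\<dots> \<le> \<bar>c\<bar> * real n ^ n + C"
      using power_times_exp_minus_le[OF u, of n] by (simp add: mult_left_mono)
    finally show "\<bar>u ^ n * poly (pCons c p) u * exp (- u)\<bar> \<le> \<bar>c\<bar> * real n ^ n + C" .
  qed
qed

lemma expinv_bounded: "\<exists>C>0. \<forall>t. \<bar>expinv p t\<bar> \<le> C"
proof -
  obtain C where C: "\<bar>poly p u * exp (- u)\<bar> \<le> C" if "u \<ge> 0" for u
    using poly_times_exp_minus_bounded[of 0 p] by auto
  have "\<bar>expinv p t\<bar> \<le> \<bar>C\<bar> + 1" for t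
    using C[of "1 / t"] by (auto simp: expinv_def)
  then show ?thesis by (intro exI[of _ "\<bar>C\<bar> + 1"]) auto
qed

lemma expinv_nonpos [simp]: "t \<le> 0 \<Longrightarrow> expinv p t = 0"
  by (simp add: expinv_def)

lemma DERIV_expinv: "(expinv p has_real_derivative expinv (expinv_deriv p) t) (at t)"
proof -
  consider "t < 0" | "t = 0" | "t > 0" by linarith
  then show ?thesis
  proof cases
    case 1
    have "((\<lambda>_. 0) has_real_derivative 0) (at t)" by simp
    then have "(expinv p has_real_derivative 0) (at t)"
      by (rule has_field_derivative_transform_within_open[of _ _ _ "{..<0}"]) (use 1 in auto)
    with 1 show ?thesis by simp
  next
    case 3
    have "((\<lambda>t. poly p (1 / t) * exp (- (1 / t))) has_real_derivative
        (poly (pderiv p) (1 / t) * (- 1 / t\<^sup>2)) * exp (- (1 / t)) + exp (- (1 / t)) * (1 / t\<^sup>2) * poly p (1 / t)) (at t)"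
      using 3 by (auto intro!: derivative_eq_intros DERIV_chain2[OF poly_DERIV] simp: power2_eq_square)
    moreover have "(poly (pderiv p) (1 / t) * (- 1 / t\<^sup>2)) * exp (- (1 / t)) + exp (- (1 / t)) * (1 / t\<^sup>2) * poly p (1 / t)
       = expinv (expinv_deriv p) t"
      using 3 by (simp add: expinv_def expinv_deriv_def power2_eq_square field_simps)
    ultimately have "((\<lambda>t. poly p (1 / t) * exp (- (1 / t))) has_real_derivative expinv (expinv_deriv p) t) (at t)"
      by simp
    then show ?thesis
      by (rule has_field_derivative_transform_within_open[of _ _ _ "{0<..}"]) (use 3 in \<open>auto simp: expinv_def\<close>)
  next
    case 2
    obtain C where C: "C > 0" "\<And>t. \<bar>expinv ([:0, 0, 1:] * p) t\<bar> \<le> C" using expinv_bounded by blast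
    \<comment> \<open>Two powers of t are traded for a factor X^2 in the polynomial. The other
      factor stays bounded, so the difference quotient at 0 is O(h).\<close>
    have eq: "expinv p t = t\<^sup>2 * expinv ([:0, 0, 1:] * p) t" for t
      by (simp add: expinv_def field_simps power2_eq_square)
    have "((\<lambda>h. expinv p h / h) \<longlongrightarrow> 0) (at 0)"
    proof (rule Lim_null_comparison)
      show "\<forall>\<^sub>F h in at 0. norm (expinv p h / h) \<le> C * \<bar>h\<bar>"
      proof (rule always_eventually, rule allI)
        fix h :: real
        have "norm (expinv p h / h) = \<bar>h\<bar> * \<bar>expinv ([:0, 0, 1:] * p) h\<bar>"
          by (subst eq) (simp add: power2_eq_square abs_mult)
        also have "\<dots> \<le> C * \<bar>h\<bar>" using C(2)[of h] by (subst mult.commute, intro mult_right_mono) auto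
        finally show "norm (expinv p h / h) \<le> C * \<bar>h\<bar>" .
      qed
      show "((\<lambda>h. C * \<bar>h\<bar>) \<longlongrightarrow> 0) (at 0)" by (auto intro!: tendsto_eq_intros)
    qed
    then show ?thesis using 2 by (simp add: DERIV_def)
  qed
qed

lemma continuous_on_expinv [continuous_intros]:
  "continuous_on S f \<Longrightarrow> continuous_on S (\<lambda>x. expinv p (f x))"
  using continuous_on_compose2[of UNIV "expinv p" S f] DERIV_continuous_on[OF DERIV_expinv[of p, THEN has_field_derivative_at_within]]
  by (auto simp: continuous_on_eq_continuous_within)

abbreviation bump :: "real \<Rightarrow> real" where "bump \<equiv> expinv 1"
abbreviation bump' :: "real \<Rightarrow> real" where "bump' \<equiv> expinv (expinv_deriv 1)"

lemma bump'_eq: "bump' t = (if 0 < t then exp (- (1 / t)) / t\<^sup>2 else 0)"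
  by (simp add: expinv_def expinv_deriv_def power2_eq_square)

lemma bump'_nonneg: "0 \<le> bump' t" by (simp add: bump'_eq)
lemma bump'_pos: "0 < t \<Longrightarrow> 0 < bump' t" by (simp add: bump'_eq)

lemma bump_bounds: "0 \<le> bump t" "bump t \<le> 1"
  by (auto simp: expinv_def)

lemma bump_less: "0 < s \<Longrightarrow> s < t \<Longrightarrow> bump s < bump t"
  by (simp add: expinv_def frac_less2)

lemma bump'_lipschitz: "\<exists>C>0. \<forall>s t. \<bar>bump' s - bump' t\<bar> \<le> C * \<bar>s - t\<bar>"
proof -
  obtain C where C: "C > 0" "\<And>t. \<bar>expinv (expinv_deriv (expinv_deriv 1)) t\<bar> \<le> C"
    using expinv_bounded by blast
  have "norm (bump' s - bump' t) \<le> C * norm (s - t)" for s t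
    by (rule field_differentiable_bound[of UNIV bump']) (auto intro: has_field_derivative_at_within DERIV_expinv C)
  then show ?thesis using C(1) by auto
qed

text \<open>Mean value theorem for u -> bump(t + u) - bump'(t) u, whose derivative is at most C r on
  [-r, r]. The two-point form serves both the Lipschitz estimates and, with u2 = 0, the expansion
  about the shear flow.\<close>

lemma bump_linearization:
  assumes lip: "\<And>s t. \<bar>bump' s - bump' t\<bar> \<le> C * \<bar>s - t\<bar>" and r: "\<bar>u1\<bar> \<le> r" "\<bar>u2\<bar> \<le> r" and "C \<ge> 0"
  shows "\<bar>bump (t + u1) - bump (t + u2) - bump' t * (u1 - u2)\<bar> \<le> C * r * \<bar>u1 - u2\<bar>"
proof -
  have d: "((\<lambda>u. bump (t + u) - bump' t * u) has_real_derivative (bump' (t + u) - bump' t)) (at u within {- r..r})" for u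
    by (auto intro!: derivative_eq_intros DERIV_chain2[OF DERIV_expinv] has_field_derivative_at_within[OF DERIV_chain2[OF DERIV_expinv]])
  have b: "norm (bump' (t + u) - bump' t) \<le> C * r" if "u \<in> {- r..r}" for u
  proof -
    have "\<bar>bump' (t + u) - bump' t\<bar> \<le> C * \<bar>u\<bar>" using lip[of "t + u" t] by simp
    also have "\<dots> \<le> C * r" using that \<open>C \<ge> 0\<close> by (intro mult_left_mono) auto
    finally show ?thesis by simp
  qed
  have "norm ((bump (t + u1) - bump' t * u1) - (bump (t + u2) - bump' t * u2)) \<le> C * r * norm (u1 - u2)"
    by (rule field_differentiable_bound[OF _ d b]) (use r in auto)
  then show ?thesis by (simp add: algebra_simps)
qed

section \<open>The logarithmic kernel\<close>

lemma integrable_lborel_Times: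
  fixes f g :: "real \<Rightarrow> real"
  assumes f: "integrable lborel f" and g: "integrable lborel g"
  shows "integrable lborel (\<lambda>q. f (fst q) * g (snd q))"
    and "(LINT q|lborel. f (fst q) * g (snd q)) = (LINT u|lborel. f u) * (LINT v|lborel. g v)"
proof -
  have [measurable]: "f \<in> borel_measurable borel" "g \<in> borel_measurable borel"
    using f g by (auto dest: borel_measurable_integrable)
  have *: "integrable (lborel \<Otimes>\<^sub>M lborel) (\<lambda>q. f (fst q) * g (snd q))"
  proof (rule lborel_pair.Fubini_integrable)
    show "integrable lborel (\<lambda>x. LBINT y. norm (f (fst (x, y)) * g (snd (x, y))))"
      using f g by (simp add: abs_mult)
    show "AE x in lborel. integrable lborel (\<lambda>y. f (fst (x, y)) * g (snd (x, y)))"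
      using g by simp
  qed simp
  then show "integrable lborel (\<lambda>q. f (fst q) * g (snd q))" by (simp add: lborel_prod)
  show "(LINT q|lborel. f (fst q) * g (snd q)) = (LINT u|lborel. f u) * (LINT v|lborel. g v)"
    using lborel_pair.integral_fst'[OF *] by (simp add: lborel_prod)
qed

lemma has_bochner_integral_lborel_reflect:
  fixes f :: "'a::euclidean_space \<Rightarrow> real"
  assumes "has_bochner_integral lborel f i"
  shows "has_bochner_integral lborel (\<lambda>q. f (p - q)) i"
proof -
  have eq: "distr lborel borel (\<lambda>q. p - q) = (lborel :: 'a measure)"
    using lborel_affine[of "-1" p] by (simp add: density_1)
  have [measurable]: "f \<in> borel_measurable borel"
    using assms by (auto dest: borel_measurable_has_bochner_integral)
  have "integrable (distr lborel borel (\<lambda>q. p - q)) f" "integral\<^sup>L (distr lborel borel (\<lambda>q. p - q)) f = i"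
    using assms eq by (simp_all add: has_bochner_integral_iff)
  then show ?thesis
    by (simp_all add: has_bochner_integral_iff integrable_distr_eq integral_distr)
qed

lemma has_bochner_integral_lborel_translate:
  fixes f :: "'a::euclidean_space \<Rightarrow> real"
  assumes "has_bochner_integral lborel f i"
  shows "has_bochner_integral lborel (\<lambda>q. f (q + p)) i"
proof -
  have "has_bochner_integral lborel (\<lambda>q. f (p - (0 - q))) i"
    by (rule has_bochner_integral_lborel_reflect[of "\<lambda>q. f (p - q)", OF has_bochner_integral_lborel_reflect[OF assms]])
  then show ?thesis by (simp add: add.commute)
qed

lemma AE_lborel_snd_neq: "AE q in (lborel :: (real \<times> real) measure). snd q \<noteq> y"
proof -
  have "negligible {q :: real \<times> real. q \<bullet> (0, 1) = y}"
    by (rule negligible_standard_hyperplane) (auto simp: Basis_prod_def)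
  then have "AE q in lebesgue. q \<bullet> ((0, 1) :: real \<times> real) \<noteq> y"
    by (auto simp: negligible_iff_null_sets elim!: AE_I[rotated 2] intro: AE_I')
  then show ?thesis by (auto simp: AE_completion_iff inner_prod_def)
qed

lemma AE_lborel_fst:
  assumes "AE x in (lborel :: real measure). P x" and "{x. P x} \<in> sets borel"
  shows "AE q in (lborel :: (real \<times> real) measure). P (fst q)"
proof -
  have [measurable]: "Measurable.pred lborel P" using assms(2) by (simp add: pred_def)
  have "{q \<in> space (lborel \<Otimes>\<^sub>M lborel). P (fst q)} \<in> sets (lborel \<Otimes>\<^sub>M (lborel :: real measure))"
    by measurable
  then have "AE q in (lborel \<Otimes>\<^sub>M lborel :: (real \<times> real) measure). P (fst q)"
    by (rule lborel_pair.AE_pair_measure) (use assms(1) in auto)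
  then show ?thesis by (simp only: lborel_prod)
qed

lemma AE_lborel_cos_neq_1: "AE u in lborel. cos (x - u) \<noteq> (1 :: real)"
proof -
  have "{u. cos (x - u) = 1} \<subseteq> range (\<lambda>n::int. x - of_int n * 2 * pi)"
    by (force simp: cos_one_2pi_int image_iff algebra_simps)
  then have "countable {u. cos (x - u) = 1}" by (rule countable_subset) simp
  then show ?thesis
    using AE_not_in[OF countable_imp_null_set_lborel] by force
qed

lemma AE_nonsingular:
  "AE q in (lborel :: (real \<times> real) measure). cos (x - fst q) \<noteq> 1 \<and> snd q \<noteq> y"
  using AE_lborel_fst[OF AE_lborel_cos_neq_1[of x]] AE_lborel_snd_neq[of y] by auto

section \<open>Model singularities and elementary bounds for the kernel\<close>

lemma integrable_powr_symmetric:
  fixes a R :: real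
  assumes "-1 < a" "0 \<le> R"
  shows "has_bochner_integral lborel (\<lambda>u. indicator {-R..R} u * \<bar>u\<bar> powr a) (2 * R powr (a + 1) / (a + 1))"
proof -
  let ?I = "R powr (a + 1) / (a + 1)"
  have "(\<integral>\<^sup>+x. ennreal (indicat_real {0..R} x * (x::real) powr a) \<partial>lborel) = ?I"
  proof -
    show ?thesis
      by (rule nn_integral_has_integral_lebesgue) (use has_integral_powr_from_0[OF assms] in auto)
  qed
  then have *: "has_bochner_integral lborel (\<lambda>u::real. indicator {0..R} u * u powr a) ?I"
    using assms by (intro has_bochner_integral_nn_integral) auto
  have "has_bochner_integral lborel (\<lambda>u::real. indicator {0..R} (0 - u) * (0 - u) powr a) ?I"
    by (rule has_bochner_integral_lborel_reflect[OF *])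
  from has_bochner_integral_add[OF * this]
  have "has_bochner_integral lborel (\<lambda>u. indicator {0..R} u * u powr a + indicator {0..R} (- u) * (- u) powr a) (?I + ?I)"
    by simp
  moreover have "(\<lambda>u. indicator {0..R} u * u powr a + indicator {0..R} (- u) * (- u) powr a) = (\<lambda>u. indicator {-R..R} u * \<bar>u\<bar> powr a)"
    by (rule ext) (auto simp: indicator_def)
  ultimately show ?thesis by (simp add: add_divide_distrib[symmetric])
qed

text \<open>Taylor's bound x - x^3/6 - x^4/24 is at least x (1 - 64/150 - 512/3000) on [0, 8/5], an
  interval containing [0, \<pi>/2], and the bracket exceeds 2/5.\<close>

lemma sin_ge_two_fifths: assumes "0 \<le> x" "x \<le> pi / 2" shows "2 / 5 * x \<le> sin x"
proof -
  have 1: "x - x ^ 3 / 6 - x ^ 4 / 24 \<le> sin x"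
  proof -
    have "{..<4} = {0, 1, 2, 3::nat}" by auto
    then have "(\<Sum>m<4. sin_coeff m * x ^ m) = x - x ^ 3 / 6"
      by (simp add: sin_coeff_def fact_numeral)
    then show ?thesis
      using Maclaurin_sin_bound[of x 4] assms by (auto simp: fact_numeral abs_if split: if_splits)
  qed
  have x: "x \<le> 8 / 5" using assms pi_approx by simp
  have x3: "x ^ 3 \<le> x * (64 / 25)"
    using mult_left_mono[OF power_mono[OF x assms(1), of 2] assms(1)] by (simp add: power_divide eval_nat_numeral mult.assoc)
  have x4: "x ^ 4 \<le> x * (512 / 125)"
    using mult_left_mono[OF power_mono[OF x assms(1), of 3] assms(1)] by (simp add: power_divide eval_nat_numeral mult.assoc)
  show ?thesis using 1 x3 x4 assms(1) by linarith
qed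

text \<open>The half-angle formula yields 2/25; it is weakened to 1/16 so that the bound is the
  square of u/4 and its roots are simple.\<close>

lemma one_minus_cos_ge: assumes "\<bar>u\<bar> \<le> pi" shows "u\<^sup>2 / 16 \<le> 1 - cos u"
proof -
  have "2 / 5 * (\<bar>u\<bar> / 2) \<le> sin (\<bar>u\<bar> / 2)" by (rule sin_ge_two_fifths) (use assms in auto)
  then have "(\<bar>u\<bar> / 5)\<^sup>2 \<le> (sin (\<bar>u\<bar> / 2))\<^sup>2" by (intro power_mono) auto
  also have "(sin (\<bar>u\<bar> / 2))\<^sup>2 = (1 - cos u) / 2"
    using sin_squared_eq[of "\<bar>u\<bar> / 2"] cos_double_cos[of "\<bar>u\<bar> / 2"] by (simp add: cos_abs_real)
  finally have "2 * u\<^sup>2 / 25 \<le> 1 - cos u" by (simp add: power_divide)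
  then show ?thesis using zero_le_power2[of u] by linarith
qed

lemma abs_sinh_ge: "\<bar>v :: real\<bar> \<le> \<bar>sinh v\<bar>"
proof -
  have *: "w \<le> sinh w" if "0 \<le> w" for w :: real
  proof -
    have "sinh 0 - 0 \<le> sinh w - w"
      by (rule DERIV_nonneg_imp_nondecreasing[OF that, of "\<lambda>w. sinh w - w"])
         (auto intro!: exI derivative_eq_intros simp: cosh_real_ge_1)
    then show ?thesis by simp
  qed
  show ?thesis using *[of v] *[of "- v"] by (cases "v \<ge> 0") auto
qed

lemma cosh_minus_1_eq: "cosh v - 1 = 2 * (sinh (v / 2))\<^sup>2" for v :: real
  using cosh_double_cosh[of "v / 2"] cosh_square_eq[of "v / 2"] by simp

lemma cosh_minus_1_ge: "v\<^sup>2 / 2 \<le> cosh v - (1 :: real)"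
proof -
  have "\<bar>v / 2\<bar>\<^sup>2 \<le> \<bar>sinh (v / 2)\<bar>\<^sup>2" by (rule power_mono[OF abs_sinh_ge]) auto
  then show ?thesis unfolding cosh_minus_1_eq by (simp add: power_divide)
qed

lemma kernel_arg_ge:
  assumes "\<bar>u\<bar> \<le> pi" shows "(u\<^sup>2 + v\<^sup>2) / 16 \<le> cosh v - cos (u::real)"
  using one_minus_cos_ge[OF assms] cosh_minus_1_ge[of v] zero_le_power2[of v]
  unfolding add_divide_distrib by linarith

lemma kernel_arg_pos: "(v::real) \<noteq> 0 \<or> cos u \<noteq> 1 \<Longrightarrow> 0 < cosh v - cos (u :: real)"
proof -
  assume "v \<noteq> 0 \<or> cos u \<noteq> 1"
  moreover have "v \<noteq> 0 \<Longrightarrow> 0 < v\<^sup>2" by simp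
  ultimately show "0 < cosh v - cos u" using cosh_minus_1_ge[of v] cos_le_one[of u] zero_le_power2[of v] by linarith
qed

text \<open>For small c, -ln c = 4 ln(c powr (-1/4)) <= 4 c powr (-1/4). The exponent 1/4 is chosen
  because the argument of the kernel is at least u^2/16: the result is a multiple of |u| powr
  (-1/2), integrable over a period and independent of v.\<close>

lemma abs_ln_le:
  fixes z c :: real
  assumes "0 < z" "z \<le> c" shows "\<bar>ln c\<bar> \<le> c + 4 * z powr (- (1 / 4))"
proof -
  have c: "0 < c" using assms by simp
  have "ln (c powr (- (1/4))) \<le> c powr (- (1/4)) - 1" by (rule ln_le_minus_one) (use c in simp)
  then have "- ln c \<le> 4 * c powr (- (1/4))" using c by (simp add: ln_powr)
  also have "c powr (- (1/4)) \<le> z powr (- (1/4))" using assms by (intro powr_mono2') auto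
  finally have 1: "- ln c \<le> 4 * z powr (- (1/4))" by simp
  have 2: "ln c \<le> c" using ln_le_minus_one[OF c] by simp
  have 3: "0 \<le> z powr (- (1/4))" by simp
  show ?thesis unfolding abs_le_iff using 1 2 3 c by linarith
qed

lemma square_powr: "0 \<le> x \<Longrightarrow> (x\<^sup>2) powr a = x powr (2 * a)" for x a :: real
  by (cases "x = 0") (simp_all add: powr_def ln_realpow)

lemma powr_quarter_sq: "(u\<^sup>2 / 16) powr (- (1/4)) = 2 * \<bar>u\<bar> powr (- (1/2))" for u :: real
proof -
  have "(u\<^sup>2 / 16) = (\<bar>u\<bar> / 4)\<^sup>2" by (simp add: power_divide)
  also have "\<dots> powr (- (1/4)) = (\<bar>u\<bar> / 4) powr (- (1/2))"
    by (subst square_powr) auto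
  also have "\<dots> = \<bar>u\<bar> powr (- (1/2)) / 4 powr (- (1/2))" by (simp add: powr_divide)
  also have "(4::real) powr (- (1/2)) = 1 / 2" by (simp add: powr_minus powr_half_sqrt real_sqrt_unique)
  finally show ?thesis by simp
qed

lemma abs_ln_kernel_le:
  fixes u v :: real
  assumes "\<bar>u\<bar> \<le> pi" "u \<noteq> 0" "\<bar>v\<bar> \<le> R"
  shows "\<bar>ln (cosh v - cos u)\<bar> \<le> cosh R + 1 + 8 * \<bar>u\<bar> powr (- (1/2))"
proof -
  have "u\<^sup>2 / 16 \<le> cosh v - cos u" using kernel_arg_ge[OF assms(1), of v] zero_le_power2[of v]
    unfolding add_divide_distrib by linarith
  then have "\<bar>ln (cosh v - cos u)\<bar> \<le> (cosh v - cos u) + 4 * (u\<^sup>2 / 16) powr (- (1/4))"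
    by (intro abs_ln_le) (use assms in auto)
  moreover have "cosh v \<le> cosh R"
    using cosh_real_nonneg_le_iff[of "\<bar>v\<bar>" R] assms(3) by auto
  ultimately show ?thesis using cos_ge_minus_one[of u] unfolding powr_quarter_sq by linarith
qed

lemma sinh_le_times_cosh: "\<bar>sinh v\<bar> \<le> \<bar>v\<bar> * cosh (v :: real)"
proof -
  have *: "sinh w \<le> w * cosh w" if "0 \<le> w" for w :: real
  proof -
    have "0 * cosh 0 - sinh 0 \<le> w * cosh w - sinh w"
      by (rule DERIV_nonneg_imp_nondecreasing[OF that, of "\<lambda>w. w * cosh w - sinh w"])
         (auto intro!: exI derivative_eq_intros)
    then show ?thesis by simp
  qed
  show ?thesis using *[of "\<bar>v\<bar>"] by simp
qed

lemma cosh_minus_1_le: assumes "\<bar>v\<bar> \<le> 1" shows "cosh v - (1::real) \<le> v\<^sup>2"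
proof -
  have "cosh (1::real) \<le> 2"
  proof -
    have "exp (- 1 :: real) \<le> 1" by simp
    then have "exp 1 + exp (- 1 :: real) \<le> 4" using exp_le by linarith
    then show ?thesis by (simp add: cosh_field_def)
  qed
  then have c: "(cosh (1/2 :: real))\<^sup>2 \<le> 3 / 2" using cosh_double_cosh[of "1/2::real"] by simp
  have "cosh \<bar>v / 2\<bar> \<le> cosh (1/2)" by (subst cosh_real_nonneg_le_iff) (use assms in auto)
  then have "cosh (v / 2) \<le> cosh (1/2)" by (simp only: cosh_real_abs)
  then have "(cosh (v/2))\<^sup>2 \<le> 3/2" by (intro order_trans[OF power_mono c]) auto
  have "(sinh (v/2))\<^sup>2 \<le> (\<bar>v/2\<bar> * cosh (v/2))\<^sup>2"
    using power_mono[OF sinh_le_times_cosh[of "v/2"], of 2] by simp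
  also have "\<dots> = (v\<^sup>2 / 4) * (cosh (v/2))\<^sup>2" by (simp add: power_mult_distrib power_divide)
  also have "\<dots> \<le> (v\<^sup>2 / 4) * (3 / 2)" by (intro mult_left_mono) (fact, simp)
  finally show ?thesis unfolding cosh_minus_1_eq using zero_le_power2[of v] by linarith
qed

lemma one_minus_cos_pos: assumes "\<bar>u\<bar> \<le> pi" "u \<noteq> 0" shows "0 < 1 - cos u"
proof -
  have "0 < u\<^sup>2 / 16" using assms by simp
  with one_minus_cos_ge[OF assms(1)] show ?thesis by linarith
qed

text \<open>The difference is ln(1 + t) with t = (cosh v - 1) / (1 - cos u), and ln(1 + t) <= 4 t
  powr (1/4) because 1 + y^4 <= (1 + y)^4. The quarter power splits into |v| powr (1/2), small
  across a thin layer, and |u| powr (-1/2), integrable along it. This is the origin of every sqrt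
  \<delta> below.\<close>

lemma kernel_diff_le:
  fixes u v :: real
  assumes "\<bar>u\<bar> \<le> pi" "u \<noteq> 0" "\<bar>v\<bar> \<le> 1"
  shows "\<bar>ln (cosh v - cos u) - ln (1 - cos u)\<bar> \<le> 8 * (\<bar>v\<bar> powr (1/2) * \<bar>u\<bar> powr (- (1/2)))"
proof -
  define t where "t = (cosh v - 1) / (1 - cos u)"
  have z: "0 < u\<^sup>2 / 16" "u\<^sup>2 / 16 \<le> 1 - cos u" using assms one_minus_cos_ge by auto
  then have p: "0 < 1 - cos u" by linarith
  have t0: "0 \<le> t" unfolding t_def using cosh_real_ge_1[of v] p by simp
  have "t \<le> v\<^sup>2 / (u\<^sup>2 / 16)"
    unfolding t_def using cosh_minus_1_le[OF assms(3)] cosh_real_ge_1[of v] z by (intro frac_le) auto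
  then have t1: "t powr (1/4) \<le> (v\<^sup>2 / (u\<^sup>2 / 16)) powr (1/4)" using t0 by (intro powr_mono2) auto
  also have "\<dots> = (v\<^sup>2) powr (1/4) * (u\<^sup>2 / 16) powr (- (1/4))"
  proof -
    have *: "(A / B) powr q = A powr q * B powr (- q)" if "0 \<le> A" "0 \<le> B" for A B q :: real
      using that by (simp add: powr_divide powr_minus_divide)
    show ?thesis by (rule *) auto
  qed
  also have "(v\<^sup>2) powr (1/4) = \<bar>v\<bar> powr (1/2)"
    using square_powr[of "\<bar>v\<bar>" "1/4"] by simp
  finally have t2: "t powr (1/4) \<le> 2 * (\<bar>v\<bar> powr (1/2) * \<bar>u\<bar> powr (- (1/2)))"
    unfolding powr_quarter_sq by (simp add: algebra_simps)
  have "ln (cosh v - cos u) - ln (1 - cos u) = ln (1 + t)"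
    using p cosh_real_ge_1[of v] by (subst ln_divide_pos[symmetric]) (auto simp: t_def field_simps)
  moreover have "ln (1 + t) \<le> 4 * t powr (1/4)"
  proof -
    have "1 + t \<le> (1 + t powr (1/4)) ^ 4"
    proof -
      have "t = (t powr (1/4)) ^ 4" using t0
        by (cases "t = 0") (auto simp: powr_power)
      moreover have "1 + y ^ 4 \<le> (1 + y) ^ 4" if "y \<ge> 0" for y :: real
        using that by (simp add: eval_nat_numeral algebra_simps)
      note this[of "t powr (1/4)", OF powr_ge_zero]
      ultimately show ?thesis by linarith
    qed
    then have "ln (1 + t) \<le> ln ((1 + t powr (1/4)) ^ 4)" using t0 by (subst ln_le_cancel_iff) (auto intro: add_pos_nonneg)
    also have "\<dots> = 4 * ln (1 + t powr (1/4))" by (simp add: ln_realpow add_pos_nonneg)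
    also have "\<dots> \<le> 4 * t powr (1/4)" using ln_add_one_self_le_self[of "t powr (1/4)"] by simp
    finally show ?thesis .
  qed
  moreover have "0 \<le> ln (1 + t)" using t0 by simp
  ultimately show ?thesis using t2 by simp
qed

text \<open>Interpolation: a powr (2 - e) * b powr e is at most max(a, b)^2. A planar singularity of
  order 1/distance becomes a product of two one-dimensional powers, both with exponent above
  -1.\<close>

lemma div_sum_squares_le:
  fixes a b :: real
  assumes "0 \<le> a" "0 < b" "0 < e" "e < 1"
  shows "a / (a\<^sup>2 + b\<^sup>2) \<le> a powr (e - 1) * b powr (- e)"
proof (cases "a = 0")
  case False
  then have a: "0 < a" using assms by simp
  define m where "m = max a b"
  have "a powr (2 - e) * b powr e \<le> m powr (2 - e) * m powr e"
    unfolding m_def using a assms by (intro mult_mono powr_mono2) auto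
  also have "\<dots> = m\<^sup>2" using a by (simp add: powr_add[symmetric] m_def)
  also have "\<dots> \<le> a\<^sup>2 + b\<^sup>2" by (auto simp: m_def max_def)
  finally have *: "a powr (2 - e) * b powr e \<le> a\<^sup>2 + b\<^sup>2" .
  have "a = (a powr (e - 1) * b powr (- e)) * (a powr (2 - e) * b powr e)"
  proof -
    have "(a powr (e - 1) * b powr (- e)) * (a powr (2 - e) * b powr e)
        = (a powr (e - 1) * a powr (2 - e)) * (b powr (- e) * b powr e)" by (simp only: mult_ac)
    also have "\<dots> = a" using a assms(2) by (simp add: powr_add[symmetric])
    finally show ?thesis by simp
  qed
  also have "\<dots> \<le> (a powr (e - 1) * b powr (- e)) * (a\<^sup>2 + b\<^sup>2)"
    by (rule mult_left_mono[OF *]) simp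
  finally show ?thesis using a assms by (subst pos_divide_le_eq) (auto intro: add_pos_pos)
qed simp

text \<open>The exponent e stays free: with e close to 0 the factor in v is nearly bounded, which is
  why derivatives in x will cost almost nothing.\<close>

lemma kernel_x_le:
  fixes u v :: real
  assumes "\<bar>u\<bar> \<le> pi" "v \<noteq> 0" "0 < e" "e < 1"
  shows "\<bar>sin u / (cosh v - cos u)\<bar> \<le> 16 * (\<bar>u\<bar> powr (e - 1) * \<bar>v\<bar> powr (- e))"
proof -
  have "\<bar>sin u / (cosh v - cos u)\<bar> = \<bar>sin u\<bar> / (cosh v - cos u)"
    using kernel_arg_pos[of v u] assms by simp
  also have "\<dots> \<le> \<bar>u\<bar> / ((\<bar>u\<bar>\<^sup>2 + \<bar>v\<bar>\<^sup>2) / 16)"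
    using kernel_arg_ge[OF assms(1), of v] assms(2) by (intro frac_le abs_sin_x_le_abs_x) (auto intro: add_nonneg_pos)
  also have "\<dots> = 16 * (\<bar>u\<bar> / (\<bar>u\<bar>\<^sup>2 + \<bar>v\<bar>\<^sup>2))" by simp
  also have "\<dots> \<le> 16 * (\<bar>u\<bar> powr (e - 1) * \<bar>v\<bar> powr (- e))"
    using assms by (intro mult_left_mono div_sum_squares_le) auto
  finally show ?thesis .
qed

lemma kernel_y_le:
  fixes u v :: real
  assumes "\<bar>u\<bar> \<le> pi" "u \<noteq> 0" "\<bar>v\<bar> \<le> R" "0 < e" "e < 1"
  shows "\<bar>sinh v / (cosh v - cos u)\<bar> \<le> 16 * cosh R * (\<bar>u\<bar> powr (- e) * \<bar>v\<bar> powr (e - 1))"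
proof -
  have c: "cosh v \<le> cosh R" using cosh_real_nonneg_le_iff[of "\<bar>v\<bar>" R] assms(3) by auto
  have k: "(u\<^sup>2 + v\<^sup>2) / 16 \<le> cosh v - cos u" "0 < (u\<^sup>2 + v\<^sup>2) / 16"
    using kernel_arg_ge[OF assms(1), of v] assms(2) by (auto intro: add_pos_nonneg)
  then have "\<bar>sinh v / (cosh v - cos u)\<bar> = \<bar>sinh v\<bar> / (cosh v - cos u)" by simp
  also have "\<dots> \<le> (\<bar>v\<bar> * cosh R) / ((\<bar>v\<bar>\<^sup>2 + \<bar>u\<bar>\<^sup>2) / 16)"
    using k sinh_le_times_cosh[of v] mult_left_mono[OF c, of "\<bar>v\<bar>"] by (intro frac_le) (auto simp: add.commute)
  also have "\<dots> = 16 * cosh R * (\<bar>v\<bar> / (\<bar>v\<bar>\<^sup>2 + \<bar>u\<bar>\<^sup>2))" by simp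
  also have "\<dots> \<le> 16 * cosh R * (\<bar>v\<bar> powr (e - 1) * \<bar>u\<bar> powr (- e))"
    using assms by (intro mult_left_mono div_sum_squares_le) auto
  finally show ?thesis by (simp add: mult.commute)
qed

section \<open>The logarithm on the circle and its exact integrals\<close>

lemma integrable_bound_interval:
  fixes f g :: "real \<Rightarrow> real"
  assumes [measurable]: "f \<in> borel_measurable borel" and g: "integrable lborel g"
    and "AE u in lborel. u \<in> A \<longrightarrow> \<bar>f u\<bar> \<le> g u" and [measurable]: "A \<in> sets borel"
  shows "integrable lborel (\<lambda>u. indicator A u * f u)"
proof (rule Bochner_Integration.integrable_bound[OF g])
  show "AE x in lborel. norm (indicator A x * f x) \<le> norm (g x)"
    using assms(3) by eventually_elim (auto simp: indicator_def)
qed simp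

lemma integrable_ln_kernel:
  "integrable lborel (\<lambda>u. indicator {-pi..pi} u * ln (2 - 2 * cos u))"
proof -
  define g where "g u = indicator {-pi..pi} u * (2 + ln 2) + 8 * (indicator {-pi..pi} u * \<bar>u\<bar> powr (- (1/2)))" for u :: real
  have g: "integrable lborel g" unfolding g_def
    using integrable_powr_symmetric[of "- (1/2)" pi]
    by (intro Bochner_Integration.integrable_add integrable_mult_right integrable_mult_left)
       (auto simp: has_bochner_integral_iff)
  have ae: "AE u in lborel. u \<in> {-pi..pi} \<longrightarrow> \<bar>ln (2 - 2 * cos u)\<bar> \<le> g u"
    using AE_lborel_singleton[of 0]
  proof eventually_elim
    case (elim u)
    show ?case
    proof
      assume u: "u \<in> {-pi..pi}"
      then have 1: "\<bar>ln (1 - cos u)\<bar> \<le> 2 + 8 * \<bar>u\<bar> powr (- (1/2))"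
        using abs_ln_kernel_le[of u 0 0] elim by auto
      have "0 < 1 - cos u" using one_minus_cos_pos[of u] elim u by (auto simp: abs_le_iff)
      then have "ln (2 - 2 * cos u) = ln 2 + ln (1 - cos u)"
        using ln_mult[of 2 "1 - cos u"] by (simp add: algebra_simps)
      moreover have "0 < ln (2::real)" by simp
      ultimately have "\<bar>ln (2 - 2 * cos u)\<bar> \<le> 2 + ln 2 + 8 * \<bar>u\<bar> powr (- (1/2))" using 1 by linarith
      then show "\<bar>ln (2 - 2 * cos u)\<bar> \<le> g u" using u by (auto simp: g_def)
    qed
  qed
  show ?thesis by (rule integrable_bound_interval[OF _ g ae]) auto
qed

lemma has_bochner_integral_cong_AE_real:
  fixes f g :: "'a \<Rightarrow> real"
  assumes "has_bochner_integral M f i" "g \<in> borel_measurable M" "AE x in M. f x = g x"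
  shows "has_bochner_integral M g i"
  using assms has_bochner_integral_cong_AE[of f M g i] by (auto dest: borel_measurable_has_bochner_integral)

text \<open>Euler's doubling argument. Since (2 - 2 cos u)(2 + 2 cos u) = 2 - 2 cos 2u, the integral
  P of the logarithm at 2u is the sum of two integrals that a reflection identifies, hence 2 P; the
  substitution u -> 2u together with the symmetry about \<pi> evaluates the same integral as
  P.\<close>

lemma has_bochner_integral_ln_kernel_0_pi:
  "has_bochner_integral lborel (\<lambda>u. indicator {0..pi} u * ln (2 - 2 * cos u)) 0"
proof -
  let ?L = "\<lambda>u::real. ln (2 - 2 * cos u)"
  have "integrable lborel (\<lambda>u. indicator {0..pi} u * (indicator {-pi..pi} u * ?L u))"
    using integrable_mult_indicator[OF _ integrable_ln_kernel, of "{0..pi}"] by simp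
  moreover have "(\<lambda>u. indicator {0..pi} u * (indicator {-pi..pi} u * ?L u)) = (\<lambda>u. indicator {0..pi} u * ?L u)"
    using pi_gt_zero by (auto simp: indicator_def simp del: pi_gt_zero)
  ultimately obtain P where P: "has_bochner_integral lborel (\<lambda>u. indicator {0..pi} u * ?L u) P"
    by (auto simp: has_bochner_integral_iff)
  have P1: "has_bochner_integral lborel (\<lambda>u. indicator {0..pi} u * ln (2 + 2 * cos u)) P"
  proof -
    have "has_bochner_integral lborel (\<lambda>u. indicator {0..pi} (pi - u) * ?L (pi - u)) P"
      by (rule has_bochner_integral_lborel_reflect[OF P])
    moreover have "indicator {0..pi} (pi - u) * ?L (pi - u) = indicator {0..pi} u * ln (2 + 2 * cos u)" for u :: real
      by (auto simp: indicator_def cos_diff)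
    ultimately show ?thesis by (simp only:)
  qed
  have P2: "has_bochner_integral lborel (\<lambda>u. indicator {pi..2*pi} u * ?L u) P"
  proof -
    have "has_bochner_integral lborel (\<lambda>u. indicator {0..pi} (2 * pi - u) * ?L (2 * pi - u)) P"
      by (rule has_bochner_integral_lborel_reflect[OF P])
    moreover have "indicator {0..pi} (2 * pi - u) * ?L (2 * pi - u) = indicator {pi..2*pi} u * ?L u" for u :: real
      by (auto simp: indicator_def cos_diff)
    ultimately show ?thesis by (simp only:)
  qed
  have P3: "has_bochner_integral lborel (\<lambda>u. indicator {0..2*pi} u * ?L u) (P + P)"
  proof (rule has_bochner_integral_cong_AE_real[OF has_bochner_integral_add[OF P P2]])
    show "AE u in lborel. indicator {0..pi} u * ?L u + indicator {pi..2*pi} u * ?L u = indicator {0..2*pi} u * ?L u"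
      using AE_lborel_singleton[of pi] by eventually_elim (auto simp: indicator_def)
  qed simp
  have "has_bochner_integral lborel (\<lambda>u. indicator {0..2*pi} (2 * u) * ?L (2 * u)) P"
    using P3 lborel_integrable_real_affine[of "\<lambda>u. indicator {0..2*pi} u * ?L u" 2 0]
      lborel_integral_real_affine[of 2 "\<lambda>u. indicator {0..2*pi} u * ?L u" 0]
    by (simp add: has_bochner_integral_iff)
  moreover have "has_bochner_integral lborel (\<lambda>u. indicator {0..2*pi} (2 * u) * ?L (2 * u)) (P + P)"
  proof (rule has_bochner_integral_cong_AE_real[OF has_bochner_integral_add[OF P P1]])
    show "AE u in lborel. indicator {0..pi} u * ?L u + indicator {0..pi} u * ln (2 + 2 * cos u)
        = indicator {0..2*pi} (2 * u) * ?L (2 * u)"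
      using AE_lborel_singleton[of 0] AE_lborel_singleton[of pi]
    proof eventually_elim
      case (elim u)
      show ?case
      proof (cases "u \<in> {0..pi}")
        case True
        then have "0 < u" "u < pi" using elim by auto
        then have "cos u < 1" "-1 < cos u"
          using cos_monotone_0_pi[of 0 u] cos_monotone_0_pi[of u pi] by auto
        then have "?L u + ln (2 + 2 * cos u) = ln ((2 - 2 * cos u) * (2 + 2 * cos u))"
          by (subst ln_mult) auto
        also have "(2 - 2 * cos u) * (2 + 2 * cos u) = 2 - 2 * cos (2 * u)"
          unfolding cos_double_cos by (simp add: algebra_simps power2_eq_square)
        finally show ?thesis using True by (simp add: algebra_simps)
      qed (auto simp: indicator_def)
    qed
  qed simp
  ultimately have "P = P + P" by (rule has_bochner_integral_eq)
  with P show ?thesis by simp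
qed

lemma has_bochner_integral_even:
  fixes f :: "real \<Rightarrow> real"
  assumes "has_bochner_integral lborel (\<lambda>u. indicator {0..b} u * f u) i"
    and "\<And>u. f (- u) = f u" and [measurable]: "f \<in> borel_measurable borel" and "0 \<le> b"
  shows "has_bochner_integral lborel (\<lambda>u. indicator {-b..b} u * f u) (2 * i)"
proof -
  have "has_bochner_integral lborel (\<lambda>u. indicator {0..b} (0 - u) * f (0 - u)) i"
    by (rule has_bochner_integral_lborel_reflect[OF assms(1)])
  from has_bochner_integral_add[OF assms(1) this]
  have "has_bochner_integral lborel (\<lambda>u. indicator {-b..b} u * f u) (i + i)"
  proof (rule has_bochner_integral_cong_AE_real)
    show "AE u in lborel. indicator {0..b} u * f u + indicator {0..b} (0 - u) * f (0 - u) = indicator {-b..b} u * f u"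
      using AE_lborel_singleton[of 0] by eventually_elim (use assms(2,4) in \<open>auto simp: indicator_def\<close>)
  qed simp
  then show ?thesis by simp
qed

text \<open>This is the Fourier symbol -2\<pi>/k at k = 1. The antiderivative comes from integration
  by parts, using sin^2 u / (1 - cos u) = 1 + cos u.\<close>

lemma has_bochner_integral_ln_kernel_cos:
  "has_bochner_integral lborel (\<lambda>u. indicator {-pi..pi} u * (ln (2 - 2 * cos u) * cos u)) (- 2 * pi)"
proof -
  let ?L = "\<lambda>u::real. ln (2 - 2 * cos u)"
  let ?F = "\<lambda>u::real. ?L u * sin u - u - sin u"
  have int: "integrable lborel (\<lambda>u. indicator {0..pi} u * (?L u * cos u))"
  proof (rule integrable_bound_interval)
    show "integrable lborel (\<lambda>u. \<bar>indicator {-pi..pi} u * ?L u\<bar>)" using integrable_ln_kernel by simp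
    show "AE u in lborel. u \<in> {0..pi} \<longrightarrow> \<bar>?L u * cos u\<bar> \<le> \<bar>indicator {-pi..pi} u * ?L u\<bar>"
    proof (intro AE_I2 impI)
      fix u :: real assume "u \<in> {0..pi}"
      moreover have "\<bar>?L u\<bar> * \<bar>cos u\<bar> \<le> \<bar>?L u\<bar> * 1" by (intro mult_left_mono) auto
      ultimately show "\<bar>?L u * cos u\<bar> \<le> \<bar>indicator {-pi..pi} u * ?L u\<bar>" by (auto simp: abs_mult)
    qed
  qed auto
  have "((\<lambda>u. ?L u * cos u) has_integral (?F pi - ?F 0)) {0..pi}"
  proof (rule fundamental_theorem_of_calculus_interior)
    fix u :: real assume u: "u \<in> {0<..<pi}"
    then have c: "0 < 1 - cos u" using cos_monotone_0_pi[of 0 u] by auto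
    have "(?F has_real_derivative (2 * sin u / (2 - 2 * cos u) * sin u + ?L u * cos u - 1 - cos u)) (at u)"
      using c by (auto intro!: derivative_eq_intros)
    moreover have "2 * sin u / (2 - 2 * cos u) * sin u = 1 + cos u"
    proof -
      have "sin u * sin u = (1 + cos u) * (1 - cos u)"
        using sin_squared_eq[of u] by (simp add: power2_eq_square algebra_simps)
      moreover have "2 * sin u / (2 - 2 * cos u) * sin u = (sin u * sin u) / (1 - cos u)"
        using c by (simp add: divide_simps)
      ultimately show ?thesis using c by simp
    qed
    ultimately show "(?F has_vector_derivative ?L u * cos u) (at u)"
      by (simp add: has_real_derivative_iff_has_vector_derivative)
  next
    have "isCont (\<lambda>u. ?L u * sin u) u" if "u \<in> {0..pi}" for u
    proof (cases "u = 0")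
      case False
      then have "0 < 1 - cos u" using that cos_monotone_0_pi[of 0 u] by auto
      then show ?thesis by (intro continuous_intros) auto
    next
      case True
      \<comment> \<open>At the left endpoint the logarithm blows up like |u| powr (-1/2) at worst,
        and the sine compensates with a power to spare.\<close>
      have "((\<lambda>u. ?L u * sin u) \<longlongrightarrow> 0) (at 0)"
      proof (rule Lim_null_comparison)
        show "\<forall>\<^sub>F u in at 0. norm (?L u * sin u) \<le> (2 + ln 2) * \<bar>u\<bar> + 8 * \<bar>u\<bar> powr (1/2)"
          unfolding eventually_at
        proof (intro exI[of _ pi] conjI ballI impI; (elim conjE)?)
          fix u :: real assume u: "u \<noteq> 0" "dist u 0 < pi"
          have 1: "\<bar>ln (1 - cos u)\<bar> \<le> 2 + 8 * \<bar>u\<bar> powr (- (1/2))"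
            using abs_ln_kernel_le[of u 0 0] u by auto
          have "0 < 1 - cos u" using one_minus_cos_pos[of u] u by auto
          then have "?L u = ln 2 + ln (1 - cos u)"
            using ln_mult[of 2 "1 - cos u"] by (simp add: algebra_simps)
          moreover have "0 < ln (2::real)" by simp
          ultimately have "\<bar>?L u\<bar> \<le> 2 + ln 2 + 8 * \<bar>u\<bar> powr (- (1/2))" using 1 by linarith
          then have "\<bar>?L u\<bar> * \<bar>sin u\<bar> \<le> (2 + ln 2 + 8 * \<bar>u\<bar> powr (- (1/2))) * \<bar>u\<bar>"
            by (intro mult_mono abs_sin_x_le_abs_x) auto
          also have "\<dots> = (2 + ln 2) * \<bar>u\<bar> + 8 * (\<bar>u\<bar> powr (- (1/2)) * \<bar>u\<bar> powr 1)"
            using u by (simp add: algebra_simps)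
          also have "\<bar>u\<bar> powr (- (1/2)) * \<bar>u\<bar> powr 1 = \<bar>u\<bar> powr (1/2)"
            by (subst powr_add[symmetric]) simp
          finally show "norm (?L u * sin u) \<le> (2 + ln 2) * \<bar>u\<bar> + 8 * \<bar>u\<bar> powr (1/2)" by (simp add: abs_mult)
        qed simp
        show "((\<lambda>u::real. (2 + ln 2) * \<bar>u\<bar> + 8 * \<bar>u\<bar> powr (1/2)) \<longlongrightarrow> 0) (at 0)"
          by (auto intro!: tendsto_eq_intros)
      qed
      with True show ?thesis by (simp add: isCont_def)
    qed
    then have "continuous_on {0..pi} (\<lambda>u. ?L u * sin u)" by (simp add: continuous_at_imp_continuous_on)
    then show "continuous_on {0..pi} ?F" by (intro continuous_on_diff continuous_on_id continuous_on_sin) auto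
  qed simp
  then have "integral {0..pi} (\<lambda>u. ?L u * cos u) = - pi" by (simp add: integral_unique)
  moreover have "set_integrable lborel {0..pi} (\<lambda>u. ?L u * cos u)" using int by (simp add: set_integrable_def)
  ultimately have "(LINT u|lborel. indicator {0..pi} u * (?L u * cos u)) = - pi"
    using set_borel_integral_eq_integral(2)[of "{0..pi}" "\<lambda>u. ?L u * cos u"] by (simp add: set_lebesgue_integral_def)
  with int have "has_bochner_integral lborel (\<lambda>u. indicator {0..pi} u * (?L u * cos u)) (- pi)"
    by (simp add: has_bochner_integral_iff)
  from has_bochner_integral_even[OF this] show ?thesis by simp
qed

text \<open>From -ln(2 - 2 cos u) = sum of 2 cos(k u)/k over k >= 1, the first mode is removed. The
  constant acts only on the total mass and is absorbed by the free constant of the stream function;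
  the value 1/2 centres s - s^2, which ranges over [0, 1/4], at 1/8 in the estimate of the L1
  norm.\<close>

definition ell :: "real \<Rightarrow> real" where "ell u = 1/2 - 2 * cos u - ln (2 - 2 * cos u)"

lemma measurable_ell [measurable]: "ell \<in> borel_measurable borel"
  unfolding ell_def by simp

lemma integrable_on_window_continuous:
  fixes f :: "real \<Rightarrow> real" assumes "continuous_on {a..b} f"
  shows "integrable lborel (\<lambda>u. indicator {a..b} u * f u)"
  using borel_integrable_atLeastAtMost'[OF assms] by (simp add: set_integrable_def)

lemma integrable_ell: "integrable lborel (\<lambda>u. indicator {-pi..pi} u * ell u)"
proof -
  have "integrable lborel (\<lambda>u. indicator {-pi..pi} u * (1/2 - 2 * cos u) - indicator {-pi..pi} u * ln (2 - 2 * cos u))"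
    by (intro Bochner_Integration.integrable_diff integrable_ln_kernel integrable_on_window_continuous continuous_intros)
  then show ?thesis by (simp add: ell_def algebra_simps)
qed

lemma has_bochner_integral_ell_cos:
  "has_bochner_integral lborel (\<lambda>u. indicator {-pi..pi} u * (ell u * cos u)) 0"
proof -
  have "has_bochner_integral lborel (\<lambda>u. indicator {-pi..pi} u *\<^sub>R (1/2 * cos u - 2 * cos u * cos u))
     ((sin pi / 2 - pi - sin pi * cos pi) - (sin (-pi) / 2 - (-pi) - sin (-pi) * cos (-pi)))"
  proof (rule has_bochner_integral_FTC_Icc[where F = "\<lambda>u. sin u / 2 - u - sin u * cos u"])
    fix u :: real
    have "((\<lambda>u. sin u / 2 - u - sin u * cos u) has_real_derivative 1/2 * cos u - 2 * cos u * cos u) (at u)"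
    proof -
      have "sin u * sin u = 1 - cos u * cos u" using sin_squared_eq[of u] by (simp add: power2_eq_square)
      then have "sin u * (sin u * 2) = 2 - cos u * (cos u * 2)" by linarith
      then show ?thesis by (auto intro!: derivative_eq_intros simp: algebra_simps)
    qed
    then show "((\<lambda>u. sin u / 2 - u - sin u * cos u) has_vector_derivative 1/2 * cos u - 2 * cos u * cos u) (at u within {-pi..pi})"
      using has_vector_derivative_at_within by (auto simp: has_real_derivative_iff_has_vector_derivative)
  qed (auto intro!: continuous_intros)
  from has_bochner_integral_diff[OF this has_bochner_integral_ln_kernel_cos]
  show ?thesis by (simp add: ell_def algebra_simps)
qed

text \<open>With \<open>s = sin (u/2)\<close> one has \<open>ell u = 2 (2 s - 1 - ln (2 s)) - 4 (s - s\<^sup>2 - 1/8)\<close>. The first bracket is nonnegative with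
  an explicit integral, and the second is uniformly small.\<close>

lemma abs_ell_le:
  assumes "0 < u" "u \<le> pi"
  shows "\<bar>ell u\<bar> \<le> (4 * sin (u/2) - 2 + 24 * (sin (u/2) - (sin (u/2))\<^sup>2 - 1/8)\<^sup>2 + 1/6) - ln (2 - 2 * cos u)"
proof -
  define s where "s = sin (u/2)"
  have s: "0 < s" unfolding s_def using assms by (intro sin_gt_zero) auto
  have c: "cos u = 1 - 2 * s\<^sup>2" using cos_double_sin[of "u/2"] by (simp add: s_def)
  have l: "ln (2 - 2 * cos u) = 2 * ln (2 * s)"
  proof -
    have "2 - 2 * cos u = (2 * s)\<^sup>2" by (simp add: c power_mult_distrib)
    moreover have "ln ((2 * s)\<^sup>2) = 2 * ln (2 * s)" using ln_realpow[of "2 * s" 2] s by simp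
    ultimately show ?thesis by (simp only:)
  qed
  have le: "ln (2 * s) \<le> 2 * s - 1" using s by (intro ln_le_minus_one) simp
  define t where "t = s - s\<^sup>2 - 1/8"
  have t: "\<bar>t\<bar> \<le> 6 * t\<^sup>2 + 1/24"
  proof -
    \<comment> \<open>A square replaces |t| by a polynomial in s, which can be integrated exactly.
      It is sharp at |t| = 1/12, a typical size since |t| <= 1/8.\<close>
    have "0 \<le> 6 * (\<bar>t\<bar> - 1/12)\<^sup>2" by simp
    then show ?thesis by (simp add: power2_eq_square algebra_simps)
  qed
  have "ell u = 2 * (2 * s - 1 - ln (2 * s)) - 4 * t"
    unfolding ell_def l unfolding c t_def by (simp add: algebra_simps)
  then have "\<bar>ell u\<bar> \<le> 2 * (2 * s - 1 - ln (2 * s)) + 4 * \<bar>t\<bar>"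
    using abs_triangle_ineq4[of "2 * (2 * s - 1 - ln (2 * s))" "4 * t"] le by (simp add: abs_mult)
  also have "\<dots> \<le> 2 * (2 * s - 1 - ln (2 * s)) + 4 * (6 * t\<^sup>2 + 1/24)" using t by simp
  finally show ?thesis unfolding s_def[symmetric] t_def[symmetric] l by (simp add: algebra_simps)
qed

text \<open>In the pointwise majorant the logarithm enters linearly, and its integral over
  [0, \<pi>] is 0. What remains is a trigonometric polynomial in u/2 with integral -68 + 541
  \<pi>/24, about 2.817, against 9 \<pi>/10, about 2.827.\<close>

lemma ell_L1_bound: "(LINT u|lborel. indicator {-pi..pi} u * \<bar>ell u\<bar>) \<le> 9/5 * pi"
proof -
  let ?s = "\<lambda>u::real. sin (u/2)"
  let ?R = "\<lambda>u::real. 4 * ?s u - 2 + 24 * (?s u - (?s u)\<^sup>2 - 1/8)\<^sup>2 + 1/6"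
  let ?F = "\<lambda>u::real. - 8 * cos (u/2) - 2 * u + u/6 + 24 * ((3/8 * u - sin u / 2 + sin (2 * u) / 16)
       - 2 * (- 2 * cos (u/2) + 2/3 * (cos (u/2))^3) + 5/4 * (u/2 - sin u / 2) + cos (u/2) / 2 + u/64)"
  have R: "has_bochner_integral lborel (\<lambda>u. indicator {0..pi} u *\<^sub>R ?R u) (?F pi - ?F 0)"
  proof (rule has_bochner_integral_FTC_Icc)
    fix u :: real
    define s where "s = sin (u/2)" define c where "c = cos (u/2)"
    have cs: "c\<^sup>2 = 1 - s\<^sup>2" unfolding s_def c_def by (rule cos_squared_eq)
    have cu: "cos u = 1 - 2 * s\<^sup>2" using cos_double_sin[of "u/2"] by (simp add: s_def)
    have c2u: "cos (2 * u) = 2 * (1 - 2 * s\<^sup>2)\<^sup>2 - 1" by (simp only: cos_double_cos cu)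
    have "(?F has_real_derivative 4 * s - 2 + 1/6 + 24 * ((3/8 - cos u / 2 + cos (2 * u) / 8)
       - 2 * (s - c\<^sup>2 * s) + 5/4 * (1/2 - cos u / 2) - s / 4 + 1/64)) (at u)"
      unfolding s_def c_def by (auto intro!: derivative_eq_intros simp: field_simps)
    moreover have "4 * s - 2 + 1/6 + 24 * ((3/8 - cos u / 2 + cos (2 * u) / 8)
       - 2 * (s - c\<^sup>2 * s) + 5/4 * (1/2 - cos u / 2) - s / 4 + 1/64) = ?R u"
      unfolding cu c2u cs s_def[symmetric] by (simp add: power2_eq_square field_simps)
    ultimately show "(?F has_vector_derivative ?R u) (at u within {0..pi})"
      using has_vector_derivative_at_within by (auto simp: has_real_derivative_iff_has_vector_derivative)
  qed (auto intro!: continuous_intros)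
  have RL: "has_bochner_integral lborel (\<lambda>u. indicator {0..pi} u * (?R u - ln (2 - 2 * cos u))) (?F pi - ?F 0)"
    using has_bochner_integral_diff[OF R has_bochner_integral_ln_kernel_0_pi] by (simp add: algebra_simps)
  have int: "integrable lborel (\<lambda>u. indicator {0..pi} u * \<bar>ell u\<bar>)"
  proof (rule integrable_bound_interval)
    show "integrable lborel (\<lambda>u. \<bar>indicator {-pi..pi} u * ell u\<bar>)" using integrable_ell by simp
  qed (auto simp: abs_mult indicator_def)
  then obtain i where i: "has_bochner_integral lborel (\<lambda>u. indicator {0..pi} u * \<bar>ell u\<bar>) i"
    by (auto simp: has_bochner_integral_iff)
  have "i \<le> ?F pi - ?F 0"
  proof -
    have "(LINT u|lborel. indicator {0..pi} u * \<bar>ell u\<bar>) \<le> (LINT u|lborel. indicator {0..pi} u * (?R u - ln (2 - 2 * cos u)))"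
    proof (rule integral_mono_AE)
      show "AE u in lborel. indicator {0..pi} u * \<bar>ell u\<bar> \<le> indicator {0..pi} u * (?R u - ln (2 - 2 * cos u))"
        using AE_lborel_singleton[of 0]
      proof eventually_elim
        case (elim u)
        then show ?case using abs_ell_le[of u] by (cases "u \<in> {0..pi}") auto
      qed
    qed (use int RL in \<open>auto simp: has_bochner_integral_iff\<close>)
    then show ?thesis using i RL by (simp add: has_bochner_integral_iff)
  qed
  also have "?F pi - ?F 0 = - 68 + (541/24) * pi" by (simp add: algebra_simps)
  also have "\<dots> \<le> 9/10 * pi" using pi_approx by simp
  finally have "i \<le> 9/10 * pi" .
  moreover have "has_bochner_integral lborel (\<lambda>u. indicator {-pi..pi} u * \<bar>ell u\<bar>) (2 * i)"
    by (rule has_bochner_integral_even[OF i]) (auto simp: ell_def)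
  ultimately show ?thesis by (simp add: has_bochner_integral_iff)
qed

section \<open>Convolution on the cylinder\<close>

lemma measurable_fst_borel [measurable]: "(fst :: real \<times> real \<Rightarrow> real) \<in> borel_measurable borel"
  and measurable_snd_borel [measurable]: "(snd :: real \<times> real \<Rightarrow> real) \<in> borel_measurable borel"
  by (auto intro!: borel_measurable_continuous_onI continuous_intros)

definition per :: "(real \<times> real \<Rightarrow> real) \<Rightarrow> bool" where
  "per f \<longleftrightarrow> (\<forall>x y. f (x + 2 * pi, y) = f (x, y))"

definition strip :: "real \<Rightarrow> (real \<times> real \<Rightarrow> real) \<Rightarrow> bool" where
  "strip r w \<longleftrightarrow> (\<forall>p. r < \<bar>snd p\<bar> \<longrightarrow> w p = 0)"

text \<open>Integrability is asked on bounded strips only, because the logarithmic kernel grows with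
  |y|; the functions it is convolved with vanish outside a strip.\<close>

definition lker :: "(real \<times> real \<Rightarrow> real) \<Rightarrow> bool" where
  "lker k \<longleftrightarrow> k \<in> borel_measurable borel \<and> per k \<and>
     (\<forall>R. integrable lborel (\<lambda>q. indicator ({-pi..<pi} \<times> {-R..R}) q * k q))"

text \<open>The window is attached to the kernel variable and centred at the singularity, where the
  bounds for |u| <= \<pi> apply. It is half-open so that its translates tile the line.\<close>

definition conv :: "(real \<times> real \<Rightarrow> real) \<Rightarrow> (real \<times> real \<Rightarrow> real) \<Rightarrow> real \<times> real \<Rightarrow> real" where
  "conv k w p = (LINT q|lborel. indicator {-pi..<pi} (fst q) * (k q * w (p - q)))"

lemma lkerD: "lker k \<Longrightarrow> integrable lborel (\<lambda>q. indicator ({-pi..<pi} \<times> {-R..R}) q * k q)"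
  by (simp add: lker_def)

lemma perD: "per f \<Longrightarrow> f (x + 2 * pi, y) = f (x, y)" by (simp add: per_def)

lemma per_int: assumes "per f" shows "f (x + 2 * pi * of_int n, y) = f (x, y)"
proof -
  have nat: "f (x + 2 * pi * of_nat m, y) = f (x, y)" for m :: nat and x
  proof (induction m)
    case (Suc m)
    have "f (x + 2 * pi * of_nat (Suc m), y) = f ((x + 2 * pi * of_nat m) + 2 * pi, y)"
      by (simp add: algebra_simps)
    then show ?case using Suc perD[OF assms] by simp
  qed simp
  show ?thesis
  proof (cases "n \<ge> 0")
    case True then show ?thesis using nat[of x "nat n"] by simp
  next
    case False then show ?thesis using nat[of "x + 2 * pi * of_int n" "nat (- n)"] by simp
  qed
qed

text \<open>The window is cut at r and its left piece moved by one period to the right end. An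
  arbitrary window is then a translate of such a one by a multiple of 2 \<pi>.\<close>

lemma has_bochner_integral_shift_window_aux:
  assumes F: "per F" and i: "has_bochner_integral lborel (\<lambda>q. indicator {-pi..<pi} (fst q) * F q) i"
    and r: "-pi \<le> r" "r < pi"
  shows "has_bochner_integral lborel (\<lambda>q. indicator {r..<r+2*pi} (fst q) * F q) i"
proof -
  have piece: "integrable lborel (\<lambda>q. indicator A (fst q) * F q)" if "A \<subseteq> {-pi..<pi}" and [measurable]: "A \<in> sets borel" for A
  proof -
    have "integrable lborel (\<lambda>q. indicator (A \<times> UNIV) q *\<^sub>R (indicator {-pi..<pi} (fst q) * F q))"
    proof (rule integrable_mult_indicator)
      have "A \<times> UNIV \<in> sets (borel \<Otimes>\<^sub>M (borel :: real measure))" using that by (intro pair_measureI) auto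
      then show "A \<times> UNIV \<in> sets (lborel :: (real \<times> real) measure)" by (simp only: borel_prod sets_lborel)
    qed (use i in \<open>simp add: has_bochner_integral_iff\<close>)
    moreover have "(\<lambda>q. indicator (A \<times> UNIV) q *\<^sub>R (indicator {-pi..<pi} (fst q) * F q)) = (\<lambda>q. indicator A (fst q) * F q)"
      using that(1) by (auto simp: fun_eq_iff indicator_def)
    ultimately show ?thesis by simp
  qed
  obtain j where j: "has_bochner_integral lborel (\<lambda>q. indicator {r..<pi} (fst q) * F q) j"
    using piece[of "{r..<pi}"] r by (auto simp: has_bochner_integral_iff)
  obtain l where l: "has_bochner_integral lborel (\<lambda>q. indicator {-pi..<r} (fst q) * F q) l"
    using piece[of "{-pi..<r}"] r by (auto simp: has_bochner_integral_iff)
  have "has_bochner_integral lborel (\<lambda>q. indicator {-pi..<pi} (fst q) * F q) (l + j)"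
  proof -
    have "indicator {-pi..<r} (fst q) * F q + indicator {r..<pi} (fst q) * F q = indicator {-pi..<pi} (fst q) * F q" for q
      using r by (auto simp: indicator_def)
    then show ?thesis using has_bochner_integral_add[OF l j] by (simp only:)
  qed
  then have i_eq: "i = l + j" using i has_bochner_integral_eq by blast
  have "has_bochner_integral lborel (\<lambda>q. indicator {-pi..<r} (fst (q + (-2*pi, 0))) * F (q + (-2*pi, 0))) l"
    by (rule has_bochner_integral_lborel_translate[OF l])
  moreover have "indicator {-pi..<r} (fst (q + (-2*pi, 0))) * F (q + (-2*pi, 0)) = indicator {pi..<r+2*pi} (fst q) * F q" for q
    using per_int[OF F, of "fst q" "-1" "snd q"] by (cases q) (auto simp: indicator_def)
  ultimately have "has_bochner_integral lborel (\<lambda>q. indicator {pi..<r+2*pi} (fst q) * F q) l" by simp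
  from has_bochner_integral_add[OF this j]
  have "has_bochner_integral lborel (\<lambda>q. indicator {pi..<r+2*pi} (fst q) * F q + indicator {r..<pi} (fst q) * F q) i"
    by (simp only: i_eq)
  moreover have "indicator {pi..<r+2*pi} (fst q) * F q + indicator {r..<pi} (fst q) * F q = indicator {r..<r+2*pi} (fst q) * F q" for q
    using r by (auto simp: indicator_def)
  ultimately show ?thesis by (simp only:)
qed

lemma has_bochner_integral_shift_window:
  assumes F: "per F" and i: "has_bochner_integral lborel (\<lambda>q. indicator {-pi..<pi} (fst q) * F q) i"
  shows "has_bochner_integral lborel (\<lambda>q. indicator {a..<a+2*pi} (fst q) * F q) i"
proof -
  define n where "n = \<lfloor>(a + pi) / (2 * pi)\<rfloor>"
  define r where "r = a - 2 * pi * of_int n"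
  have "of_int n \<le> (a + pi) / (2 * pi)" "(a + pi) / (2 * pi) < of_int n + 1"
    unfolding n_def by linarith+
  then have r: "-pi \<le> r" "r < pi" unfolding r_def by (simp_all add: field_simps)
  have "has_bochner_integral lborel (\<lambda>q. indicator {r..<r+2*pi} (fst (q + (- 2 * pi * of_int n, 0))) * F (q + (- 2 * pi * of_int n, 0))) i"
    by (rule has_bochner_integral_lborel_translate[OF has_bochner_integral_shift_window_aux[OF F i r]])
  moreover have "indicator {r..<r+2*pi} (fst (q + (- 2 * pi * of_int n, 0))) * F (q + (- 2 * pi * of_int n, 0))
      = indicator {a..<a+2*pi} (fst q) * F q" for q
    using per_int[OF F, of "fst q" "-n" "snd q"] by (cases q) (auto simp: indicator_def r_def)
  ultimately show ?thesis by simp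
qed

lemma AE_fst_neq: "AE q in (lborel :: (real \<times> real) measure). fst q \<noteq> a"
  by (rule AE_lborel_fst[OF AE_lborel_singleton]) auto

text \<open>The majorant depends on p only through P, so it serves dominated convergence for all p
  in a bounded range of heights.\<close>

lemma strip_bound_indicator:
  assumes "strip r w" "\<And>p. \<bar>w p\<bar> \<le> B" "\<bar>snd p\<bar> \<le> P" "P + r \<le> R"
  shows "\<bar>indicator {-pi..<pi} (fst q) * (k q * w (p - q))\<bar> \<le> B * \<bar>indicator ({-pi..<pi} \<times> {-R..R}) q * k q\<bar>"
proof (cases "\<bar>snd q\<bar> \<le> R")
  case True
  have "\<bar>k q\<bar> * \<bar>w (p - q)\<bar> \<le> \<bar>k q\<bar> * B" by (intro mult_left_mono assms) auto
  then show ?thesis using True by (cases q) (auto simp: indicator_def abs_mult mult.commute)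
next
  case False
  then have "r < \<bar>snd (p - q)\<bar>" using assms by auto
  then have "w (p - q) = 0" using assms(1) unfolding strip_def by blast
  moreover have "0 \<le> B" using assms(2)[of p] by linarith
  ultimately show ?thesis by simp
qed

lemma conv_integrable:
  assumes "lker k" "strip r w" "\<And>p. \<bar>w p\<bar> \<le> B" and [measurable]: "w \<in> borel_measurable borel"
  shows "integrable lborel (\<lambda>q. indicator {-pi..<pi} (fst q) * (k q * w (p - q)))"
proof (rule Bochner_Integration.integrable_bound)
  have [measurable]: "k \<in> borel_measurable borel" using assms(1) by (simp add: lker_def)
  let ?R = "\<bar>snd p\<bar> + r"
  show "integrable lborel (\<lambda>q. B * \<bar>indicator ({-pi..<pi} \<times> {-?R..?R}) q * k q\<bar>)"
    by (intro integrable_mult_right integrable_abs lkerD assms)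
  show "(\<lambda>q. indicator {-pi..<pi} (fst q) * (k q * w (p - q))) \<in> borel_measurable lborel" by measurable
  have "0 \<le> B" using assms(3)[of p] by linarith
  then show "AE q in lborel. norm (indicator {-pi..<pi} (fst q) * (k q * w (p - q)))
       \<le> norm (B * \<bar>indicator ({-pi..<pi} \<times> {-?R..?R}) q * k q\<bar>)"
    using strip_bound_indicator[OF assms(2,3) order_refl order_refl, where k = k and p = p] by (auto simp: abs_mult)
qed

text \<open>The same convolution with a fixed window in the vorticity variable. This form suits
  Fubini, trigonometric addition formulas and the comparison with \<open>stream\<close>, where p
  should appear in the kernel alone.\<close>

lemma conv_window:
  assumes "lker k" "strip r w" "\<And>p. \<bar>w p\<bar> \<le> B" and [measurable]: "w \<in> borel_measurable borel" and "per w"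
  shows "has_bochner_integral lborel (\<lambda>q. indicator {a..<a+2*pi} (fst q) * (k (p - q) * w q)) (conv k w p)"
proof -
  have [measurable]: "k \<in> borel_measurable borel" and k: "per k" using assms(1) by (simp_all add: lker_def)
  have "has_bochner_integral lborel (\<lambda>q. indicator {-pi..<pi} (fst q) * (k q * w (p - q))) (conv k w p)"
    using conv_integrable[OF assms(1-4), of p] by (simp add: conv_def has_bochner_integral_iff)
  moreover have "per (\<lambda>q. k q * w (p - q))" unfolding per_def
  proof (intro allI)
    fix x y
    show "k (x + 2 * pi, y) * w (p - (x + 2 * pi, y)) = k (x, y) * w (p - (x, y))"
      using perD[OF k, of x y] per_int[OF assms(5), of "fst p - x" "-1" "snd p - y"]
      by (cases p) (simp add: algebra_simps)
  qed
  ultimately have "has_bochner_integral lborel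
      (\<lambda>q. indicator {fst p - a - 2*pi..<fst p - a - 2*pi + 2*pi} (fst q) * (k q * w (p - q))) (conv k w p)"
    by (intro has_bochner_integral_shift_window)
  from has_bochner_integral_lborel_reflect[OF this, of p]
  have "has_bochner_integral lborel
      (\<lambda>q. indicator {fst p - a - 2*pi..<fst p - a} (fst (p - q)) * (k (p - q) * w q)) (conv k w p)"
    by simp
  then show ?thesis
  proof (rule has_bochner_integral_cong_AE_real)
    show "AE q in lborel. indicator {fst p - a - 2*pi..<fst p - a} (fst (p - q)) * (k (p - q) * w q) =
        indicator {a..<a+2*pi} (fst q) * (k (p - q) * w q)"
      using AE_fst_neq[of a] AE_fst_neq[of "a + 2*pi"] by eventually_elim (auto simp: indicator_def)
  qed measurable
qed

lemma conv_bound: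
  assumes "integrable lborel \<kappa>" "integrable lborel \<mu>" "\<And>u. 0 \<le> \<kappa> u" "\<And>v. 0 \<le> \<mu> v"
    and le: "AE q in lborel. fst q \<in> {-pi..<pi} \<longrightarrow> \<bar>k q * w (p - q)\<bar> \<le> \<kappa> (fst q) * \<mu> (snd q)"
  shows "\<bar>conv k w p\<bar> \<le> (LINT u|lborel. \<kappa> u) * (LINT v|lborel. \<mu> v)"
proof (cases "integrable lborel (\<lambda>q. indicator {-pi..<pi} (fst q) * (k q * w (p - q)))")
  case True
  have "\<bar>conv k w p\<bar> \<le> (LINT q|lborel. \<bar>indicator {-pi..<pi} (fst q) * (k q * w (p - q))\<bar>)"
    unfolding conv_def by (rule integral_abs_bound)
  also have "\<dots> \<le> (LINT q|lborel. \<kappa> (fst q) * \<mu> (snd q))"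
  proof (rule integral_mono_AE)
    show "AE q in lborel. \<bar>indicator {-pi..<pi} (fst q) * (k q * w (p - q))\<bar> \<le> \<kappa> (fst q) * \<mu> (snd q)"
      using le by eventually_elim (auto simp: indicator_def assms)
  qed (use True integrable_lborel_Times(1)[OF assms(1,2)] in auto)
  finally show ?thesis by (simp add: integrable_lborel_Times(2)[OF assms(1,2)])
next
  case False
  \<comment> \<open>The integral of a non-integrable function is 0 by convention, and the right-hand
    side is nonnegative.\<close>
  then have "conv k w p = 0" unfolding conv_def by (rule not_integrable_integral_eq)
  then show ?thesis by (simp add: assms)
qed

lemma conv_diff:
  assumes "lker k" "strip r w1" "\<And>p. \<bar>w1 p\<bar> \<le> B1" "w1 \<in> borel_measurable borel"
    "strip r w2" "\<And>p. \<bar>w2 p\<bar> \<le> B2" "w2 \<in> borel_measurable borel"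
  shows "conv k (\<lambda>q. w1 q - w2 q) p = conv k w1 p - conv k w2 p"
  unfolding conv_def
  by (subst Bochner_Integration.integral_diff[symmetric])
     (use conv_integrable[OF assms(1-4), of p] conv_integrable[OF assms(1,5-7), of p] in \<open>auto simp: algebra_simps\<close>)

lemma conv_diff_kernel:
  assumes "lker k1" "lker k2" "strip r w" "\<And>p. \<bar>w p\<bar> \<le> B" "w \<in> borel_measurable borel"
  shows "conv (\<lambda>q. k1 q - k2 q) w p = conv k1 w p - conv k2 w p"
  unfolding conv_def
  by (subst Bochner_Integration.integral_diff[symmetric])
     (use conv_integrable[OF assms(1,3-5), of p] conv_integrable[OF assms(2,3-5), of p] in \<open>auto simp: algebra_simps\<close>)

lemma conv_per: "per w \<Longrightarrow> per (conv k w)"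
  unfolding per_def[of "conv k w"] conv_def
proof (intro allI)
  fix x y assume w: "per w"
  have "w ((x + 2 * pi, y) - q) = w ((x, y) - q)" for q
    using perD[OF w, of "x - fst q" "y - snd q"] by (cases q) (simp add: algebra_simps)
  then show "(LBINT q. indicat_real {- pi..<pi} (fst q) * (k q * w ((x + 2 * pi, y) - q))) =
     (LBINT q. indicat_real {- pi..<pi} (fst q) * (k q * w ((x, y) - q)))" by simp
qed

lemma conv_continuous:
  assumes "lker k" "strip r w" "\<And>p. \<bar>w p\<bar> \<le> B" and w: "continuous_on UNIV w"
  shows "continuous_on UNIV (conv k w)"
proof -
  have [measurable]: "k \<in> borel_measurable borel" using assms(1) by (simp add: lker_def)
  have [measurable]: "w \<in> borel_measurable borel" using w by (rule borel_measurable_continuous_onI)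
  have B: "0 \<le> B" using assms(3)[of 0] by linarith
  show ?thesis unfolding continuous_on_sequentially comp_def
  proof (intro allI ballI impI; elim conjE)
    fix X p assume X: "X \<longlonglongrightarrow> (p :: real \<times> real)"
    then have "bounded (range X)" by (rule convergent_imp_bounded)
    then obtain P where P: "\<And>n. norm (X n) \<le> P" by (auto simp: bounded_iff)
    have sP: "\<bar>snd (X n)\<bar> \<le> P" for n using P[of n] norm_snd_le[of "snd (X n)" "fst (X n)"] by simp
    let ?R = "P + r"
    show "(\<lambda>n. conv k w (X n)) \<longlonglongrightarrow> conv k w p"
      unfolding conv_def
    proof (rule integral_dominated_convergence)
      show "integrable lborel (\<lambda>q. B * \<bar>indicator ({-pi..<pi} \<times> {-?R..?R}) q * k q\<bar>)"
        by (intro integrable_mult_right integrable_abs lkerD assms)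
      show "AE q in lborel. (\<lambda>n. indicator {-pi..<pi} (fst q) * (k q * w (X n - q)))
           \<longlonglongrightarrow> indicator {-pi..<pi} (fst q) * (k q * w (p - q))"
      proof (intro AE_I2 tendsto_mult_left tendsto_intros)
        fix q
        have "(\<lambda>n. X n - q) \<longlonglongrightarrow> p - q" using X by (intro tendsto_intros)
        then show "(\<lambda>n. w (X n - q)) \<longlonglongrightarrow> w (p - q)"
          using w unfolding continuous_on_eq_continuous_at[OF open_UNIV] by (intro isCont_tendsto_compose[of "p - q" w]) blast
      qed
      show "AE q in lborel. norm (indicator {-pi..<pi} (fst q) * (k q * w (X n - q)))
          \<le> B * \<bar>indicator ({-pi..<pi} \<times> {-?R..?R}) q * k q\<bar>" for n
        using strip_bound_indicator[OF assms(2,3) sP order_refl, where k = k] by auto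
    qed measurable
  qed
qed

section \<open>Differentiation of convolutions, in the density and in the kernel\<close>

lemma has_real_derivative_integral:
  fixes f f' :: "real \<Rightarrow> 'a \<Rightarrow> real"
  assumes int: "\<And>t. integrable M (f t)" and m: "f' t0 \<in> borel_measurable M"
    and d: "\<And>t q. ((\<lambda>t. f t q) has_real_derivative f' t q) (at t)"
    and b: "\<And>t q. \<bar>t - t0\<bar> \<le> 1 \<Longrightarrow> \<bar>f' t q\<bar> \<le> g q" and g: "integrable M g"
  shows "((\<lambda>t. LINT q|M. f t q) has_real_derivative (LINT q|M. f' t0 q)) (at t0)"
proof -
  have "((\<lambda>h. ((LINT q|M. f (t0 + h) q) - (LINT q|M. f t0 q)) / h) \<longlongrightarrow> (LINT q|M. f' t0 q)) (at 0 within {-1<..<1})"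
    unfolding tendsto_at_iff_sequentially comp_def
  proof (intro allI impI)
    fix X :: "nat \<Rightarrow> real" assume X: "\<forall>i. X i \<in> {-1<..<1} - {0}" "X \<longlonglongrightarrow> 0"
    have eq: "((LINT q|M. f (t0 + X n) q) - (LINT q|M. f t0 q)) / X n = (LINT q|M. (f (t0 + X n) q - f t0 q) / X n)" for n
      using int by simp
    show "(\<lambda>n. ((LINT q|M. f (t0 + X n) q) - (LINT q|M. f t0 q)) / X n) \<longlonglongrightarrow> (LINT q|M. f' t0 q)"
      unfolding eq
    proof (rule integral_dominated_convergence[OF m _ g])
      show "(\<lambda>q. (f (t0 + X n) q - f t0 q) / X n) \<in> borel_measurable M" for n
        using borel_measurable_integrable[OF int] by measurable
      show "AE q in M. (\<lambda>n. (f (t0 + X n) q - f t0 q) / X n) \<longlonglongrightarrow> f' t0 q"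
      proof (intro AE_I2)
        fix q
        have "((\<lambda>h. (f (t0 + h) q - f t0 q) / h) \<longlongrightarrow> f' t0 q) (at 0)" using d[of q t0] by (simp add: DERIV_def)
        then show "(\<lambda>n. (f (t0 + X n) q - f t0 q) / X n) \<longlonglongrightarrow> f' t0 q"
          using X unfolding tendsto_at_iff_sequentially comp_def by auto
      qed
      show "AE q in M. norm ((f (t0 + X n) q - f t0 q) / X n) \<le> g q" for n
      proof (intro AE_I2)
        fix q
        have Xn: "X n \<noteq> 0" "\<bar>X n\<bar> < 1" using X(1)[rule_format, of n] by auto
        have "norm (f (t0 + X n) q - f t0 q) \<le> g q * norm (t0 + X n - t0)"
          by (rule field_differentiable_bound[of "{t0 - 1..t0 + 1}" "\<lambda>t. f t q" "\<lambda>t. f' t q"])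
             (use d b Xn in \<open>auto intro: has_field_derivative_at_within\<close>)
        then show "norm ((f (t0 + X n) q - f t0 q) / X n) \<le> g q" using Xn by (simp add: field_simps)
      qed
    qed
  qed
  then show ?thesis by (simp add: DERIV_def at_within_open[of 0 "{-1<..<1}"])
qed

lemma has_derivative_from_partials:
  fixes f fx fy :: "real \<times> real \<Rightarrow> real"
  assumes dx: "\<And>x y. ((\<lambda>x. f (x, y)) has_real_derivative fx (x, y)) (at x)"
    and dy: "\<And>x y. ((\<lambda>y. f (x, y)) has_real_derivative fy (x, y)) (at y)"
    and cont: "continuous_on UNIV fy"
  shows "(f has_derivative (\<lambda>h. fst h * fx p + snd h * fy p)) (at p)"
proof -
  obtain x y where p: "p = (x, y)" by (cases p)
  have "((\<lambda>(x, y). f (x, y)) has_derivative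
      (\<lambda>(tx, ty). (*) (fx (x, y)) tx + blinfun_scaleR_left (fy (x, y)) ty)) (at (x, y) within UNIV \<times> UNIV)"
  proof (rule has_derivative_partialsI)
    show "((\<lambda>x. f (x, y)) has_derivative (*) (fx (x, y))) (at x within UNIV)"
      using dx by (simp add: has_field_derivative_def)
    show "((\<lambda>y. f (x, y)) has_derivative blinfun_apply (blinfun_scaleR_left (fy (x, y)))) (at y within UNIV)" for x y
      using dy[of x y] by (simp add: has_field_derivative_def mult.commute[of _ "fy (x, y)"])
    have "continuous (at (x, y)) fy" using cont by (simp add: continuous_on_eq_continuous_at del: split_paired_All)
    then have "continuous (at (x, y)) (\<lambda>q. blinfun_scaleR_left (fy q) :: real \<Rightarrow>\<^sub>L real)"
      by (intro bounded_linear.continuous[OF bounded_linear_blinfun_scaleR_left])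
    then show "continuous (at (x, y) within UNIV \<times> UNIV) (\<lambda>(x, y). blinfun_scaleR_left (fy (x, y)))"
      by (simp add: case_prod_beta')
  qed auto
  then show ?thesis by (simp add: p case_prod_beta' mult.commute)
qed

lemma has_derivative_fst_snd_imp_partials:
  fixes f :: "real \<times> real \<Rightarrow> real"
  assumes "(f has_derivative (\<lambda>h. fst h * a + snd h * b)) (at (x, y))"
  shows "((\<lambda>x. f (x, y)) has_real_derivative a) (at x)" "((\<lambda>y. f (x, y)) has_real_derivative b) (at y)"
proof -
  have "((\<lambda>x. f (x, y)) has_derivative (\<lambda>t. fst (t, 0::real) * a + snd (t, 0::real) * b)) (at x)"
    by (rule has_derivative_compose[of "\<lambda>x. (x, y)" "\<lambda>t. (t, 0)", OF _ assms]) (auto intro!: derivative_eq_intros)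
  then show "((\<lambda>x. f (x, y)) has_real_derivative a) (at x)"
    by (simp add: has_field_derivative_def mult.commute[of _ a])
  have "((\<lambda>y. f (x, y)) has_derivative (\<lambda>t. fst (0::real, t) * a + snd (0::real, t) * b)) (at y)"
    by (rule has_derivative_compose[of "\<lambda>y. (x, y)" "\<lambda>t. (0, t)", OF _ assms]) (auto intro!: derivative_eq_intros)
  then show "((\<lambda>y. f (x, y)) has_real_derivative b) (at y)"
    by (simp add: has_field_derivative_def mult.commute[of _ b])
qed

lemma bounded_of_per_strip:
  assumes "per w" "strip r w" "continuous_on UNIV w"
  shows "\<exists>B>0. \<forall>p. \<bar>w p\<bar> \<le> B"
proof -
  have "compact ({0..2*pi} \<times> {-r..r})" by (intro compact_Times) auto
  then have "bounded (w ` ({0..2*pi} \<times> {-r..r}))"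
    by (intro compact_imp_bounded compact_continuous_image continuous_on_subset[OF assms(3)]) auto
  then obtain B where B: "\<And>q. q \<in> {0..2*pi} \<times> {-r..r} \<Longrightarrow> \<bar>w q\<bar> \<le> B" by (auto simp: bounded_iff)
  have "\<bar>w (x, y)\<bar> \<le> \<bar>B\<bar> + 1" for x y
  proof (cases "\<bar>y\<bar> \<le> r")
    case True
    define n where "n = \<lfloor>x / (2 * pi)\<rfloor>"
    have "of_int n \<le> x / (2 * pi)" "x / (2 * pi) < of_int n + 1" unfolding n_def by linarith+
    then have "x - 2 * pi * of_int n \<in> {0..2*pi}" by (simp add: field_simps)
    moreover have "w (x, y) = w (x - 2 * pi * of_int n, y)" using per_int[OF assms(1), of x "- n" y] by simp
    ultimately show ?thesis using B[of "(x - 2 * pi * of_int n, y)"] True by (auto simp: abs_le_iff)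
  next
    case False then show ?thesis using assms(2) by (auto simp: strip_def)
  qed
  then show ?thesis by (intro exI[of _ "\<bar>B\<bar> + 1"]) auto
qed

definition good :: "real \<Rightarrow> (real \<times> real \<Rightarrow> real) \<Rightarrow> bool" where
  "good r w \<longleftrightarrow> per w \<and> strip r w \<and> continuous_on UNIV w"

lemma good_measurable: "good r w \<Longrightarrow> w \<in> borel_measurable borel"
  by (auto simp: good_def intro: borel_measurable_continuous_onI)

lemma good_conv_continuous: assumes "lker k" "good r w" shows "continuous_on UNIV (conv k w)"
proof -
  obtain B where "\<And>p. \<bar>w p\<bar> \<le> B" using bounded_of_per_strip assms unfolding good_def by blast
  then show ?thesis using conv_continuous assms unfolding good_def by blast
qed

lemma good_conv_integrable:
  assumes "lker k" "good r w"
  shows "integrable lborel (\<lambda>q. indicator {-pi..<pi} (fst q) * (k q * w (p - q)))"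
proof -
  obtain B where "\<And>p. \<bar>w p\<bar> \<le> B" using bounded_of_per_strip assms unfolding good_def by blast
  then show ?thesis using conv_integrable good_measurable assms unfolding good_def by blast
qed

lemma good_conv_window:
  assumes "lker k" "good r w"
  shows "has_bochner_integral lborel (\<lambda>q. indicator {a..<a+2*pi} (fst q) * (k (p - q) * w q)) (conv k w p)"
proof -
  obtain B where "\<And>p. \<bar>w p\<bar> \<le> B" using bounded_of_per_strip assms unfolding good_def by blast
  then show ?thesis using conv_window good_measurable assms unfolding good_def by blast
qed

lemma conv_has_partial:
  fixes e :: "real \<times> real"
  assumes k: "lker k" and w: "good r w" and w': "good r w'"
    and d: "\<And>p. ((\<lambda>s. w (p + s *\<^sub>R e)) has_real_derivative w' p) (at 0)"
  shows "((\<lambda>s. conv k w (p + s *\<^sub>R e)) has_real_derivative conv k w' p) (at 0)"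
proof -
  have d': "((\<lambda>s. w (p + s *\<^sub>R e)) has_real_derivative w' (p + t *\<^sub>R e)) (at t)" for p t
  proof -
    have "((\<lambda>s. w ((p + t *\<^sub>R e) + s *\<^sub>R e)) has_real_derivative w' (p + t *\<^sub>R e)) (at (t - t))" using d by simp
    then show ?thesis using DERIV_shift[of "\<lambda>s. w (p + s *\<^sub>R e)" _ 0 t] by (simp add: algebra_simps)
  qed
  have [measurable]: "k \<in> borel_measurable borel" using k by (simp add: lker_def)
  have [measurable]: "w' \<in> borel_measurable borel" using w' by (rule good_measurable)
  obtain B where B: "\<And>p. \<bar>w' p\<bar> \<le> B" using bounded_of_per_strip w' unfolding good_def by blast
  define P where "P = \<bar>snd p\<bar> + \<bar>snd e\<bar>"
  have "((\<lambda>s. LINT q|lborel. indicator {-pi..<pi} (fst q) * (k q * w (p + s *\<^sub>R e - q))) has_real_derivative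
      (LINT q|lborel. indicator {-pi..<pi} (fst q) * (k q * w' (p + 0 *\<^sub>R e - q)))) (at 0)"
  proof (rule has_real_derivative_integral)
    show "integrable lborel (\<lambda>q. indicator {-pi..<pi} (fst q) * (k q * w (p + t *\<^sub>R e - q)))" for t
      by (rule good_conv_integrable[OF k w])
    show "(\<lambda>q. indicator {-pi..<pi} (fst q) * (k q * w' (p + 0 *\<^sub>R e - q))) \<in> borel_measurable lborel" by measurable
    fix t :: real and q :: "real \<times> real"
    show "((\<lambda>s. indicator {-pi..<pi} (fst q) * (k q * w (p + s *\<^sub>R e - q))) has_real_derivative
        indicator {-pi..<pi} (fst q) * (k q * w' (p + t *\<^sub>R e - q))) (at t)"
      using d'[of "p - q" t] by (intro DERIV_cmult) (simp add: algebra_simps)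
    assume t: "\<bar>t - 0\<bar> \<le> 1"
    have "\<bar>snd (p + t *\<^sub>R e)\<bar> \<le> \<bar>snd p\<bar> + \<bar>t\<bar> * \<bar>snd e\<bar>"
      using abs_triangle_ineq[of "snd p" "t * snd e"] by (simp add: abs_mult)
    also have "\<dots> \<le> P" unfolding P_def using mult_right_mono[OF t, of "\<bar>snd e\<bar>"] by simp
    finally have "\<bar>snd (p + t *\<^sub>R e)\<bar> \<le> P" .
    with w' B show "\<bar>indicator {-pi..<pi} (fst q) * (k q * w' (p + t *\<^sub>R e - q))\<bar>
       \<le> B * \<bar>indicator ({-pi..<pi} \<times> {-(P+r)..P+r}) q * k q\<bar>"
      by (intro strip_bound_indicator[where r = r and P = P]) (auto simp: good_def)
  next
    show "integrable lborel (\<lambda>q. B * \<bar>indicator ({-pi..<pi} \<times> {-(P+r)..P+r}) q * k q\<bar>)"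
      by (intro integrable_mult_right integrable_abs lkerD k)
  qed
  then show ?thesis by (simp add: conv_def)
qed

lemma lker_abs: assumes "lker k" shows "lker (\<lambda>q. \<bar>k q\<bar>)"
proof -
  have "integrable lborel (\<lambda>q. indicator ({-pi..<pi} \<times> {-R..R}) q * \<bar>k q\<bar>)" for R
    using integrable_abs[OF lkerD[OF assms, of R]] by (simp add: abs_mult)
  then show ?thesis using assms by (auto simp: lker_def per_def)
qed

text \<open>The kernel is singular, but smooth along almost every line in a coordinate direction.\<close>

lemma conv_has_partial_kernel:
  fixes e :: "real \<times> real"
  assumes K: "lker K" and D: "lker D" and w: "good r w"
    and d: "\<And>p. AE q in lborel. \<forall>s. ((\<lambda>s. K (p + s *\<^sub>R e - q)) has_real_derivative D (p + s *\<^sub>R e - q)) (at s)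
              \<and> isCont (\<lambda>s. D (p + s *\<^sub>R e - q)) s"
  shows "((\<lambda>s. conv K w (p + s *\<^sub>R e)) has_real_derivative conv D w p) (at 0)"
proof -
  have [measurable]: "K \<in> borel_measurable borel" "D \<in> borel_measurable borel" using K D by (simp_all add: lker_def)
  have [measurable]: "w \<in> borel_measurable borel" using w by (rule good_measurable)
  have wa: "good r (\<lambda>q. \<bar>w q\<bar>)" using w unfolding good_def per_def strip_def by (auto intro!: continuous_intros)
  \<comment> \<open>Starting one unit behind p puts p at parameter 1, inside [0, 2], so that a
    primitive defined for t >= 0 can be differentiated there from both sides.\<close>
  define p0 where "p0 = p - e"
  let ?i = "\<lambda>q::real\<times>real. indicat_real {0..<0+2*pi} (fst q)"
  define g where "g s = conv D w (p0 + s *\<^sub>R e)" for s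
  have g_cont: "continuous_on UNIV g" unfolding g_def
    by (intro continuous_on_compose2[OF good_conv_continuous[OF D w]] continuous_intros) auto
  \<comment> \<open>The singularity of \<open>D\<close> moves with s, so dominated differentiation
    under the integral is not at hand. Fubini followed by the fundamental theorem on almost every
    line gives the integrated identity, and continuity of \<open>g\<close> gives the
    derivative.\<close>
  have FTC: "conv K w (p0 + t *\<^sub>R e) - conv K w p0 = integral {0..t} g" if t: "0 \<le> t" for t
  proof -
    let ?F = "\<lambda>(s, q). indicat_real {0..t} s * (?i q * (D (p0 + s *\<^sub>R e - q) * w q))"
    have inner: "has_bochner_integral lborel (\<lambda>q. ?i q * (D (p0 + s *\<^sub>R e - q) * w q)) (g s)" for s
      unfolding g_def by (rule good_conv_window[OF D w])
    have inner_abs: "has_bochner_integral lborel (\<lambda>q. ?i q * (\<bar>D (p0 + s *\<^sub>R e - q)\<bar> * \<bar>w q\<bar>))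
        (conv (\<lambda>q. \<bar>D q\<bar>) (\<lambda>q. \<bar>w q\<bar>) (p0 + s *\<^sub>R e))" for s
      by (rule good_conv_window[OF lker_abs[OF D] wa])
    have F: "integrable (lborel \<Otimes>\<^sub>M lborel) ?F"
    proof (rule lborel_pair.Fubini_integrable)
      show "?F \<in> borel_measurable (lborel \<Otimes>\<^sub>M lborel)" by measurable
      have "(\<lambda>s. LINT q|lborel. norm (?F (s, q))) =
          (\<lambda>s. indicator {0..t} s * conv (\<lambda>q. \<bar>D q\<bar>) (\<lambda>q. \<bar>w q\<bar>) (p0 + s *\<^sub>R e))"
        using inner_abs by (auto simp: fun_eq_iff has_bochner_integral_iff abs_mult)
      moreover have "integrable lborel (\<lambda>s. indicator {0..t} s * conv (\<lambda>q. \<bar>D q\<bar>) (\<lambda>q. \<bar>w q\<bar>) (p0 + s *\<^sub>R e))"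
        by (intro integrable_on_window_continuous continuous_on_compose2[OF good_conv_continuous[OF lker_abs[OF D] wa]] continuous_intros) auto
      ultimately show "integrable lborel (\<lambda>s. LINT q|lborel. norm (?F (s, q)))" by simp
      show "AE s in lborel. integrable lborel (\<lambda>q. ?F (s, q))"
        using inner by (auto simp: has_bochner_integral_iff)
    qed
    have lhs: "(LINT s|lborel. LINT q|lborel. ?F (s, q)) = integral {0..t} g"
    proof -
      have "(LINT s|lborel. LINT q|lborel. ?F (s, q)) = (LINT s|lborel. indicator {0..t} s *\<^sub>R g s)"
        using inner by (simp add: has_bochner_integral_iff)
      also have "\<dots> = integral {0..t} g"
        using set_borel_integral_eq_integral(2)[OF borel_integrable_atLeastAtMost'[of 0 t g]]
          continuous_on_subset[OF g_cont] by (simp add: set_lebesgue_integral_def)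
      finally show ?thesis .
    qed
    have rhs: "(LINT q|lborel. LINT s|lborel. ?F (s, q)) = conv K w (p0 + t *\<^sub>R e) - conv K w p0"
    proof -
      have 1: "has_bochner_integral lborel (\<lambda>q. ?i q * (K (p0 + t *\<^sub>R e - q) * w q) - ?i q * (K (p0 - q) * w q))
         (conv K w (p0 + t *\<^sub>R e) - conv K w p0)"
        by (intro has_bochner_integral_diff good_conv_window[OF K w])
      have "AE q in lborel. (LINT s|lborel. ?F (s, q)) = ?i q * (K (p0 + t *\<^sub>R e - q) * w q) - ?i q * (K (p0 - q) * w q)"
        using d[of p0]
      proof eventually_elim
        case (elim q)
        have "(LINT s|lborel. D (p0 + s *\<^sub>R e - q) * indicator {0..t} s) = K (p0 + t *\<^sub>R e - q) - K (p0 + 0 *\<^sub>R e - q)"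
          by (rule integral_FTC_Icc_real[OF t]) (use elim in auto)
        moreover have "(LINT s|lborel. ?F (s, q)) = (?i q * w q) * (LINT s|lborel. D (p0 + s *\<^sub>R e - q) * indicator {0..t} s)"
          by (subst integral_mult_right_zero[symmetric], intro Bochner_Integration.integral_cong) auto
        ultimately have "(LINT s|lborel. ?F (s, q)) = (?i q * w q) * (K (p0 + t *\<^sub>R e - q) - K (p0 + 0 *\<^sub>R e - q))"
          by (simp only:)
        also have "\<dots> = ?i q * (K (p0 + t *\<^sub>R e - q) * w q) - ?i q * (K (p0 - q) * w q)"
          by (simp add: algebra_simps)
        finally show ?case .
      qed
      then have "(LINT q|lborel. LINT s|lborel. ?F (s, q)) =
          (LINT q|lborel. ?i q * (K (p0 + t *\<^sub>R e - q) * w q) - ?i q * (K (p0 - q) * w q))"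
        by (intro integral_cong_AE) measurable
      then show ?thesis using 1 by (simp add: has_bochner_integral_iff)
    qed
    show ?thesis using lborel_pair.Fubini_integral[of "\<lambda>s q. ?F (s, q)"] F lhs rhs by simp
  qed
  have "((\<lambda>t. integral {0..t} g) has_real_derivative g 1) (at 1 within {0..2})"
    by (rule integral_has_real_derivative) (auto intro: continuous_on_subset[OF g_cont])
  then have "((\<lambda>t. conv K w p0 + integral {0..t} g) has_real_derivative g 1) (at 1 within {0..2})"
    by (auto intro!: derivative_eq_intros)
  moreover have "at (1::real) within {0..2} = at 1" by (rule at_within_interior) simp
  ultimately have "((\<lambda>t. conv K w p0 + integral {0..t} g) has_real_derivative g 1) (at 1)" by simp
  then have "((\<lambda>t. conv K w (p0 + t *\<^sub>R e)) has_real_derivative g 1) (at 1)"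
    by (rule has_field_derivative_transform_within_open[of _ _ _ "{0<..}"]) (use FTC in \<open>auto simp: algebra_simps\<close>)
  then have "((\<lambda>t. conv K w (p0 + (t + 1) *\<^sub>R e)) has_real_derivative g 1) (at 0)"
    using DERIV_shift[of "\<lambda>t. conv K w (p0 + t *\<^sub>R e)" "g 1" 0 1] by simp
  then show ?thesis by (simp add: g_def p0_def algebra_simps)
qed

section \<open>Smoothness\<close>

definition KL :: "real \<times> real \<Rightarrow> real" where "KL q = ln (cosh (snd q) - cos (fst q))"
definition KX :: "real \<times> real \<Rightarrow> real" where "KX q = sin (fst q) / (cosh (snd q) - cos (fst q))"
definition KY :: "real \<times> real \<Rightarrow> real" where "KY q = sinh (snd q) / (cosh (snd q) - cos (fst q))"

lemma measurable_cosh [measurable]: "(cosh :: real \<Rightarrow> real) \<in> borel_measurable borel"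
  and measurable_sinh [measurable]: "(sinh :: real \<Rightarrow> real) \<in> borel_measurable borel"
  by (auto intro!: borel_measurable_continuous_onI continuous_intros)

lemma measurable_kernels [measurable]:
  "KL \<in> borel_measurable borel" "KX \<in> borel_measurable borel" "KY \<in> borel_measurable borel"
  unfolding KL_def KX_def KY_def by measurable

lemma per_kernels: "per KL" "per KX" "per KY"
  by (simp_all add: per_def KL_def KX_def KY_def)

lemma lkerI:
  assumes [measurable]: "k \<in> borel_measurable borel" and "per k"
    and "\<And>R. 0 \<le> R \<Longrightarrow> \<exists>\<kappa> \<mu>. integrable lborel \<kappa> \<and> integrable lborel \<mu> \<and>
        (AE q in lborel. fst q \<in> {-pi..<pi} \<longrightarrow> \<bar>snd q\<bar> \<le> R \<longrightarrow> \<bar>k q\<bar> \<le> \<kappa> (fst q) * \<mu> (snd q))"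
  shows "lker k"
  unfolding lker_def
proof (intro conjI allI assms)
  fix R :: real
  show "integrable lborel (\<lambda>q. indicator ({-pi..<pi} \<times> {-R..R}) q * k q)"
  proof (cases "0 \<le> R")
    case True
    then obtain \<kappa> \<mu> where k: "integrable lborel \<kappa>" "integrable lborel \<mu>"
      "AE q in lborel. fst q \<in> {-pi..<pi} \<longrightarrow> \<bar>snd q\<bar> \<le> R \<longrightarrow> \<bar>k q\<bar> \<le> \<kappa> (fst q) * \<mu> (snd q)"
      using assms(3) by blast
    show ?thesis
    proof (rule Bochner_Integration.integrable_bound[OF integrable_lborel_Times(1)[OF k(1,2)]])
      have "{-pi..<pi} \<times> {-R..R} \<in> sets (borel \<Otimes>\<^sub>M (borel :: real measure))" by (intro pair_measureI) auto
      then have [measurable]: "{-pi..<pi} \<times> {-R..R} \<in> sets (borel :: (real \<times> real) measure)" by (simp only: borel_prod)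
      show "(\<lambda>q. indicator ({-pi..<pi} \<times> {-R..R}) q * k q) \<in> borel_measurable lborel" by measurable
      show "AE q in lborel. norm (indicator ({-pi..<pi} \<times> {-R..R}) q * k q) \<le> norm (\<kappa> (fst q) * \<mu> (snd q))"
        using k(3)
      proof eventually_elim
        case (elim q)
        then show ?case by (cases q) (auto simp: indicator_def abs_le_iff)
      qed
    qed
  next
    case False
    then have "{-pi..<pi} \<times> {-R..R} = {}" by auto
    then show ?thesis by simp
  qed
qed

lemma integrable_powr_window:
  "- 1 < a \<Longrightarrow> 0 \<le> R \<Longrightarrow> integrable lborel (\<lambda>u. indicator {-R..R} u * \<bar>u\<bar> powr a)" for a R :: real
  using integrable_powr_symmetric by (simp add: has_bochner_integral_iff)

lemma lker_KL: "lker KL"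
proof (rule lkerI)
  fix R :: real assume "0 \<le> R"
  show "\<exists>\<kappa> \<mu>. integrable lborel \<kappa> \<and> integrable lborel \<mu> \<and>
        (AE q in lborel. fst q \<in> {-pi..<pi} \<longrightarrow> \<bar>snd q\<bar> \<le> R \<longrightarrow> \<bar>KL q\<bar> \<le> \<kappa> (fst q) * \<mu> (snd q))"
  proof (intro exI conjI)
    show "integrable lborel (\<lambda>u. indicator {-pi..pi} u * (cosh R + 1) + 8 * (indicator {-pi..pi} u * \<bar>u\<bar> powr (- (1/2))))"
      by (intro Bochner_Integration.integrable_add integrable_mult_right integrable_powr_window
          integrable_on_window_continuous continuous_intros) auto
    show "integrable lborel (\<lambda>v. indicator {-R..R} v * (1::real))"
      by (intro integrable_on_window_continuous continuous_intros)
    show "AE q in lborel. fst q \<in> {-pi..<pi} \<longrightarrow> \<bar>snd q\<bar> \<le> R \<longrightarrow> \<bar>KL q\<bar> \<le>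
      (indicator {-pi..pi} (fst q) * (cosh R + 1) + 8 * (indicator {-pi..pi} (fst q) * \<bar>fst q\<bar> powr (- (1/2)))) *
      (indicator {-R..R} (snd q) * 1)"
      using AE_fst_neq[of 0]
    proof eventually_elim
      case (elim q)
      show ?case
      proof (intro impI)
        assume q: "fst q \<in> {-pi..<pi}" "\<bar>snd q\<bar> \<le> R"
        then have "\<bar>fst q\<bar> \<le> pi" "snd q \<in> {-R..R}" by (auto simp: abs_le_iff)
        with abs_ln_kernel_le[of "fst q" "snd q" R] elim q show "\<bar>KL q\<bar> \<le> (indicator {-pi..pi} (fst q) * (cosh R + 1) + 8 * (indicator {-pi..pi} (fst q) * \<bar>fst q\<bar> powr (- (1/2)))) *
      (indicator {-R..R} (snd q) * 1)"
          by (simp add: KL_def)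
      qed
    qed
  qed
qed (auto simp: per_kernels)

lemma lker_KX: "lker KX"
proof (rule lkerI)
  fix R :: real assume R: "0 \<le> R"
  show "\<exists>\<kappa> \<mu>. integrable lborel \<kappa> \<and> integrable lborel \<mu> \<and>
        (AE q in lborel. fst q \<in> {-pi..<pi} \<longrightarrow> \<bar>snd q\<bar> \<le> R \<longrightarrow> \<bar>KX q\<bar> \<le> \<kappa> (fst q) * \<mu> (snd q))"
  proof (intro exI conjI)
    show "integrable lborel (\<lambda>u. 16 * (indicator {-pi..pi} u * \<bar>u\<bar> powr (- (1/2))))"
      by (intro integrable_mult_right integrable_powr_window) auto
    show "integrable lborel (\<lambda>v. indicator {-R..R} v * \<bar>v\<bar> powr (- (1/2)))"
      by (intro integrable_powr_window R) auto
    show "AE q in lborel. fst q \<in> {-pi..<pi} \<longrightarrow> \<bar>snd q\<bar> \<le> R \<longrightarrow> \<bar>KX q\<bar> \<le>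
      (16 * (indicator {-pi..pi} (fst q) * \<bar>fst q\<bar> powr (- (1/2)))) * (indicator {-R..R} (snd q) * \<bar>snd q\<bar> powr (- (1/2)))"
      using AE_lborel_snd_neq[of 0]
    proof eventually_elim
      case (elim q)
      show ?case
      proof (intro impI)
        assume q: "fst q \<in> {-pi..<pi}" "\<bar>snd q\<bar> \<le> R"
        then have "\<bar>fst q\<bar> \<le> pi" "snd q \<in> {-R..R}" by (auto simp: abs_le_iff)
        with kernel_x_le[of "fst q" "snd q" "1/2"] elim q show "\<bar>KX q\<bar> \<le> (16 * (indicator {-pi..pi} (fst q) * \<bar>fst q\<bar> powr (- (1/2)))) * (indicator {-R..R} (snd q) * \<bar>snd q\<bar> powr (- (1/2)))"
          by (simp add: KX_def)
      qed
    qed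
  qed
qed (auto simp: per_kernels)

lemma lker_KY: "lker KY"
proof (rule lkerI)
  fix R :: real assume R: "0 \<le> R"
  show "\<exists>\<kappa> \<mu>. integrable lborel \<kappa> \<and> integrable lborel \<mu> \<and>
        (AE q in lborel. fst q \<in> {-pi..<pi} \<longrightarrow> \<bar>snd q\<bar> \<le> R \<longrightarrow> \<bar>KY q\<bar> \<le> \<kappa> (fst q) * \<mu> (snd q))"
  proof (intro exI conjI)
    show "integrable lborel (\<lambda>u. (16 * cosh R) * (indicator {-pi..pi} u * \<bar>u\<bar> powr (- (1/2))))"
      by (intro integrable_mult_right integrable_powr_window) auto
    show "integrable lborel (\<lambda>v. indicator {-R..R} v * \<bar>v\<bar> powr (- (1/2)))"
      by (intro integrable_powr_window R) auto
    show "AE q in lborel. fst q \<in> {-pi..<pi} \<longrightarrow> \<bar>snd q\<bar> \<le> R \<longrightarrow> \<bar>KY q\<bar> \<le>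
      ((16 * cosh R) * (indicator {-pi..pi} (fst q) * \<bar>fst q\<bar> powr (- (1/2)))) * (indicator {-R..R} (snd q) * \<bar>snd q\<bar> powr (- (1/2)))"
      using AE_fst_neq[of 0]
    proof eventually_elim
      case (elim q)
      show ?case
      proof (intro impI)
        assume q: "fst q \<in> {-pi..<pi}" "\<bar>snd q\<bar> \<le> R"
        then have "\<bar>fst q\<bar> \<le> pi" "snd q \<in> {-R..R}" by (auto simp: abs_le_iff)
        with kernel_y_le[of "fst q" "snd q" R "1/2"] elim q show "\<bar>KY q\<bar> \<le> ((16 * cosh R) * (indicator {-pi..pi} (fst q) * \<bar>fst q\<bar> powr (- (1/2)))) * (indicator {-R..R} (snd q) * \<bar>snd q\<bar> powr (- (1/2)))"
          by (simp add: KY_def)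
      qed
    qed
  qed
qed (auto simp: per_kernels)

text \<open>A horizontal line meets a singularity only if the heights of p and q agree, a vertical
  one only if their abscissae agree modulo 2 \<pi>. Both sets of exceptional q are null.\<close>

lemma conv_KL_has_derivative:
  assumes w: "good r w"
  shows "(conv KL w has_derivative (\<lambda>h. fst h * conv KX w p + snd h * conv KY w p)) (at p)"
proof (rule has_derivative_from_partials)
  fix x y :: real
  have shift: "(f has_real_derivative D) (at t)" if "((\<lambda>s. f (t + s)) has_real_derivative D) (at 0)" for f D and t :: real
    using that DERIV_shift[of f D 0 t] by (simp add: add.commute)
  have "((\<lambda>s. conv KL w ((x, y) + s *\<^sub>R (1, 0))) has_real_derivative conv KX w (x, y)) (at 0)"
  proof (rule conv_has_partial_kernel[OF lker_KL lker_KX w])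
    fix p :: "real \<times> real"
    show "AE q in lborel. \<forall>s. ((\<lambda>s. KL (p + s *\<^sub>R (1, 0) - q)) has_real_derivative KX (p + s *\<^sub>R (1, 0) - q)) (at s)
              \<and> isCont (\<lambda>s. KX (p + s *\<^sub>R (1, 0) - q)) s"
      using AE_lborel_snd_neq[of "snd p"]
    proof eventually_elim
      case (elim q)
      show ?case
      proof (intro allI)
        fix s
        have pos: "0 < cosh (snd p - snd q) - cos (fst p + s - fst q)" using elim by (intro kernel_arg_pos) auto
        show "((\<lambda>s. KL (p + s *\<^sub>R (1, 0) - q)) has_real_derivative KX (p + s *\<^sub>R (1, 0) - q)) (at s)
              \<and> isCont (\<lambda>s. KX (p + s *\<^sub>R (1, 0) - q)) s"
        proof
          have "((\<lambda>s. ln (cosh (snd p - snd q) - cos (fst p + s - fst q))) has_real_derivative sin (fst p + s - fst q) / (cosh (snd p - snd q) - cos (fst p + s - fst q))) (at s)"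
            using pos by (auto intro!: derivative_eq_intros)
          then show "((\<lambda>s. KL (p + s *\<^sub>R (1, 0) - q)) has_real_derivative KX (p + s *\<^sub>R (1, 0) - q)) (at s)"
            by (simp add: KL_def KX_def)
          have "isCont (\<lambda>s. sin (fst p + s - fst q) / (cosh (snd p - snd q) - cos (fst p + s - fst q))) s"
            using pos by (intro continuous_intros) auto
          then show "isCont (\<lambda>s. KX (p + s *\<^sub>R (1, 0) - q)) s" by (simp add: KX_def)
        qed
      qed
    qed
  qed
  then show "((\<lambda>x. conv KL w (x, y)) has_real_derivative conv KX w (x, y)) (at x)"
    using shift[of "\<lambda>t. conv KL w (t, y)" x] by simp
next
  fix x y :: real
  have shift: "(f has_real_derivative D) (at t)" if "((\<lambda>s. f (t + s)) has_real_derivative D) (at 0)" for f D and t :: real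
    using that DERIV_shift[of f D 0 t] by (simp add: add.commute)
  have "((\<lambda>s. conv KL w ((x, y) + s *\<^sub>R (0, 1))) has_real_derivative conv KY w (x, y)) (at 0)"
  proof (rule conv_has_partial_kernel[OF lker_KL lker_KY w])
    fix p :: "real \<times> real"
    have "AE q in (lborel :: (real \<times> real) measure). cos (fst p - fst q) \<noteq> 1" using AE_nonsingular[of "fst p" 0] by auto
    then show "AE q in lborel. \<forall>s. ((\<lambda>s. KL (p + s *\<^sub>R (0, 1) - q)) has_real_derivative KY (p + s *\<^sub>R (0, 1) - q)) (at s)
              \<and> isCont (\<lambda>s. KY (p + s *\<^sub>R (0, 1) - q)) s"
    proof eventually_elim
      case (elim q)
      show ?case
      proof (intro allI)
        fix s
        have pos: "0 < cosh (snd p + s - snd q) - cos (fst p - fst q)" using elim by (intro kernel_arg_pos) auto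
        show "((\<lambda>s. KL (p + s *\<^sub>R (0, 1) - q)) has_real_derivative KY (p + s *\<^sub>R (0, 1) - q)) (at s)
              \<and> isCont (\<lambda>s. KY (p + s *\<^sub>R (0, 1) - q)) s"
        proof
          have "((\<lambda>s. ln (cosh (snd p + s - snd q) - cos (fst p - fst q))) has_real_derivative sinh (snd p + s - snd q) / (cosh (snd p + s - snd q) - cos (fst p - fst q))) (at s)"
            using pos by (auto intro!: derivative_eq_intros)
          then show "((\<lambda>s. KL (p + s *\<^sub>R (0, 1) - q)) has_real_derivative KY (p + s *\<^sub>R (0, 1) - q)) (at s)"
            by (simp add: KL_def KY_def)
          have "isCont (\<lambda>s. sinh (snd p + s - snd q) / (cosh (snd p + s - snd q) - cos (fst p - fst q))) s"
            using pos by (intro continuous_intros) auto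
          then show "isCont (\<lambda>s. KY (p + s *\<^sub>R (0, 1) - q)) s" by (simp add: KY_def)
        qed
      qed
    qed
  qed
  then show "((\<lambda>y. conv KL w (x, y)) has_real_derivative conv KY w (x, y)) (at y)"
    using shift[of "\<lambda>t. conv KL w (x, t)" y] by simp
qed (rule good_conv_continuous[OF lker_KY w])


lemma conv_has_derivative:
  assumes k: "lker k" and w: "good r w" and wx: "good r wx" and wy: "good r wy"
    and d: "\<And>p. (w has_derivative (\<lambda>h. fst h * wx p + snd h * wy p)) (at p)"
  shows "(conv k w has_derivative (\<lambda>h. fst h * conv k wx p + snd h * conv k wy p)) (at p)"
proof (rule has_derivative_from_partials)
  have line: "((\<lambda>s. w (p + s *\<^sub>R e)) has_real_derivative fst e * wx p + snd e * wy p) (at 0)" for p e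
  proof -
    have "((\<lambda>s. w (p + s *\<^sub>R e)) has_derivative (\<lambda>t. fst (t *\<^sub>R e) * wx p + snd (t *\<^sub>R e) * wy p)) (at 0)"
      by (rule has_derivative_compose[of "\<lambda>s. p + s *\<^sub>R e" "\<lambda>t. t *\<^sub>R e"]) (use d in \<open>auto intro!: derivative_eq_intros\<close>)
    moreover have "(\<lambda>t. fst (t *\<^sub>R e) * wx p + snd (t *\<^sub>R e) * wy p) = (*) (fst e * wx p + snd e * wy p)"
      by (auto simp: algebra_simps)
    ultimately show ?thesis by (simp add: has_field_derivative_def)
  qed
  have shift: "(f has_real_derivative D) (at t)" if "((\<lambda>s. f (t + s)) has_real_derivative D) (at 0)" for f D and t :: real
    using that DERIV_shift[of f D 0 t] by (simp add: add.commute)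
  fix x y :: real
  have "((\<lambda>s. conv k w ((x, y) + s *\<^sub>R (1, 0))) has_real_derivative conv k wx (x, y)) (at 0)"
    by (rule conv_has_partial[OF k w wx]) (use line[of _ "(1, 0)"] in simp)
  then show "((\<lambda>x. conv k w (x, y)) has_real_derivative conv k wx (x, y)) (at x)"
    using shift[of "\<lambda>t. conv k w (t, y)" x] by simp
  have "((\<lambda>s. conv k w ((x, y) + s *\<^sub>R (0, 1))) has_real_derivative conv k wy (x, y)) (at 0)"
    by (rule conv_has_partial[OF k w wy]) (use line[of _ "(0, 1)"] in simp)
  then show "((\<lambda>y. conv k w (x, y)) has_real_derivative conv k wy (x, y)) (at y)"
    using shift[of "\<lambda>t. conv k w (x, t)" y] by simp
qed (rule good_conv_continuous[OF k wy])

text \<open>Finite levels of the coinductive \<open>smooth2\<close>. The bootstrap for the profile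
  gains one derivative at a time and therefore runs by induction on a level.\<close>

fun Ck :: "nat \<Rightarrow> (real \<times> real \<Rightarrow> real) \<Rightarrow> bool" where
  "Ck 0 f \<longleftrightarrow> continuous_on UNIV f"
| "Ck (Suc n) f \<longleftrightarrow> (\<exists>fx fy. (\<forall>p. (f has_derivative (\<lambda>h. fst h * fx p + snd h * fy p)) (at p)) \<and> Ck n fx \<and> Ck n fy)"

lemma Ck_SucI:
  "(\<And>p. (f has_derivative (\<lambda>h. fst h * fx p + snd h * fy p)) (at p)) \<Longrightarrow> Ck n fx \<Longrightarrow> Ck n fy \<Longrightarrow> Ck (Suc n) f"
  unfolding Ck.simps by blast

lemma gradient_unique:
  fixes a b c d :: real
  assumes "(f has_derivative (\<lambda>h. fst h * a + snd h * b)) (at (p :: real \<times> real))"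
    and "(f has_derivative (\<lambda>h. fst h * c + snd h * d)) (at p)"
  shows "a = c" "b = d"
  using fun_cong[OF has_derivative_unique[OF assms], of "(1, 0)"] fun_cong[OF has_derivative_unique[OF assms], of "(0, 1)"]
  by auto

lemma Ck_continuous: "Ck n f \<Longrightarrow> continuous_on UNIV f"
proof (cases n)
  case (Suc m)
  assume "Ck n f"
  then obtain fx fy where "\<forall>p. (f has_derivative (\<lambda>h. fst h * fx p + snd h * fy p)) (at p)"
    unfolding Suc Ck.simps by blast
  then have "\<forall>p. isCont f p" by (meson has_derivative_continuous)
  then show ?thesis by (simp add: continuous_on_eq_continuous_at del: split_paired_All)
qed simp

lemma Ck_mono1: "Ck (Suc n) f \<Longrightarrow> Ck n f"
proof (induction n arbitrary: f)
  case 0 then show ?case using Ck_continuous[OF 0] by simp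
next
  case (Suc n)
  then obtain fx fy where f: "\<forall>p. (f has_derivative (\<lambda>h. fst h * fx p + snd h * fy p)) (at p)"
      "Ck (Suc n) fx" "Ck (Suc n) fy" unfolding Ck.simps(2)[of "Suc n" f] by blast
  have "Ck n fx" "Ck n fy" using f Suc.IH by blast+
  with f(1) show ?case unfolding Ck.simps(2)[of n f] by blast
qed

text \<open>Each level supplies its own partial derivatives. Uniqueness of the gradient identifies
  them, so one pair has all levels and the coinduction can proceed.\<close>

lemma smooth2_if_Ck: assumes "\<And>n. Ck n f" shows "smooth2 f"
proof -
  have "\<forall>n. Ck n f" using assms by blast
  then show ?thesis
  proof (coinduction arbitrary: f)
    case smooth2
    then have "Ck (Suc 0) f" by blast
    then obtain fx fy where f: "\<forall>p. (f has_derivative (\<lambda>h. fst h * fx p + snd h * fy p)) (at p)"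
      unfolding Ck.simps(2)[of 0 f] by blast
    have "Ck n fx \<and> Ck n fy" for n
    proof -
      have "Ck (Suc n) f" using smooth2 by blast
      then obtain gx gy where g: "\<forall>p. (f has_derivative (\<lambda>h. fst h * gx p + snd h * gy p)) (at p)" "Ck n gx" "Ck n gy"
        unfolding Ck.simps(2)[of n f] by blast
      have "gx = fx" "gy = fy" using f g(1) gradient_unique by blast+
      with g show ?thesis by simp
    qed
    then show ?case using f by blast
  qed
qed

lemma Ck_const: "Ck n (\<lambda>p. c)"
proof (induction n arbitrary: c)
  case (Suc n)
  show ?case by (rule Ck_SucI[of _ "\<lambda>p. 0" "\<lambda>p. 0"]) (simp_all add: Suc)
qed simp

lemma Ck_snd: "Ck n snd"
proof (cases n)
  case (Suc m)
  have "(snd has_derivative (\<lambda>h. fst h * 0 + snd h * 1)) (at p)" for p :: "real \<times> real"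
    by (auto intro!: derivative_eq_intros)
  then show ?thesis unfolding Suc by (rule Ck_SucI) (rule Ck_const)+
qed (auto intro!: continuous_intros)

lemma Ck_add: "Ck n f \<Longrightarrow> Ck n g \<Longrightarrow> Ck n (\<lambda>p. f p + g p)"
proof (induction n arbitrary: f g)
  case 0 then show ?case by (auto intro!: continuous_intros)
next
  case (Suc n)
  obtain fx fy where f: "\<forall>p. (f has_derivative (\<lambda>h. fst h * fx p + snd h * fy p)) (at p)" "Ck n fx" "Ck n fy"
    using Suc.prems(1) unfolding Ck.simps by blast
  obtain gx gy where g: "\<forall>p. (g has_derivative (\<lambda>h. fst h * gx p + snd h * gy p)) (at p)" "Ck n gx" "Ck n gy"
    using Suc.prems(2) unfolding Ck.simps by blast
  have "((\<lambda>p. f p + g p) has_derivative (\<lambda>h. fst h * (fx p + gx p) + snd h * (fy p + gy p))) (at p)" for p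
    using has_derivative_add[OF f(1)[rule_format, of p] g(1)[rule_format, of p]] by (simp add: algebra_simps)
  moreover have "Ck n (\<lambda>p. fx p + gx p)" "Ck n (\<lambda>p. fy p + gy p)" by (intro Suc.IH f g)+
  ultimately show ?case by (rule Ck_SucI)
qed

lemma Ck_mult: "Ck n f \<Longrightarrow> Ck n g \<Longrightarrow> Ck n (\<lambda>p. f p * g p)"
proof (induction n arbitrary: f g)
  case 0 then show ?case by (auto intro!: continuous_intros)
next
  case (Suc n)
  obtain fx fy where f: "\<forall>p. (f has_derivative (\<lambda>h. fst h * fx p + snd h * fy p)) (at p)" "Ck n fx" "Ck n fy"
    using Suc.prems(1) unfolding Ck.simps by blast
  obtain gx gy where g: "\<forall>p. (g has_derivative (\<lambda>h. fst h * gx p + snd h * gy p)) (at p)" "Ck n gx" "Ck n gy"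
    using Suc.prems(2) unfolding Ck.simps by blast
  have "((\<lambda>p. f p * g p) has_derivative (\<lambda>h. fst h * (f p * gx p + fx p * g p) + snd h * (f p * gy p + fy p * g p))) (at p)" for p
    using has_derivative_mult[OF f(1)[rule_format, of p] g(1)[rule_format, of p]] by (simp add: algebra_simps)
  moreover have "Ck n (\<lambda>p. f p * gx p + fx p * g p)" "Ck n (\<lambda>p. f p * gy p + fy p * g p)"
    by (intro Ck_add Suc.IH f g Suc.prems[THEN Ck_mono1])+
  ultimately show ?case by (rule Ck_SucI)
qed

text \<open>Functions of the form \<open>G \<cdot> expinv P (E)\<close>, truncated to \<open>\<bar>y\<bar> < b\<close>, are stable under differentiation
  as soon as \<open>E \<le> 0\<close> near the edge of the strip; there the truncation is invisible.\<close>

definition trunc :: "real \<Rightarrow> (real \<times> real \<Rightarrow> real) \<Rightarrow> real \<times> real \<Rightarrow> real" where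
  "trunc b f p = (if \<bar>snd p\<bar> < b then f p else 0)"

lemma trunc_has_derivative:
  assumes "a < b" and E0: "\<And>p. a \<le> \<bar>snd p\<bar> \<Longrightarrow> \<bar>snd p\<bar> < b \<Longrightarrow> E p \<le> 0"
    and G: "(G has_derivative (\<lambda>h. fst h * Gx + snd h * Gy)) (at p)"
    and E: "(E has_derivative (\<lambda>h. fst h * Dx + snd h * Dy)) (at p)"
  shows "(trunc b (\<lambda>p. G p * expinv P (E p)) has_derivative
     (\<lambda>h. fst h * trunc b (\<lambda>p. Gx * expinv P (E p) + (G p * Dx) * expinv (expinv_deriv P) (E p)) p
        + snd h * trunc b (\<lambda>p. Gy * expinv P (E p) + (G p * Dy) * expinv (expinv_deriv P) (E p)) p)) (at p)"
proof (cases "\<bar>snd p\<bar> < b")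
  case True
  have "((\<lambda>p. expinv P (E p)) has_derivative (\<lambda>h. (fst h * Dx + snd h * Dy) * expinv (expinv_deriv P) (E p))) (at p)"
    using has_derivative_compose[OF E, of "expinv P"] DERIV_expinv[of P "E p"]
    by (simp add: has_field_derivative_def mult.commute)
  from has_derivative_mult[OF G this]
  have "((\<lambda>p. G p * expinv P (E p)) has_derivative
     (\<lambda>h. fst h * (Gx * expinv P (E p) + (G p * Dx) * expinv (expinv_deriv P) (E p))
        + snd h * (Gy * expinv P (E p) + (G p * Dy) * expinv (expinv_deriv P) (E p)))) (at p)"
    by (simp add: algebra_simps)
  then have "(trunc b (\<lambda>p. G p * expinv P (E p)) has_derivative
     (\<lambda>h. fst h * (Gx * expinv P (E p) + (G p * Dx) * expinv (expinv_deriv P) (E p))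
        + snd h * (Gy * expinv P (E p) + (G p * Dy) * expinv (expinv_deriv P) (E p)))) (at p)"
  proof (rule has_derivative_transform_within_open[where s = "{p. \<bar>snd p\<bar> < b}"])
    show "open {p :: real \<times> real. \<bar>snd p\<bar> < b}" by (intro open_Collect_less continuous_intros)
  qed (use True in \<open>auto simp: trunc_def\<close>)
  then show ?thesis using True by (simp add: trunc_def)
next
  \<comment> \<open>Beyond \<open>a\<close> the function vanishes on both sides of the edge
    \<open>b\<close>: inside because E <= 0, outside by truncation. Hence it is 0 in a whole
    neighbourhood of p.\<close>
  case False
  have "((\<lambda>p. 0) has_derivative (\<lambda>h. fst h * 0 + snd h * 0)) (at p)" by simp
  then have "(trunc b (\<lambda>p. G p * expinv P (E p)) has_derivative (\<lambda>h. fst h * 0 + snd h * 0)) (at p)"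
  proof (rule has_derivative_transform_within_open[where s = "{p. a < \<bar>snd p\<bar>}"])
    show "open {p :: real \<times> real. a < \<bar>snd p\<bar>}" by (intro open_Collect_less continuous_intros)
  qed (use False \<open>a < b\<close> E0 in \<open>auto simp: trunc_def\<close>)
  then show ?thesis using False by (simp add: trunc_def)
qed

lemma trunc_continuous:
  assumes "a < b" and E0: "\<And>p. a \<le> \<bar>snd p\<bar> \<Longrightarrow> \<bar>snd p\<bar> < b \<Longrightarrow> E p \<le> 0"
    and G: "continuous_on UNIV G" and E: "continuous_on UNIV E"
  shows "continuous_on UNIV (trunc b (\<lambda>p. G p * expinv P (E p)))"
proof -
  let ?A = "{p :: real \<times> real. \<bar>snd p\<bar> < b}" and ?B = "{p :: real \<times> real. a < \<bar>snd p\<bar>}"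
  have o: "open ?A" "open ?B" by (intro open_Collect_less continuous_intros)+
  have "continuous_on ?A (trunc b (\<lambda>p. G p * expinv P (E p)))"
    by (rule continuous_on_eq[of _ "\<lambda>p. G p * expinv P (E p)"])
       (auto simp: trunc_def intro!: continuous_intros continuous_on_subset[OF G] continuous_on_subset[OF E])
  moreover have "continuous_on ?B (trunc b (\<lambda>p. G p * expinv P (E p)))"
    by (rule continuous_on_eq[of _ "\<lambda>p. 0"]) (use E0 in \<open>auto simp: trunc_def\<close>)
  ultimately have "continuous_on (?A \<union> ?B) (trunc b (\<lambda>p. G p * expinv P (E p)))"
    using o by (intro continuous_on_open_Un)
  moreover have "?A \<union> ?B = UNIV" using \<open>a < b\<close> by auto
  ultimately show ?thesis by simp
qed

lemma Ck_trunc: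
  assumes "a < b" and E0: "\<And>p. a \<le> \<bar>snd p\<bar> \<Longrightarrow> \<bar>snd p\<bar> < b \<Longrightarrow> E p \<le> 0"
  shows "Ck n G \<Longrightarrow> Ck n E \<Longrightarrow> Ck n (trunc b (\<lambda>p. G p * expinv P (E p)))"
proof (induction n arbitrary: G P)
  case 0
  then show ?case using trunc_continuous[OF assms] by simp
next
  case (Suc n)
  obtain Gx Gy where G: "\<forall>p. (G has_derivative (\<lambda>h. fst h * Gx p + snd h * Gy p)) (at p)" "Ck n Gx" "Ck n Gy"
    using Suc.prems(1) unfolding Ck.simps by blast
  obtain Dx Dy where E: "\<forall>p. (E has_derivative (\<lambda>h. fst h * Dx p + snd h * Dy p)) (at p)" "Ck n Dx" "Ck n Dy"
    using Suc.prems(2) unfolding Ck.simps by blast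
  let ?Q = "expinv_deriv P"
  have split: "trunc b (\<lambda>p'. A p * expinv P (E p') + (G p' * B p) * expinv ?Q (E p')) p
      = trunc b (\<lambda>p. A p * expinv P (E p)) p + trunc b (\<lambda>p. (G p * B p) * expinv ?Q (E p)) p" for A B p
    by (simp add: trunc_def)
  have "(trunc b (\<lambda>p. G p * expinv P (E p)) has_derivative
     (\<lambda>h. fst h * (trunc b (\<lambda>p. Gx p * expinv P (E p)) p + trunc b (\<lambda>p. (G p * Dx p) * expinv ?Q (E p)) p)
        + snd h * (trunc b (\<lambda>p. Gy p * expinv P (E p)) p + trunc b (\<lambda>p. (G p * Dy p) * expinv ?Q (E p)) p))) (at p)" for p
    using trunc_has_derivative[OF assms G(1)[rule_format, of p] E(1)[rule_format, of p], of P] unfolding split .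
  moreover note GE = Suc.prems[THEN Ck_mono1]
  have "Ck n (\<lambda>p. trunc b (\<lambda>p. Gx p * expinv P (E p)) p + trunc b (\<lambda>p. (G p * Dx p) * expinv ?Q (E p)) p)"
    "Ck n (\<lambda>p. trunc b (\<lambda>p. Gy p * expinv P (E p)) p + trunc b (\<lambda>p. (G p * Dy p) * expinv ?Q (E p)) p)"
    by (intro Ck_add Suc.IH Ck_mult G E GE)+
  ultimately show ?case by (rule Ck_SucI)
qed

lemma good_gradient:
  assumes w: "good r w" and d: "\<And>p. (w has_derivative (\<lambda>h. fst h * wx p + snd h * wy p)) (at p)"
    and c: "continuous_on UNIV wx" "continuous_on UNIV wy"
  shows "good r wx" "good r wy"
proof -
  have P: "wx (x + 2 * pi, y) = wx (x, y) \<and> wy (x + 2 * pi, y) = wy (x, y)" for x y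
  proof -
    have "((\<lambda>p. w (p + (2 * pi, 0))) has_derivative (\<lambda>h. fst h * wx ((x, y) + (2 * pi, 0)) + snd h * wy ((x, y) + (2 * pi, 0)))) (at (x, y))"
      by (rule has_derivative_compose[of "\<lambda>p. p + (2 * pi, 0)" "\<lambda>h. h", OF _ d]) (auto intro!: derivative_eq_intros)
    moreover have "(\<lambda>p. w (p + (2 * pi, 0))) = w"
      using w by (auto simp: good_def per_def fun_eq_iff)
    ultimately show ?thesis using gradient_unique[OF _ d] by force
  qed
  have S: "wx p = 0 \<and> wy p = 0" if "r < \<bar>snd p\<bar>" for p
  proof -
    have "((\<lambda>p. 0) has_derivative (\<lambda>h. fst h * 0 + snd h * 0)) (at p)" by simp
    then have "(w has_derivative (\<lambda>h. fst h * 0 + snd h * 0)) (at p)"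
    proof (rule has_derivative_transform_within_open[where s = "{p. r < \<bar>snd p\<bar>}"])
      show "open {p :: real \<times> real. r < \<bar>snd p\<bar>}" by (intro open_Collect_less continuous_intros)
    qed (use that w in \<open>auto simp: good_def strip_def\<close>)
    from gradient_unique[OF d this] show ?thesis by simp
  qed
  show "good r wx" "good r wy" using P S c by (auto simp: good_def per_def strip_def)
qed

lemma Ck_conv: "lker k \<Longrightarrow> good r w \<Longrightarrow> Ck n w \<Longrightarrow> Ck n (conv k w)"
proof (induction n arbitrary: w)
  case 0 then show ?case using good_conv_continuous by simp
next
  case (Suc n)
  obtain wx wy where w: "\<And>p. (w has_derivative (\<lambda>h. fst h * wx p + snd h * wy p)) (at p)" "Ck n wx" "Ck n wy"
    using Suc.prems(3) unfolding Ck.simps by blast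
  have g: "good r wx" "good r wy" using good_gradient[OF Suc.prems(2) w(1) w(2,3)[THEN Ck_continuous]] by simp_all
  have "(conv k w has_derivative (\<lambda>h. fst h * conv k wx p + snd h * conv k wy p)) (at p)" for p
    by (rule conv_has_derivative[OF Suc.prems(1,2) g w(1)])
  moreover have "Ck n (conv k wx)" "Ck n (conv k wy)" by (intro Suc.IH Suc.prems(1) g w)+
  ultimately show ?case by (rule Ck_SucI)
qed

text \<open>The gain of one derivative: the kernel absorbs it, and its gradient is still locally
  integrable.\<close>

lemma Ck_Suc_conv_KL: assumes "good r w" "Ck n w" shows "Ck (Suc n) (conv KL w)"
  by (rule Ck_SucI[OF conv_KL_has_derivative[OF assms(1)] Ck_conv[OF lker_KX assms] Ck_conv[OF lker_KY assms]])

section \<open>The fixed point\<close>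

definition profile :: "real \<Rightarrow> (real \<times> real \<Rightarrow> real) \<Rightarrow> real \<times> real \<Rightarrow> real" where
  "profile \<delta> \<phi> p = bump (1 - (snd p)\<^sup>2 / (2 * \<delta>\<^sup>2) + \<phi> p)"

definition profile_deriv :: "real \<Rightarrow> real \<Rightarrow> real" where "profile_deriv \<delta> y = bump' (1 - y\<^sup>2 / (2 * \<delta>\<^sup>2))"

definition bump_mass :: real where "bump_mass = (LINT y|lborel. profile_deriv 1 y)"

text \<open>Point symmetry, rather than evenness in \<open>x\<close>, excludes the mode \<open>sin x\<close>: it only needs the reflection of the plane.\<close>

definition admissible :: "(real \<times> real \<Rightarrow> real) \<Rightarrow> bool" where
  "admissible \<phi> \<longleftrightarrow> continuous_on UNIV \<phi> \<and> per \<phi> \<and> (\<forall>p. \<phi> (- p) = \<phi> p) \<and> (\<forall>p. \<bar>\<phi> p\<bar> \<le> 1/2)"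

lemma quotient_gt_2: fixes \<delta> y :: real assumes "0 < \<delta>" "2 * \<delta> < \<bar>y\<bar>" shows "2 < y\<^sup>2 / (2 * \<delta>\<^sup>2)"
proof -
  have "(2 * \<delta>)\<^sup>2 < \<bar>y\<bar>\<^sup>2" using assms by (intro power_strict_mono) auto
  then show ?thesis using assms(1) by (subst pos_less_divide_eq) (auto simp: power_mult_distrib)
qed

text \<open>The argument of the bump is below 1 - 2 + 1/2, so the layer |y| <= 2 \<delta> contains
  the support for all admissible \<phi> at once.\<close>

lemma profile_zero: "0 < \<delta> \<Longrightarrow> \<bar>\<phi> p\<bar> \<le> 1/2 \<Longrightarrow> 2 * \<delta> < \<bar>snd p\<bar> \<Longrightarrow> profile \<delta> \<phi> p = 0"
  using quotient_gt_2[of \<delta> "snd p"] unfolding profile_def by (intro expinv_nonpos) linarith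

lemma profile_deriv_zero: "0 < \<delta> \<Longrightarrow> 2 * \<delta> < \<bar>y\<bar> \<Longrightarrow> profile_deriv \<delta> y = 0"
  using quotient_gt_2[of \<delta> y] unfolding profile_deriv_def by (intro expinv_nonpos) linarith

lemma profile_deriv_nonneg: "0 \<le> profile_deriv \<delta> y" by (simp add: profile_deriv_def bump'_nonneg)

lemma profile_bounds: "\<bar>profile \<delta> \<phi> p\<bar> \<le> 1" using bump_bounds by (simp add: profile_def)

lemma profile_good: assumes "0 < \<delta>" "admissible \<phi>" shows "good (2 * \<delta>) (profile \<delta> \<phi>)"
  unfolding good_def
proof (intro conjI)
  show "per (profile \<delta> \<phi>)" using assms(2) by (auto simp: per_def profile_def admissible_def)
  show "strip (2 * \<delta>) (profile \<delta> \<phi>)" using assms profile_zero unfolding strip_def admissible_def by blast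
  show "continuous_on UNIV (profile \<delta> \<phi>)" using assms unfolding profile_def admissible_def by (intro continuous_intros) auto
qed

lemma profile_deriv_continuous: "0 < \<delta> \<Longrightarrow> continuous_on A (profile_deriv \<delta>)"
  unfolding profile_deriv_def by (intro continuous_intros) auto

lemma profile_deriv_integrable: assumes "0 < \<delta>" shows "integrable lborel (profile_deriv \<delta>)"
proof -
  have "integrable lborel (\<lambda>y. indicator {-2*\<delta>..2*\<delta>} y * profile_deriv \<delta> y)"
    by (rule integrable_on_window_continuous[OF profile_deriv_continuous[OF assms]])
  moreover have "(\<lambda>y. indicator {-2*\<delta>..2*\<delta>} y * profile_deriv \<delta> y) = profile_deriv \<delta>"
    using profile_deriv_zero[OF assms] by (force simp: fun_eq_iff indicator_def)
  ultimately show ?thesis by simp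
qed

lemma profile_deriv_integral: assumes "0 < \<delta>" shows "(LINT y|lborel. profile_deriv \<delta> y) = \<delta> * bump_mass"
proof -
  have "(LINT y|lborel. profile_deriv \<delta> y) = \<bar>\<delta>\<bar> *\<^sub>R (LINT y|lborel. profile_deriv \<delta> (0 + \<delta> * y))"
    by (rule lborel_integral_real_affine) (use assms in auto)
  also have "(\<lambda>y. profile_deriv \<delta> (0 + \<delta> * y)) = profile_deriv 1" using assms by (simp add: profile_deriv_def fun_eq_iff power_mult_distrib)
  finally show ?thesis using assms by (simp add: bump_mass_def)
qed

lemma bump_mass_pos: "0 < bump_mass"
proof -
  have "0 \<le> bump_mass" unfolding bump_mass_def by (intro Bochner_Integration.integral_nonneg) (auto simp: profile_deriv_nonneg)
  moreover have "bump_mass \<noteq> 0"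
  proof
    assume "bump_mass = 0"
    then have "AE y in lborel. profile_deriv 1 y = 0"
      using integral_nonneg_eq_0_iff_AE[OF profile_deriv_integrable[of 1]] profile_deriv_nonneg by (auto simp: bump_mass_def)
    then have "AE y in lborel. y \<notin> {-1<..<1::real}"
    proof eventually_elim
      case (elim y)
      have "y \<in> {-1<..<1} \<Longrightarrow> 0 < profile_deriv 1 y" unfolding profile_deriv_def
      proof (rule bump'_pos)
        assume "y \<in> {-1<..<1}"
        then have "y\<^sup>2 < 1" by (simp add: abs_square_less_1 abs_less_iff)
        then show "0 < 1 - y\<^sup>2 / (2 * 1\<^sup>2)" by simp
      qed
      then show ?case using elim by auto
    qed
    then have "emeasure lborel {-1<..<1::real} = 0"
      by (subst (asm) AE_iff_measurable[of "{-1<..<1}"]) auto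
    then show False by simp
  qed
  ultimately show ?thesis by simp
qed

text \<open>Outside the layer all terms vanish, so the quadratic remainder carries an indicator of
  length 4 \<delta>. It thereby scales in \<delta> like the linear term.\<close>

lemma profile_linearization:
  assumes lip: "\<And>s t. \<bar>bump' s - bump' t\<bar> \<le> C * \<bar>s - t\<bar>" and C: "0 \<le> C" and "0 < \<delta>"
    and r: "\<bar>\<phi>1 p\<bar> \<le> r" "\<bar>\<phi>2 p\<bar> \<le> r" "r \<le> 1/2"
  shows "\<bar>profile \<delta> \<phi>1 p - profile \<delta> \<phi>2 p - profile_deriv \<delta> (snd p) * (\<phi>1 p - \<phi>2 p)\<bar>
      \<le> C * r * \<bar>\<phi>1 p - \<phi>2 p\<bar> * indicator {-2*\<delta>..2*\<delta>} (snd p)"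
proof (cases "\<bar>snd p\<bar> \<le> 2 * \<delta>")
  case True
  then have "snd p \<in> {-2*\<delta>..2*\<delta>}" by auto
  then show ?thesis using bump_linearization[OF lip r(1,2) C, of "1 - (snd p)\<^sup>2 / (2 * \<delta>\<^sup>2)"] by (simp add: profile_def profile_deriv_def)
next
  case False
  have "\<bar>\<phi>1 p\<bar> \<le> 1/2" "\<bar>\<phi>2 p\<bar> \<le> 1/2" using r by linarith+
  then have "profile \<delta> \<phi>1 p = 0" "profile \<delta> \<phi>2 p = 0" "profile_deriv \<delta> (snd p) = 0"
    using profile_zero[of \<delta>] profile_deriv_zero[of \<delta>] \<open>0 < \<delta>\<close> False by auto
  then show ?thesis using False by (auto simp: indicator_def abs_le_iff)
qed

lemma profile_lipschitz:
  assumes lip: "\<And>s t. \<bar>bump' s - bump' t\<bar> \<le> C * \<bar>s - t\<bar>" and C: "0 \<le> C" and "0 < \<delta>"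
    and r: "\<bar>\<phi>1 p\<bar> \<le> r" "\<bar>\<phi>2 p\<bar> \<le> r" "r \<le> 1/2" and d: "\<bar>\<phi>1 p - \<phi>2 p\<bar> \<le> d"
  shows "\<bar>profile \<delta> \<phi>1 p - profile \<delta> \<phi>2 p\<bar> \<le> (profile_deriv \<delta> (snd p) + C * r * indicator {-2*\<delta>..2*\<delta>} (snd p)) * d"
proof -
  have "\<bar>profile \<delta> \<phi>1 p - profile \<delta> \<phi>2 p\<bar> \<le> \<bar>profile_deriv \<delta> (snd p) * (\<phi>1 p - \<phi>2 p)\<bar> + C * r * \<bar>\<phi>1 p - \<phi>2 p\<bar> * indicator {-2*\<delta>..2*\<delta>} (snd p)"
    using profile_linearization[where p = p and ?\<phi>1.0 = \<phi>1 and ?\<phi>2.0 = \<phi>2, OF lip C assms(3) r] by linarith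
  also have "\<dots> = (profile_deriv \<delta> (snd p) + C * r * indicator {-2*\<delta>..2*\<delta>} (snd p)) * \<bar>\<phi>1 p - \<phi>2 p\<bar>"
  proof -
    have "\<bar>profile_deriv \<delta> (snd p) * (\<phi>1 p - \<phi>2 p)\<bar> = profile_deriv \<delta> (snd p) * \<bar>\<phi>1 p - \<phi>2 p\<bar>" by (simp add: abs_mult profile_deriv_nonneg)
    then show ?thesis by (simp only: distrib_right) (simp add: mult_ac)
  qed
  also have "\<dots> \<le> (profile_deriv \<delta> (snd p) + C * r * indicator {-2*\<delta>..2*\<delta>} (snd p)) * d"
    using profile_deriv_nonneg C r by (intro mult_left_mono d add_nonneg_nonneg mult_nonneg_nonneg) auto
  finally show ?thesis .
qed

section \<open>Convolution estimates on a thin layer\<close>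

definition ellk :: "real \<times> real \<Rightarrow> real" where "ellk q = ell (fst q)"
definition dk :: "real \<times> real \<Rightarrow> real" where "dk q = KL q - ln (1 - cos (fst q))"

lemma measurable_ellk [measurable]: "ellk \<in> borel_measurable borel" unfolding ellk_def by measurable
lemma measurable_dk [measurable]: "dk \<in> borel_measurable borel" unfolding dk_def by measurable

lemma lker_fst:
  assumes [measurable]: "f \<in> borel_measurable borel" and "\<And>x. f (x + 2 * pi) = f x"
    and i: "integrable lborel (\<lambda>u. indicator {-pi..pi} u * f u)"
  shows "lker (\<lambda>q. f (fst q))"
proof (rule lkerI)
  fix R :: real
  show "\<exists>\<kappa> \<mu>. integrable lborel \<kappa> \<and> integrable lborel \<mu> \<and>
        (AE q in lborel. fst q \<in> {-pi..<pi} \<longrightarrow> \<bar>snd q\<bar> \<le> R \<longrightarrow> \<bar>f (fst q)\<bar> \<le> \<kappa> (fst q) * \<mu> (snd q))"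
  proof (intro exI conjI)
    show "integrable lborel (\<lambda>u. \<bar>indicator {-pi..pi} u * f u\<bar>)" using i by simp
    show "integrable lborel (\<lambda>v. indicator {-R..R} v * (1::real))"
      by (intro integrable_on_window_continuous continuous_intros)
    show "AE q in lborel. fst q \<in> {-pi..<pi} \<longrightarrow> \<bar>snd q\<bar> \<le> R \<longrightarrow> \<bar>f (fst q)\<bar>
        \<le> \<bar>indicator {-pi..pi} (fst q) * f (fst q)\<bar> * (indicator {-R..R} (snd q) * (1::real))"
      by (intro AE_I2) (auto simp: indicator_def)
  qed
qed (use assms in \<open>auto simp: per_def\<close>)

lemma lker_ellk: "lker ellk"
  unfolding ellk_def by (rule lker_fst[of ell]) (simp_all add: integrable_ell, simp add: ell_def)

lemma lker_ln_one_minus_cos: "lker (\<lambda>q. ln (1 - cos (fst q)))"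
  proof (rule lker_fst[of "\<lambda>u. ln (1 - cos u)"])
    have "integrable lborel (\<lambda>u. indicator {-pi..pi} u * ln (2 - 2 * cos u) - indicator {-pi..pi} u * ln 2)"
      by (intro Bochner_Integration.integrable_diff integrable_ln_kernel integrable_on_window_continuous continuous_intros)
    then show "integrable lborel (\<lambda>u. indicator {-pi..pi} u * ln (1 - cos u))"
    proof (rule integrable_cong_AE_imp)
      show "AE u in lborel. indicator {-pi..pi} u * ln (2 - 2 * cos u) - indicator {-pi..pi} u * ln 2 =
          indicator {-pi..pi} u * ln (1 - cos u)"
        using AE_lborel_singleton[of 0]
      proof eventually_elim
        case (elim u)
        show ?case
        proof (cases "u \<in> {-pi..pi}")
          case True
          then have "0 < 1 - cos u" using one_minus_cos_pos[of u] elim by auto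
          then show ?thesis using ln_mult[of 2 "1 - cos u"] True by (simp add: algebra_simps)
        qed simp
      qed
    qed measurable
  qed auto

lemma lker_dk: "lker dk"
proof -
  note K0 = lker_ln_one_minus_cos
  have "integrable lborel (\<lambda>q. indicator ({-pi..<pi} \<times> {-R..R}) q * dk q)" for R
    using Bochner_Integration.integrable_diff[OF lkerD[OF lker_KL, of R] lkerD[OF K0, of R]]
    by (simp add: dk_def algebra_simps)
  moreover have "per dk" using per_kernels(1) by (simp add: per_def dk_def)
  ultimately show ?thesis by (simp add: lker_def)
qed

lemma integrable_reflect_real:
  fixes g :: "real \<Rightarrow> real" assumes "integrable lborel g"
  shows "integrable lborel (\<lambda>v. g (y - v))" "(LINT v|lborel. g (y - v)) = (LINT v|lborel. g v)"
  using has_bochner_integral_lborel_reflect[of g "LINT v|lborel. g v" y] assms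
  by (auto simp: has_bochner_integral_iff)

text \<open>Young's inequality for a kernel independent of y: the L1 norm of \<open>ell\<close>
  multiplies the mass of the majorant in y. This is where 9/5 \<pi> enters.\<close>

lemma conv_ellk_bound:
  assumes g: "integrable lborel g" "\<And>y. 0 \<le> g y" and V: "\<And>p. \<bar>V p\<bar> \<le> g (snd p)"
  shows "\<bar>conv ellk V p\<bar> \<le> 9/5 * pi * (LINT y|lborel. g y)"
proof -
  have i: "integrable lborel (\<lambda>u. indicator {-pi..pi} u * \<bar>ell u\<bar>)"
    using integrable_abs[OF integrable_ell] by (simp add: abs_mult)
  have "\<bar>conv ellk V p\<bar> \<le> (LINT u|lborel. indicator {-pi..pi} u * \<bar>ell u\<bar>) * (LINT v|lborel. g (snd p - v))"
  proof (rule conv_bound[OF i integrable_reflect_real(1)[OF g(1)]])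
    show "AE q in lborel. fst q \<in> {-pi..<pi} \<longrightarrow> \<bar>ellk q * V (p - q)\<bar> \<le> indicator {-pi..pi} (fst q) * \<bar>ell (fst q)\<bar> * g (snd p - snd q)"
    proof (intro AE_I2 impI)
      fix q :: "real \<times> real" assume q: "fst q \<in> {-pi..<pi}"
      have "\<bar>ell (fst q)\<bar> * \<bar>V (p - q)\<bar> \<le> \<bar>ell (fst q)\<bar> * g (snd (p - q))" by (intro mult_left_mono V) auto
      then show "\<bar>ellk q * V (p - q)\<bar> \<le> indicator {-pi..pi} (fst q) * \<bar>ell (fst q)\<bar> * g (snd p - snd q)"
        using q by (simp add: ellk_def abs_mult)
    qed
  qed (use g in auto)
  also have "\<dots> = (LINT u|lborel. indicator {-pi..pi} u * \<bar>ell u\<bar>) * (LINT y|lborel. g y)"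
    by (simp add: integrable_reflect_real[OF g(1)])
  also have "\<dots> \<le> 9/5 * pi * (LINT y|lborel. g y)"
    by (intro mult_right_mono ell_L1_bound Bochner_Integration.integral_nonneg) (use g in auto)
  finally show ?thesis .
qed

lemma has_bochner_integral_strip_indicator:
  "0 \<le> \<delta> \<Longrightarrow> has_bochner_integral lborel (\<lambda>y. B * indicator {-2*\<delta>..2*\<delta>} y :: real) (4 * \<delta> * B)"
  by (auto simp: has_bochner_integral_iff)

text \<open>Two points of the layer differ by at most 4 \<delta> in height, so |dk| <= 16 sqrt
  \<delta> |u| powr (-1/2). The integral over u is 4 sqrt \<pi> <= 8 times the constant, the layer
  has length 4 \<delta>, and 512 = 16 * 8 * 4. After division by \<delta> a factor sqrt \<delta>
  survives.\<close>

lemma conv_dk_bound: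
  assumes \<delta>: "0 < \<delta>" "\<delta> \<le> 1/4" and B: "0 \<le> B" and V: "\<And>p. \<bar>V p\<bar> \<le> B * indicator {-2*\<delta>..2*\<delta>} (snd p)"
    and p: "\<bar>snd p\<bar> \<le> 2 * \<delta>"
  shows "\<bar>conv dk V p\<bar> \<le> 512 * sqrt \<delta> * \<delta> * B"
proof -
  let ?\<kappa> = "\<lambda>u::real. 16 * sqrt \<delta> * (indicator {-pi..pi} u * \<bar>u\<bar> powr (- (1/2)))"
  have pw: "has_bochner_integral lborel (\<lambda>u::real. indicator {-pi..pi} u * \<bar>u\<bar> powr (- (1/2))) (4 * sqrt pi)"
    using integrable_powr_symmetric[of "- (1/2)" pi] by (simp add: powr_half_sqrt)
  have i: "integrable lborel ?\<kappa>" using pw by (auto simp: has_bochner_integral_iff)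
  note ind = has_bochner_integral_strip_indicator[of \<delta> B]
  have "\<bar>conv dk V p\<bar> \<le> (LINT u|lborel. ?\<kappa> u) * (LINT v|lborel. B * indicator {-2*\<delta>..2*\<delta>} (snd p - v))"
  proof (rule conv_bound[OF i integrable_reflect_real(1)])
    show "integrable lborel (\<lambda>y. B * indicator {-2*\<delta>..2*\<delta>} y :: real)" using ind \<delta> by (simp add: has_bochner_integral_iff)
    show "AE q in lborel. fst q \<in> {-pi..<pi} \<longrightarrow> \<bar>dk q * V (p - q)\<bar> \<le> ?\<kappa> (fst q) * (B * indicator {-2*\<delta>..2*\<delta>} (snd p - snd q))"
      using AE_fst_neq[of 0]
    proof eventually_elim
      case (elim q)
      show ?case
      proof
        assume q: "fst q \<in> {-pi..<pi}"
        show "\<bar>dk q * V (p - q)\<bar> \<le> ?\<kappa> (fst q) * (B * indicator {-2*\<delta>..2*\<delta>} (snd p - snd q))"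
        proof (cases "snd p - snd q \<in> {-2*\<delta>..2*\<delta>}")
          case False
          then show ?thesis using V[of "p - q"] by simp
        next
          case True
          then have v: "\<bar>snd q\<bar> \<le> 4 * \<delta>" using p by (auto simp: abs_le_iff)
          have A: "\<bar>snd q\<bar> powr (1/2) \<le> 2 * sqrt \<delta>"
          proof -
            have "\<bar>snd q\<bar> powr (1/2) \<le> (4 * \<delta>) powr (1/2)" using v by (intro powr_mono2) auto
            also have "(4 * \<delta>) powr (1/2) = 2 * sqrt \<delta>" using \<delta> by (simp add: powr_half_sqrt real_sqrt_mult)
            finally show ?thesis .
          qed
          have "\<bar>dk q\<bar> \<le> 8 * (\<bar>snd q\<bar> powr (1/2) * \<bar>fst q\<bar> powr (- (1/2)))"
            unfolding dk_def KL_def by (rule kernel_diff_le) (use q elim v \<delta> in \<open>auto simp: abs_le_iff\<close>)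
          also have "\<dots> \<le> 8 * (2 * sqrt \<delta> * \<bar>fst q\<bar> powr (- (1/2)))"
            by (intro mult_left_mono mult_right_mono A) auto
          finally have "\<bar>dk q\<bar> \<le> ?\<kappa> (fst q)" using q by simp
          then have "\<bar>dk q\<bar> * \<bar>V (p - q)\<bar> \<le> ?\<kappa> (fst q) * (B * indicator {-2*\<delta>..2*\<delta>} (snd (p - q)))"
            using \<delta> by (intro mult_mono V) auto
          then show ?thesis by (simp add: abs_mult)
        qed
      qed
    qed
  qed (use \<delta> B in auto)
  also have "(LINT v|lborel. B * indicator {-2*\<delta>..2*\<delta>} (snd p - v)) = 4 * \<delta> * B"
    using integrable_reflect_real(2)[of "\<lambda>y. B * indicator {-2*\<delta>..2*\<delta>} y :: real" "snd p"] ind \<delta>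
    by (simp add: has_bochner_integral_iff)
  also have "(LINT u|lborel. ?\<kappa> u) = 16 * sqrt \<delta> * (4 * sqrt pi)" using pw by (simp add: has_bochner_integral_iff)
  also have "16 * sqrt \<delta> * (4 * sqrt pi) * (4 * \<delta> * B) \<le> 16 * sqrt \<delta> * (4 * 2) * (4 * \<delta> * B)"
  proof -
    have "sqrt pi \<le> 2" using pi_less_4 by (intro real_le_lsqrt) auto
    then show ?thesis using \<delta> B by (intro mult_right_mono mult_left_mono) auto
  qed
  finally show ?thesis by (simp add: algebra_simps)
qed

definition cosk :: "real \<times> real \<Rightarrow> real" where "cosk q = cos (fst q)"
definition sink :: "real \<times> real \<Rightarrow> real" where "sink q = sin (fst q)"

lemma lker_cosk: "lker cosk"
  unfolding cosk_def by (rule lker_fst[of cos]) (auto intro!: integrable_on_window_continuous continuous_intros)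
lemma lker_sink: "lker sink"
  unfolding sink_def by (rule lker_fst[of sin]) (auto intro!: integrable_on_window_continuous continuous_intros)
lemma lker_one: "lker (\<lambda>_. 1)"
  by (rule lker_fst[of "\<lambda>_. 1"]) (auto intro!: integrable_on_window_continuous continuous_intros)

lemma measurable_cosk [measurable]: "cosk \<in> borel_measurable borel" unfolding cosk_def by measurable

lemma good_conv_diff:
  assumes "lker k" "good r w1" "good r w2"
  shows "conv k (\<lambda>q. w1 q - w2 q) p = conv k w1 p - conv k w2 p"
proof -
  obtain B1 where "\<And>p. \<bar>w1 p\<bar> \<le> B1" using bounded_of_per_strip assms(2) unfolding good_def by blast
  moreover obtain B2 where "\<And>p. \<bar>w2 p\<bar> \<le> B2" using bounded_of_per_strip assms(3) unfolding good_def by blast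
  ultimately show ?thesis using conv_diff assms good_measurable unfolding good_def by blast
qed

lemma good_conv_diff_kernel:
  assumes "lker k1" "lker k2" "good r w"
  shows "conv (\<lambda>q. k1 q - k2 q) w p = conv k1 w p - conv k2 w p"
proof -
  obtain B1 where "\<And>p. \<bar>w p\<bar> \<le> B1" using bounded_of_per_strip assms(3) unfolding good_def by blast
  then show ?thesis using conv_diff_kernel assms good_measurable unfolding good_def by blast
qed

lemma good_diff: "good r w1 \<Longrightarrow> good r w2 \<Longrightarrow> good r (\<lambda>q. w1 q - w2 q)"
  unfolding good_def per_def strip_def by (auto intro!: continuous_intros)

lemma conv_symmetric:
  assumes "\<And>q. k (- q) = k q" "\<And>p. w (- p) = w p" and k: "lker k" and w: "good r w"
  shows "conv k w (- p) = conv k w p"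
proof -
  have [measurable]: "k \<in> borel_measurable borel" using k by (simp add: lker_def)
  have [measurable]: "w \<in> borel_measurable borel" using w by (rule good_measurable)
  have "has_bochner_integral lborel (\<lambda>q. indicator {-pi..<pi} (fst q) * (k q * w (- p - q))) (conv k w (- p))"
    using good_conv_integrable[OF k w, of "- p"] by (simp add: conv_def has_bochner_integral_iff)
  from has_bochner_integral_lborel_reflect[OF this, of 0]
  have "has_bochner_integral lborel (\<lambda>q. indicator {-pi..<pi} (- fst q) * (k (- q) * w (- (p - q)))) (conv k w (- p))"
    by simp
  then have "has_bochner_integral lborel (\<lambda>q. indicator {-pi..<pi} (- fst q) * (k q * w (p - q))) (conv k w (- p))"
    by (simp only: assms(1,2))
  then have "has_bochner_integral lborel (\<lambda>q. indicator {-pi..<pi} (fst q) * (k q * w (p - q))) (conv k w (- p))"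
  proof (rule has_bochner_integral_cong_AE_real)
    show "AE q in lborel. indicator {-pi..<pi} (- fst q) * (k q * w (p - q)) = indicator {-pi..<pi} (fst q) * (k q * w (p - q))"
      using AE_fst_neq[of "-pi"] AE_fst_neq[of pi] by eventually_elim (auto simp: indicator_def)
  qed measurable
  then show ?thesis by (simp add: conv_def has_bochner_integral_iff)
qed

text \<open>By the addition formula only the first cosine and sine coefficients occur, and point
  symmetry makes the sine coefficient equal to its own negative.\<close>

lemma conv_cosk_eq:
  assumes w: "good r w" and sym: "\<And>p. w (- p) = w p"
  shows "conv cosk w p = cos (fst p) * conv cosk w 0"
proof -
  have s0: "conv sink w 0 = 0"
  proof -
    have [measurable]: "w \<in> borel_measurable borel" using w by (rule good_measurable)
    have [measurable]: "sink \<in> borel_measurable borel" unfolding sink_def by measurable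
    have "has_bochner_integral lborel (\<lambda>q. indicator {-pi..<pi} (fst q) * (sink q * w (0 - q))) (conv sink w 0)"
      using good_conv_integrable[OF lker_sink w, of 0] by (simp add: conv_def has_bochner_integral_iff)
    from has_bochner_integral_lborel_reflect[OF this, of 0]
    have "has_bochner_integral lborel (\<lambda>q. indicator {-pi..<pi} (- fst q) * (sink (- q) * w (- (- q)))) (conv sink w 0)"
      by simp
    then have "has_bochner_integral lborel (\<lambda>q. - (indicator {-pi..<pi} (fst q) * (sink q * w (0 - q)))) (conv sink w 0)"
    proof (rule has_bochner_integral_cong_AE_real)
      show "AE q in lborel. indicator {-pi..<pi} (- fst q) * (sink (- q) * w (- (- q))) = - (indicator {-pi..<pi} (fst q) * (sink q * w (0 - q)))"
        using AE_fst_neq[of "-pi"] AE_fst_neq[of pi] by eventually_elim (auto simp: indicator_def sink_def sym)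
    qed measurable
    then have "conv sink w 0 = - conv sink w 0" by (simp add: conv_def has_bochner_integral_iff)
    then show ?thesis by simp
  qed
  have "has_bochner_integral lborel (\<lambda>q. cos (fst p) * (indicator {-pi..<-pi+2*pi} (fst q) * (cosk (0 - q) * w q))
        - sin (fst p) * (indicator {-pi..<-pi+2*pi} (fst q) * (sink (0 - q) * w q))) (cos (fst p) * conv cosk w 0 - sin (fst p) * conv sink w 0)"
    by (intro has_bochner_integral_diff has_bochner_integral_mult_right good_conv_window[OF lker_cosk w] good_conv_window[OF lker_sink w])
  moreover have "cos (fst p) * (indicator {-pi..<-pi+2*pi} (fst q) * (cosk (0 - q) * w q))
        - sin (fst p) * (indicator {-pi..<-pi+2*pi} (fst q) * (sink (0 - q) * w q))
      = indicator {-pi..<-pi+2*pi} (fst q) * (cosk (p - q) * w q)" for q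
    by (simp add: cosk_def sink_def cos_diff algebra_simps)
  ultimately have "has_bochner_integral lborel (\<lambda>q. indicator {-pi..<-pi+2*pi} (fst q) * (cosk (p - q) * w q)) (cos (fst p) * conv cosk w 0)"
    by (simp add: s0)
  from has_bochner_integral_eq[OF this good_conv_window[OF lker_cosk w]] show ?thesis by simp
qed

lemma conv_one_eq: assumes w: "good r w" shows "conv (\<lambda>_. 1) w p = conv (\<lambda>_. 1) w 0"
  using has_bochner_integral_eq[OF good_conv_window[OF lker_one w, of 0 p] good_conv_window[OF lker_one w, of 0 0]] .

abbreviation "W0 \<delta> \<equiv> profile \<delta> (\<lambda>_. 0)"

lemma admissible_sym: "admissible \<phi> \<Longrightarrow> \<phi> (- p) = \<phi> p" unfolding admissible_def by blast

lemma admissible_0: "admissible (\<lambda>_. 0)" by (simp add: admissible_def per_def)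

lemma integrable_bump_profile: assumes "0 < \<delta>" shows "integrable lborel (\<lambda>y. bump (1 - y\<^sup>2 / (2 * \<delta>\<^sup>2)))"
proof -
  have "integrable lborel (\<lambda>y. indicator {-2*\<delta>..2*\<delta>} y * bump (1 - y\<^sup>2 / (2 * \<delta>\<^sup>2)))"
    by (rule integrable_on_window_continuous) (use assms in \<open>auto intro!: continuous_intros\<close>)
  moreover have "(\<lambda>y. indicator {-2*\<delta>..2*\<delta>} y * bump (1 - y\<^sup>2 / (2 * \<delta>\<^sup>2))) = (\<lambda>y. bump (1 - y\<^sup>2 / (2 * \<delta>\<^sup>2)))"
  proof
    fix y
    show "indicator {-2*\<delta>..2*\<delta>} y * bump (1 - y\<^sup>2 / (2 * \<delta>\<^sup>2)) = bump (1 - y\<^sup>2 / (2 * \<delta>\<^sup>2))"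
    proof (cases "\<bar>y\<bar> \<le> 2 * \<delta>")
      case False
      then have "2 < y\<^sup>2 / (2 * \<delta>\<^sup>2)" using quotient_gt_2[OF assms] by simp
      then have "bump (1 - y\<^sup>2 / (2 * \<delta>\<^sup>2)) = 0" by (intro expinv_nonpos) linarith
      then show ?thesis by simp
    qed (auto simp: abs_le_iff)
  qed
  ultimately show ?thesis by simp
qed

lemma window_half_open:
  fixes f :: "real \<Rightarrow> real"
  assumes "has_bochner_integral lborel (\<lambda>u. indicator {-pi..pi} u * f u) i" and [measurable]: "f \<in> borel_measurable borel"
  shows "has_bochner_integral lborel (\<lambda>u. indicator {-pi..<pi} u * f u) i"
  by (rule has_bochner_integral_cong_AE_real[OF assms(1)])
     (measurable, use AE_lborel_singleton[of pi] in \<open>eventually_elim, auto simp: indicator_def\<close>)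

lemma conv_fst_snd:
  assumes "integrable lborel (\<lambda>u. indicator {-pi..<pi} u * f u * g (fst p - u))" "integrable lborel h"
  shows "conv (\<lambda>q. f (fst q)) (\<lambda>q. g (fst q) * h (snd q)) p
     = (LINT u|lborel. indicator {-pi..<pi} u * f u * g (fst p - u)) * (LINT v|lborel. h v)"
  using integrable_lborel_Times(2)[OF assms(1) integrable_reflect_real(1)[OF assms(2), of "snd p"]]
  unfolding conv_def integrable_reflect_real(2)[OF assms(2)] by (simp add: mult.assoc)

lemma conv_ellk_W0: assumes "0 < \<delta>"
  shows "conv ellk (W0 \<delta>) p = (LINT u|lborel. indicator {-pi..<pi} u * ell u * 1) * (LINT y|lborel. bump (1 - y\<^sup>2 / (2 * \<delta>\<^sup>2)))"
proof -
  have "integrable lborel (\<lambda>u. indicator {-pi..<pi} u * ell u * 1)"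
    using window_half_open[of ell "LINT u|lborel. indicator {-pi..pi} u * ell u"] integrable_ell
    by (simp add: has_bochner_integral_iff)
  from conv_fst_snd[where f = ell and g = "\<lambda>_. 1" and p = p, OF this integrable_bump_profile[OF assms]]
  show ?thesis by (simp add: profile_def[abs_def] ellk_def[abs_def])
qed

text \<open>\<open>W0\<close> depends on y alone and \<open>ellk\<close> on x alone, so their
  convolution is constant. Subtracting \<open>W0\<close> thus changes only the additive constant and
  makes the \<open>ellk\<close> term first order in \<phi>.\<close>

definition nonresonant :: "real \<Rightarrow> (real \<times> real \<Rightarrow> real) \<Rightarrow> real \<times> real \<Rightarrow> real" where
  "nonresonant \<delta> \<phi> p = (conv ellk (\<lambda>q. profile \<delta> \<phi> q - W0 \<delta> q) p - conv dk (profile \<delta> \<phi>) p) / \<delta>"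

definition resonant :: "real \<Rightarrow> (real \<times> real \<Rightarrow> real) \<Rightarrow> real" where
  "resonant \<delta> \<phi> = 2 / \<delta> * conv cosk (\<lambda>q. profile \<delta> \<phi> q - W0 \<delta> q) 0"

lemma has_bochner_integral_cos_window: "has_bochner_integral lborel (\<lambda>u. indicator {-pi..<pi} u * cos u) 0"
proof (rule window_half_open)
  have "has_bochner_integral lborel (\<lambda>u. indicator {-pi..pi} u *\<^sub>R cos u) (sin pi - sin (-pi))"
    by (rule has_bochner_integral_FTC_Icc) (auto intro!: continuous_intros derivative_eq_intros simp: has_real_derivative_iff_has_vector_derivative[symmetric])
  then show "has_bochner_integral lborel (\<lambda>u. indicator {-pi..pi} u * cos u) 0" by simp
qed simp

lemma has_bochner_integral_cos2_window: "has_bochner_integral lborel (\<lambda>u. indicator {-pi..<pi} u * (cos u * cos u)) pi"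
proof (rule window_half_open)
  have "has_bochner_integral lborel (\<lambda>u. indicator {-pi..pi} u *\<^sub>R (cos u * cos u)) ((pi + sin pi * cos pi) / 2 - (-pi + sin (-pi) * cos (-pi)) / 2)"
  proof (rule has_bochner_integral_FTC_Icc)
    fix u :: real
    have "sin u * sin u = 1 - cos u * cos u" using sin_squared_eq[of u] by (simp add: power2_eq_square)
    then have "sin u * (sin u * 2) = 2 - cos u * (cos u * 2)" by linarith
    then have "((\<lambda>u. (u + sin u * cos u) / 2) has_real_derivative cos u * cos u) (at u within {-pi..pi})"
      by (auto intro!: derivative_eq_intros simp: field_simps)
    then show "((\<lambda>u. (u + sin u * cos u) / 2) has_vector_derivative cos u * cos u) (at u within {-pi..pi})"
      by (simp add: has_real_derivative_iff_has_vector_derivative)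
  qed (auto intro!: continuous_intros)
  then show "has_bochner_integral lborel (\<lambda>u. indicator {-pi..pi} u * (cos u * cos u)) pi" by simp
qed simp

lemma conv_cosk_W0: assumes "0 < \<delta>" shows "conv cosk (W0 \<delta>) 0 = 0"
proof -
  have "integrable lborel (\<lambda>u. indicator {-pi..<pi} u * cos u * 1)"
    using has_bochner_integral_cos_window by (simp add: has_bochner_integral_iff)
  from conv_fst_snd[where f = cos and g = "\<lambda>_. 1" and p = 0, OF this integrable_bump_profile[OF assms]]
  show ?thesis using has_bochner_integral_cos_window by (simp add: profile_def[abs_def] cosk_def[abs_def] has_bochner_integral_iff)
qed

text \<open>Up to an additive constant, minus the logarithmic kernel is \<open>ell(u) + 2 cos u - dk\<close>;
  the three parts are the contraction, the resonant mode and the error of the thin-layer limit.\<close>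

lemma conv_KL_decomposition:
  assumes \<delta>: "0 < \<delta>" and \<phi>: "admissible \<phi>"
  obtains c where "\<And>p. - conv KL (profile \<delta> \<phi>) p / \<delta> = nonresonant \<delta> \<phi> p + resonant \<delta> \<phi> * cos (fst p) + c"
proof -
  let ?W = "profile \<delta> \<phi>"
  let ?K0 = "\<lambda>q::real\<times>real. ln (1 - cos (fst q))"
  note W = profile_good[OF \<delta> \<phi>] and W00 = profile_good[OF \<delta> admissible_0]
  have sym: "?W (- p) = ?W p" for p using admissible_sym[OF \<phi>] by (simp add: profile_def)
  have 1: "conv dk ?W p = conv KL ?W p - conv ?K0 ?W p" for p
    unfolding dk_def by (rule good_conv_diff_kernel[OF lker_KL lker_ln_one_minus_cos W])
  \<comment> \<open>Pointwise identity ln(1 - cos u) = 1/2 - ln 2 - 2 cos u - ell u, valid off the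
    null set cos u = 1.\<close>
  have 2: "conv ?K0 ?W p = (1/2 - ln 2) * conv (\<lambda>_. 1) ?W p - 2 * conv cosk ?W p - conv ellk ?W p" for p
  proof -
    have [measurable]: "?W \<in> borel_measurable borel" using W by (rule good_measurable)
    have "has_bochner_integral lborel (\<lambda>q. (1/2 - ln 2) * (indicator {-pi..<pi} (fst q) * (1 * ?W (p - q)))
        - 2 * (indicator {-pi..<pi} (fst q) * (cosk q * ?W (p - q))) - indicator {-pi..<pi} (fst q) * (ellk q * ?W (p - q)))
        ((1/2 - ln 2) * conv (\<lambda>_. 1) ?W p - 2 * conv cosk ?W p - conv ellk ?W p)"
      using good_conv_integrable[OF lker_one W, of p] good_conv_integrable[OF lker_cosk W, of p] good_conv_integrable[OF lker_ellk W, of p]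
      by (intro has_bochner_integral_diff has_bochner_integral_mult_right) (auto simp: conv_def has_bochner_integral_iff)
    then have "has_bochner_integral lborel (\<lambda>q. indicator {-pi..<pi} (fst q) * (?K0 q * ?W (p - q)))
        ((1/2 - ln 2) * conv (\<lambda>_. 1) ?W p - 2 * conv cosk ?W p - conv ellk ?W p)"
    proof (rule has_bochner_integral_cong_AE_real)
      have "AE q in (lborel :: (real \<times> real) measure). cos (0 - fst q) \<noteq> 1" using AE_nonsingular[of 0 0] by auto
      then show "AE q in lborel. (1/2 - ln 2) * (indicator {-pi..<pi} (fst q) * (1 * ?W (p - q)))
        - 2 * (indicator {-pi..<pi} (fst q) * (cosk q * ?W (p - q))) - indicator {-pi..<pi} (fst q) * (ellk q * ?W (p - q))
        = indicator {-pi..<pi} (fst q) * (?K0 q * ?W (p - q))"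
      proof eventually_elim
        case (elim q)
        then have "cos (fst q) \<noteq> 1" by simp
        then have "0 < 1 - cos (fst q)" using cos_le_one[of "fst q"] by linarith
        then have "ln (2 - 2 * cos (fst q)) = ln 2 + ?K0 q" using ln_mult[of 2 "1 - cos (fst q)"] by (simp add: algebra_simps)
        then show ?case by (simp add: ellk_def ell_def cosk_def algebra_simps)
      qed
    qed measurable
    then show ?thesis by (simp add: conv_def has_bochner_integral_iff)
  qed
  have 3: "conv ellk (\<lambda>q. ?W q - W0 \<delta> q) p = conv ellk ?W p - conv ellk (W0 \<delta>) p" for p
    by (rule good_conv_diff[OF lker_ellk W W00])
  have 4: "conv cosk (\<lambda>q. ?W q - W0 \<delta> q) 0 = conv cosk ?W 0"
    using good_conv_diff[OF lker_cosk W W00, of 0] conv_cosk_W0[OF \<delta>] by simp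
  define E0 where "E0 = conv ellk (W0 \<delta>) 0"
  have 5: "conv ellk (W0 \<delta>) p = E0" for p unfolding E0_def conv_ellk_W0[OF \<delta>] by simp
  show thesis
  proof (rule that)
    fix p
    have "- conv KL ?W p = conv ellk (\<lambda>q. ?W q - W0 \<delta> q) p - conv dk ?W p + 2 * (cos (fst p) * conv cosk (\<lambda>q. ?W q - W0 \<delta> q) 0)
        + (E0 - (1/2 - ln 2) * conv (\<lambda>_. 1) ?W 0)"
      using 1[of p] 2[of p] 3[of p] 4 5[of p] conv_cosk_eq[OF W sym, of p] conv_one_eq[OF W, of p] by simp
    then have "- conv KL ?W p / \<delta> = (conv ellk (\<lambda>q. ?W q - W0 \<delta> q) p - conv dk ?W p + 2 * (cos (fst p) * conv cosk (\<lambda>q. ?W q - W0 \<delta> q) 0)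
        + (E0 - (1/2 - ln 2) * conv (\<lambda>_. 1) ?W 0)) / \<delta>" by simp
    also have "\<dots> = nonresonant \<delta> \<phi> p + resonant \<delta> \<phi> * cos (fst p) + (E0 - (1/2 - ln 2) * conv (\<lambda>_. 1) ?W 0) / \<delta>"
      by (simp add: nonresonant_def resonant_def add_divide_distrib diff_divide_distrib algebra_simps)
    finally show "- conv KL ?W p / \<delta> = nonresonant \<delta> \<phi> p + resonant \<delta> \<phi> * cos (fst p) + (E0 - (1/2 - ln 2) * conv (\<lambda>_. 1) ?W 0) / \<delta>" .
  qed
qed

lemma conv_cosk_bound:
  assumes g: "integrable lborel g" "\<And>y. 0 \<le> g y" and V: "\<And>p. \<bar>V p\<bar> \<le> g (snd p)"
  shows "\<bar>conv cosk V p\<bar> \<le> 2 * pi * (LINT y|lborel. g y)"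
proof -
  have i: "integrable lborel (\<lambda>u. indicator {-pi..pi} u * (1::real))"
    by (intro integrable_on_window_continuous continuous_intros)
  have "\<bar>conv cosk V p\<bar> \<le> (LINT u|lborel. indicator {-pi..pi} u * (1::real)) * (LINT v|lborel. g (snd p - v))"
  proof (rule conv_bound[OF i integrable_reflect_real(1)[OF g(1)]])
    show "AE q in lborel. fst q \<in> {-pi..<pi} \<longrightarrow> \<bar>cosk q * V (p - q)\<bar> \<le> indicator {-pi..pi} (fst q) * 1 * g (snd p - snd q)"
    proof (intro AE_I2 impI)
      fix q :: "real \<times> real" assume q: "fst q \<in> {-pi..<pi}"
      have "\<bar>cos (fst q)\<bar> * \<bar>V (p - q)\<bar> \<le> 1 * g (snd (p - q))" by (intro mult_mono V) auto
      then show "\<bar>cosk q * V (p - q)\<bar> \<le> indicator {-pi..pi} (fst q) * 1 * g (snd p - snd q)"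
        using q by (simp add: cosk_def abs_mult)
    qed
  qed (use g in auto)
  then show ?thesis by (simp add: integrable_reflect_real[OF g(1)])
qed

lemma has_bochner_integral_profile:
  assumes "0 < \<delta>"
  shows "has_bochner_integral lborel (\<lambda>y. profile_deriv \<delta> y * A + B * indicator {-2*\<delta>..2*\<delta>} y) (\<delta> * (bump_mass * A + 4 * B))"
proof -
  have "has_bochner_integral lborel (\<lambda>y. profile_deriv \<delta> y * A) (\<delta> * bump_mass * A)"
    using profile_deriv_integrable[OF assms] profile_deriv_integral[OF assms] by (simp add: has_bochner_integral_iff)
  from has_bochner_integral_add[OF this has_bochner_integral_strip_indicator[of \<delta> B]] assms
  show ?thesis by (simp add: algebra_simps)
qed

lemma conv_profile_bound:
  assumes "0 < \<delta>" "0 \<le> A" "0 \<le> B"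
    and V: "\<And>p. \<bar>V p\<bar> \<le> profile_deriv \<delta> (snd p) * A + B * indicator {-2*\<delta>..2*\<delta>} (snd p)"
  shows "\<bar>conv ellk V p\<bar> \<le> \<delta> * (9/5 * pi * (bump_mass * A + 4 * B))"
    and "\<bar>conv cosk V p\<bar> \<le> \<delta> * (2 * pi * (bump_mass * A + 4 * B))"
proof -
  note h = has_bochner_integral_profile[OF assms(1), of A B]
  have i: "integrable lborel (\<lambda>y. profile_deriv \<delta> y * A + B * indicator {-2*\<delta>..2*\<delta>} y)" using h by (simp add: has_bochner_integral_iff)
  have nn: "0 \<le> profile_deriv \<delta> y * A + B * indicator {-2*\<delta>..2*\<delta>} y" for y using assms profile_deriv_nonneg by simp
  show "\<bar>conv ellk V p\<bar> \<le> \<delta> * (9/5 * pi * (bump_mass * A + 4 * B))"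
    using conv_ellk_bound[OF i nn V, of p] h by (simp add: has_bochner_integral_iff algebra_simps)
  show "\<bar>conv cosk V p\<bar> \<le> \<delta> * (2 * pi * (bump_mass * A + 4 * B))"
    using conv_cosk_bound[OF i nn V, of p] h by (simp add: has_bochner_integral_iff algebra_simps)
qed

lemma bump_lipschitz:
  assumes "\<And>t. \<bar>bump' t\<bar> \<le> C1" shows "\<bar>bump s - bump t\<bar> \<le> C1 * \<bar>s - t\<bar>"
proof -
  have "norm (bump s - bump t) \<le> C1 * norm (s - t)"
    by (rule field_differentiable_bound[of UNIV bump]) (auto intro: has_field_derivative_at_within DERIV_expinv assms)
  then show ?thesis by simp
qed

text \<open>The contraction estimate. The leading constant is 9/5 \<pi> times
  \<open>bump_mass\<close>; C r measures the nonlinearity of the bump and sqrt \<delta> the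
  thickness of the layer.\<close>

lemma nonresonant_lipschitz:
  assumes lip: "\<And>s t. \<bar>bump' s - bump' t\<bar> \<le> C * \<bar>s - t\<bar>" and C: "0 \<le> C" and C1: "\<And>t. \<bar>bump' t\<bar> \<le> C1"
    and \<delta>: "0 < \<delta>" "\<delta> \<le> 1/4" and a: "admissible \<phi>1" "admissible \<phi>2"
    and r: "\<And>p. \<bar>\<phi>1 p\<bar> \<le> r" "\<And>p. \<bar>\<phi>2 p\<bar> \<le> r" "r \<le> 1/2" and d: "\<And>p. \<bar>\<phi>1 p - \<phi>2 p\<bar> \<le> d"
    and p: "\<bar>snd p\<bar> \<le> 2 * \<delta>"
  shows "\<bar>nonresonant \<delta> \<phi>1 p - nonresonant \<delta> \<phi>2 p\<bar> \<le> (9/5 * pi * (bump_mass + 4 * (C * r)) + 512 * sqrt \<delta> * C1) * d"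
proof -
  note W1 = profile_good[OF \<delta>(1) a(1)] and W2 = profile_good[OF \<delta>(1) a(2)] and W00 = profile_good[OF \<delta>(1) admissible_0]
  let ?V = "\<lambda>q. profile \<delta> \<phi>1 q - profile \<delta> \<phi>2 q"
  have d0: "0 \<le> d" using d[of 0] by linarith
  have r0: "0 \<le> r" using r(1)[of 0] by linarith
  have C10: "0 \<le> C1" using C1[of 0] by linarith
  have V1: "\<bar>?V q\<bar> \<le> profile_deriv \<delta> (snd q) * d + (C * r * d) * indicator {-2*\<delta>..2*\<delta>} (snd q)" for q
    using profile_lipschitz[where p = q and ?\<phi>1.0 = \<phi>1 and ?\<phi>2.0 = \<phi>2, OF lip C \<delta>(1) r(1) r(2) r(3) d]
    by (simp add: algebra_simps)
  \<comment> \<open>Two majorants for one difference: the sharp one above is kept for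
    \<open>ellk\<close>, where the constant matters; this crude one suffices for \<open>dk\<close>,
    which is small by itself.\<close>
  have V2: "\<bar>?V q\<bar> \<le> (C1 * d) * indicator {-2*\<delta>..2*\<delta>} (snd q)" for q
  proof (cases "\<bar>snd q\<bar> \<le> 2 * \<delta>")
    case True
    have "\<bar>?V q\<bar> \<le> C1 * \<bar>\<phi>1 q - \<phi>2 q\<bar>" 
      using bump_lipschitz[OF C1, of "1 - (snd q)\<^sup>2 / (2 * \<delta>\<^sup>2) + \<phi>1 q" "1 - (snd q)\<^sup>2 / (2 * \<delta>\<^sup>2) + \<phi>2 q"] by (simp add: profile_def)
    also have "\<dots> \<le> C1 * d" by (intro mult_left_mono d C10)
    finally show ?thesis using True by (auto simp: indicator_def abs_le_iff)
  next
    case False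
    then have "?V q = 0" using W1 W2 by (auto simp: good_def strip_def simp del: split_paired_All)
    then show ?thesis using C10 d0 by simp
  qed
  have e1: "\<bar>conv ellk ?V p\<bar> \<le> \<delta> * (9/5 * pi * (bump_mass * d + 4 * (C * r * d)))"
    using C r0 d0 by (intro conv_profile_bound(1)[OF \<delta>(1) _ _ V1]) auto
  have e2: "\<bar>conv dk ?V p\<bar> \<le> 512 * sqrt \<delta> * \<delta> * (C1 * d)"
    using C10 d0 by (intro conv_dk_bound[OF \<delta> _ V2 p]) auto
  have "conv ellk (\<lambda>q. profile \<delta> \<phi>1 q - W0 \<delta> q) p - conv ellk (\<lambda>q. profile \<delta> \<phi>2 q - W0 \<delta> q) p = conv ellk ?V p"
    using good_conv_diff[OF lker_ellk W1 W00, of p] good_conv_diff[OF lker_ellk W2 W00, of p] good_conv_diff[OF lker_ellk W1 W2, of p] by simp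
  moreover have "conv dk (profile \<delta> \<phi>1) p - conv dk (profile \<delta> \<phi>2) p = conv dk ?V p"
    using good_conv_diff[OF lker_dk W1 W2, of p] by simp
  ultimately have "nonresonant \<delta> \<phi>1 p - nonresonant \<delta> \<phi>2 p = (conv ellk ?V p - conv dk ?V p) / \<delta>"
    unfolding nonresonant_def by (simp add: diff_divide_distrib[symmetric])
  also have "\<bar>\<dots>\<bar> \<le> (\<delta> * (9/5 * pi * (bump_mass * d + 4 * (C * r * d))) + 512 * sqrt \<delta> * \<delta> * (C1 * d)) / \<delta>"
    unfolding abs_divide using \<delta>(1) e1 e2 by (intro divide_mono order_trans[OF abs_triangle_ineq4]) auto
  also have "\<dots> = (9/5 * pi * (bump_mass + 4 * (C * r)) + 512 * sqrt \<delta> * C1) * d"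
    using \<delta>(1) by (simp add: add_divide_distrib) (simp add: algebra_simps)
  finally show ?thesis .
qed

lemma admissible_cos: "0 \<le> a \<Longrightarrow> a \<le> 1/2 \<Longrightarrow> admissible (\<lambda>p. a * cos (fst p))"
  unfolding admissible_def per_def
proof (intro conjI allI)
  fix p :: "real \<times> real" assume a: "0 \<le> a" "a \<le> 1/2"
  have "\<bar>a * cos (fst p)\<bar> \<le> a * 1" unfolding abs_mult using a by (intro mult_mono) auto
  with a show "\<bar>a * cos (fst p)\<bar> \<le> 1/2" by simp
qed (auto intro!: continuous_intros)

lemma abs_a_cos_le: "0 \<le> a \<Longrightarrow> \<bar>a * cos x\<bar> \<le> a" for a x :: real
proof -
  assume "0 \<le> a"
  then have "\<bar>a\<bar> * \<bar>cos x\<bar> \<le> a * 1" by (intro mult_mono) auto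
  then show ?thesis by (simp add: abs_mult)
qed

text \<open>First variation of the profile at \<phi> = 0 in the direction a cos x.\<close>

definition linear_part :: "real \<Rightarrow> real \<Rightarrow> real \<times> real \<Rightarrow> real" where
  "linear_part \<delta> a q = a * cos (fst q) * profile_deriv \<delta> (snd q)"

lemma good_linear_part: assumes "0 < \<delta>" shows "good (2 * \<delta>) (linear_part \<delta> a)"
proof -
  have "continuous_on UNIV (\<lambda>q::real\<times>real. profile_deriv \<delta> (snd q))"
    by (intro continuous_on_compose2[OF profile_deriv_continuous[OF assms, of UNIV]] continuous_intros) auto
  then show ?thesis unfolding good_def linear_part_def per_def strip_def
    using profile_deriv_zero[OF assms] by (auto intro!: continuous_intros)
qed

text \<open>\<open>ell\<close> is orthogonal to cos by construction and to sin by evenness, so it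
  annihilates the first mode. Consequently \<open>nonresonant\<close> at a cos x is quadratic in a,
  up to the thin-layer error.\<close>

lemma conv_ellk_linear_part: assumes "0 < \<delta>" shows "conv ellk (linear_part \<delta> a) p = 0"
proof -
  have c: "has_bochner_integral lborel (\<lambda>u. indicator {-pi..<pi} u * (ell u * cos u)) 0"
    by (rule window_half_open[OF has_bochner_integral_ell_cos]) simp
  have s: "has_bochner_integral lborel (\<lambda>u. indicator {-pi..<pi} u * (ell u * sin u)) 0"
  proof (rule window_half_open)
    have i: "integrable lborel (\<lambda>u. indicator {-pi..pi} u * (ell u * sin u))"
    proof (rule integrable_bound_interval)
      show "integrable lborel (\<lambda>u. \<bar>indicator {-pi..pi} u * ell u\<bar>)" using integrable_ell by simp
      show "AE u in lborel. u \<in> {-pi..pi} \<longrightarrow> \<bar>ell u * sin u\<bar> \<le> \<bar>indicator {-pi..pi} u * ell u\<bar>"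
      proof (intro AE_I2 impI)
        fix u :: real assume "u \<in> {-pi..pi}"
        moreover have "\<bar>ell u\<bar> * \<bar>sin u\<bar> \<le> \<bar>ell u\<bar> * 1" by (intro mult_left_mono) auto
        ultimately show "\<bar>ell u * sin u\<bar> \<le> \<bar>indicator {-pi..pi} u * ell u\<bar>" by (auto simp: abs_mult)
      qed
    qed auto
    then have j: "has_bochner_integral lborel (\<lambda>u. indicator {-pi..pi} u * (ell u * sin u)) (LINT u|lborel. indicator {-pi..pi} u * (ell u * sin u))"
      by (simp add: has_bochner_integral_iff)
    from has_bochner_integral_lborel_reflect[OF this, of 0]
    have "has_bochner_integral lborel (\<lambda>u. - (indicator {-pi..pi} u * (ell u * sin u))) (LINT u|lborel. indicator {-pi..pi} u * (ell u * sin u))"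
    proof -
      assume *: "has_bochner_integral lborel (\<lambda>q. indicat_real {- pi..pi} (0 - q) * (ell (0 - q) * sin (0 - q)))
         (LBINT u. indicat_real {- pi..pi} u * (ell u * sin u))"
      have "indicat_real {- pi..pi} (0 - q) * (ell (0 - q) * sin (0 - q)) = - (indicator {-pi..pi} q * (ell q * sin q))" for q
        by (auto simp: indicator_def ell_def)
      with * show ?thesis by (simp only:)
    qed
    then have "(LINT u|lborel. indicator {-pi..pi} u * (ell u * sin u)) = 0" by (simp add: has_bochner_integral_iff)
    with j show "has_bochner_integral lborel (\<lambda>u. indicator {-pi..pi} u * (ell u * sin u)) 0" by simp
  qed simp
  have "has_bochner_integral lborel (\<lambda>u. (a * cos (fst p)) * (indicator {-pi..<pi} u * (ell u * cos u))
      + (a * sin (fst p)) * (indicator {-pi..<pi} u * (ell u * sin u))) ((a * cos (fst p)) * 0 + (a * sin (fst p)) * 0)"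
    by (intro has_bochner_integral_add has_bochner_integral_mult_right c s)
  moreover have "(a * cos (fst p)) * (indicator {-pi..<pi} u * (ell u * cos u))
      + (a * sin (fst p)) * (indicator {-pi..<pi} u * (ell u * sin u)) = indicator {-pi..<pi} u * ell u * (a * cos (fst p - u))" for u
    by (simp add: cos_diff algebra_simps)
  ultimately have h: "has_bochner_integral lborel (\<lambda>u. indicator {-pi..<pi} u * ell u * (a * cos (fst p - u))) 0"
    by simp
  then have "integrable lborel (\<lambda>u. indicator {-pi..<pi} u * ell u * (a * cos (fst p - u)))" by (simp add: has_bochner_integral_iff)
  from conv_fst_snd[where f = ell and g = "\<lambda>x. a * cos x" and p = p, OF this profile_deriv_integrable[OF assms]] h
  show ?thesis by (simp add: linear_part_def[abs_def] ellk_def[abs_def] has_bochner_integral_iff)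
qed

lemma conv_cosk_linear_part: assumes "0 < \<delta>" shows "conv cosk (linear_part \<delta> a) 0 = pi * a * \<delta> * bump_mass"
proof -
  have "has_bochner_integral lborel (\<lambda>u. a * (indicator {-pi..<pi} u * (cos u * cos u))) (a * pi)"
    by (intro has_bochner_integral_mult_right has_bochner_integral_cos2_window)
  moreover have "a * (indicator {-pi..<pi} u * (cos u * cos u)) = indicator {-pi..<pi} u * cos u * (a * cos (fst (0::real\<times>real) - u))" for u
    by simp
  ultimately have h: "has_bochner_integral lborel (\<lambda>u. indicator {-pi..<pi} u * cos u * (a * cos (fst (0::real\<times>real) - u))) (a * pi)"
    by (simp only:)
  then have "integrable lborel (\<lambda>u. indicator {-pi..<pi} u * cos u * (a * cos (fst (0::real\<times>real) - u)))" by (simp add: has_bochner_integral_iff)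
  from conv_fst_snd[where f = cos and g = "\<lambda>x. a * cos x" and p = 0, OF this profile_deriv_integrable[OF assms]]
  have "conv cosk (linear_part \<delta> a) 0 = (LINT u|lborel. indicator {-pi..<pi} u * cos u * (a * cos (fst (0::real\<times>real) - u))) * (LINT y|lborel. profile_deriv \<delta> y)"
    by (simp only: linear_part_def[abs_def] cosk_def[abs_def])
  also have "\<dots> = a * pi * (\<delta> * bump_mass)" using h by (simp only: has_bochner_integral_iff profile_deriv_integral[OF assms])
  finally show ?thesis by (simp add: mult_ac)
qed

text \<open>Two errors add up: the quadratic remainder of the bump, and the distance \<sigma> of
  \<phi> from a cos x weighted by the derivative of the profile.\<close>

lemma profile_minus_lin:
  assumes lip: "\<And>s t. \<bar>bump' s - bump' t\<bar> \<le> C * \<bar>s - t\<bar>" and C: "0 \<le> C" and \<delta>: "0 < \<delta>"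
    and r: "\<bar>\<phi> q\<bar> \<le> r" "r \<le> 1/2" and v: "\<bar>\<phi> q - a * cos (fst q)\<bar> \<le> \<sigma>"
  shows "\<bar>profile \<delta> \<phi> q - W0 \<delta> q - linear_part \<delta> a q\<bar> \<le> profile_deriv \<delta> (snd q) * \<sigma> + (C * r * r) * indicator {-2*\<delta>..2*\<delta>} (snd q)"
proof -
  have r0: "0 \<le> r" using r(1) by linarith
  have "\<bar>profile \<delta> \<phi> q - W0 \<delta> q - profile_deriv \<delta> (snd q) * (\<phi> q - 0)\<bar> \<le> C * r * \<bar>\<phi> q - 0\<bar> * indicator {-2*\<delta>..2*\<delta>} (snd q)"
    by (rule profile_linearization[where p = q and ?\<phi>1.0 = \<phi> and ?\<phi>2.0 = "\<lambda>_. 0", OF lip C \<delta> r(1) _ r(2)]) (simp add: r0)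
  also have "\<dots> \<le> C * r * r * indicator {-2*\<delta>..2*\<delta>} (snd q)"
    using r C r0 by (intro mult_right_mono mult_left_mono) auto
  finally have 1: "\<bar>profile \<delta> \<phi> q - W0 \<delta> q - profile_deriv \<delta> (snd q) * \<phi> q\<bar> \<le> C * r * r * indicator {-2*\<delta>..2*\<delta>} (snd q)" by simp
  have "\<bar>profile_deriv \<delta> (snd q) * (\<phi> q - a * cos (fst q))\<bar> \<le> profile_deriv \<delta> (snd q) * \<sigma>"
    unfolding abs_mult by (simp add: profile_deriv_nonneg mult_left_mono v)
  moreover have "profile \<delta> \<phi> q - W0 \<delta> q - linear_part \<delta> a q = (profile \<delta> \<phi> q - W0 \<delta> q - profile_deriv \<delta> (snd q) * \<phi> q) + profile_deriv \<delta> (snd q) * (\<phi> q - a * cos (fst q))"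
    by (simp add: linear_part_def algebra_simps)
  ultimately show ?thesis using 1 by linarith
qed

text \<open>The defect of the starting point a cos x of the iteration. It must be small compared
  with a, which is why its first term has to be quadratic in a.\<close>

lemma nonresonant_cos_bound:
  assumes lip: "\<And>s t. \<bar>bump' s - bump' t\<bar> \<le> C * \<bar>s - t\<bar>" and C: "0 \<le> C"
    and \<delta>: "0 < \<delta>" "\<delta> \<le> 1/4" and a: "0 \<le> a" "a \<le> 1/2" and p: "\<bar>snd p\<bar> \<le> 2 * \<delta>"
  shows "\<bar>nonresonant \<delta> (\<lambda>p. a * cos (fst p)) p\<bar> \<le> 9/5 * pi * (4 * (C * a * a)) + 512 * sqrt \<delta>"
proof -
  let ?\<phi> = "\<lambda>p::real\<times>real. a * cos (fst p)"
  note W1 = profile_good[OF \<delta>(1) admissible_cos[OF a]] and W00 = profile_good[OF \<delta>(1) admissible_0]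
  let ?V = "\<lambda>q. (profile \<delta> ?\<phi> q - W0 \<delta> q) - linear_part \<delta> a q"
  have V: "\<bar>?V q\<bar> \<le> profile_deriv \<delta> (snd q) * 0 + (C * a * a) * indicator {-2*\<delta>..2*\<delta>} (snd q)" for q
    by (rule profile_minus_lin[OF lip C \<delta>(1)]) (use a abs_a_cos_le in auto)
  have "\<bar>conv ellk ?V p\<bar> \<le> \<delta> * (9/5 * pi * (bump_mass * 0 + 4 * (C * a * a)))"
    using C a by (intro conv_profile_bound(1)[OF \<delta>(1) _ _ V]) auto
  moreover have "conv ellk ?V p = conv ellk (\<lambda>q. profile \<delta> ?\<phi> q - W0 \<delta> q) p"
    using good_conv_diff[OF lker_ellk good_diff[OF W1 W00] good_linear_part[OF \<delta>(1)], of a p] conv_ellk_linear_part[OF \<delta>(1)] by simp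
  ultimately have e1: "\<bar>conv ellk (\<lambda>q. profile \<delta> ?\<phi> q - W0 \<delta> q) p\<bar> \<le> \<delta> * (9/5 * pi * (4 * (C * a * a)))" by simp
  have W: "\<bar>profile \<delta> ?\<phi> q\<bar> \<le> 1 * indicator {-2*\<delta>..2*\<delta>} (snd q)" for q
  proof (cases "\<bar>snd q\<bar> \<le> 2 * \<delta>")
    case True then show ?thesis using profile_bounds[of \<delta> ?\<phi> q] by (auto simp: indicator_def abs_le_iff)
  next
    case False then show ?thesis using W1 by (auto simp: good_def strip_def simp del: split_paired_All)
  qed
  have e2: "\<bar>conv dk (profile \<delta> ?\<phi>) p\<bar> \<le> 512 * sqrt \<delta> * \<delta> * 1"
    by (rule conv_dk_bound[OF \<delta> _ W p]) simp
  have "\<bar>nonresonant \<delta> ?\<phi> p\<bar> \<le> (\<delta> * (9/5 * pi * (4 * (C * a * a))) + 512 * sqrt \<delta> * \<delta> * 1) / \<delta>"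
    unfolding nonresonant_def abs_divide using \<delta>(1) e1 e2 by (intro divide_mono order_trans[OF abs_triangle_ineq4]) auto
  also have "\<dots> = 9/5 * pi * (4 * (C * a * a)) + 512 * sqrt \<delta>"
    using \<delta>(1) by (simp add: add_divide_distrib)
  finally show ?thesis .
qed

text \<open>The leading value is the first mode of \<open>linear_part\<close>, \<pi> a \<delta>
  \<open>bump_mass\<close>, times 2/\<delta>. Closeness to it keeps the denominator of the strength
  a / \<open>resonant\<close> away from 0.\<close>

lemma resonant_approx:
  assumes lip: "\<And>s t. \<bar>bump' s - bump' t\<bar> \<le> C * \<bar>s - t\<bar>" and C: "0 \<le> C"
    and \<delta>: "0 < \<delta>" and ad: "admissible \<phi>" and r: "\<And>q. \<bar>\<phi> q\<bar> \<le> r" "r \<le> 1/2" and v: "\<And>q. \<bar>\<phi> q - a * cos (fst q)\<bar> \<le> \<sigma>"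
  shows "\<bar>resonant \<delta> \<phi> - 2 * pi * bump_mass * a\<bar> \<le> 4 * pi * (bump_mass * \<sigma> + 4 * (C * r * r))"
proof -
  note W1 = profile_good[OF \<delta> ad] and W00 = profile_good[OF \<delta> admissible_0]
  have r0: "0 \<le> r" "0 \<le> \<sigma>" using r(1)[of 0] v[of 0] by linarith+
  let ?V = "\<lambda>q. (profile \<delta> \<phi> q - W0 \<delta> q) - linear_part \<delta> a q"
  have V: "\<bar>?V q\<bar> \<le> profile_deriv \<delta> (snd q) * \<sigma> + (C * r * r) * indicator {-2*\<delta>..2*\<delta>} (snd q)" for q
    by (rule profile_minus_lin[OF lip C \<delta> r v])
  have b: "\<bar>conv cosk ?V 0\<bar> \<le> \<delta> * (2 * pi * (bump_mass * \<sigma> + 4 * (C * r * r)))"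
    using C r0 by (intro conv_profile_bound(2)[OF \<delta> _ _ V]) auto
  have "conv cosk ?V 0 = conv cosk (\<lambda>q. profile \<delta> \<phi> q - W0 \<delta> q) 0 - pi * a * \<delta> * bump_mass"
    using good_conv_diff[OF lker_cosk good_diff[OF W1 W00] good_linear_part[OF \<delta>], of a 0] conv_cosk_linear_part[OF \<delta>] by simp
  then have "resonant \<delta> \<phi> - 2 * pi * bump_mass * a = 2 / \<delta> * conv cosk ?V 0"
    unfolding resonant_def using \<delta> by (simp add: field_simps)
  also have "\<bar>\<dots>\<bar> = 2 / \<delta> * \<bar>conv cosk ?V 0\<bar>" using \<delta> by (simp add: abs_mult)
  also have "\<dots> \<le> 2 / \<delta> * (\<delta> * (2 * pi * (bump_mass * \<sigma> + 4 * (C * r * r))))" using \<delta> by (intro mult_left_mono b) auto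
  also have "\<dots> = 4 * pi * (bump_mass * \<sigma> + 4 * (C * r * r))" using \<delta> by simp
  finally show ?thesis .
qed

lemma resonant_lipschitz:
  assumes lip: "\<And>s t. \<bar>bump' s - bump' t\<bar> \<le> C * \<bar>s - t\<bar>" and C: "0 \<le> C"
    and \<delta>: "0 < \<delta>" and a: "admissible \<phi>1" "admissible \<phi>2"
    and r: "\<And>p. \<bar>\<phi>1 p\<bar> \<le> r" "\<And>p. \<bar>\<phi>2 p\<bar> \<le> r" "r \<le> 1/2" and d: "\<And>p. \<bar>\<phi>1 p - \<phi>2 p\<bar> \<le> d"
  shows "\<bar>resonant \<delta> \<phi>1 - resonant \<delta> \<phi>2\<bar> \<le> 4 * pi * (bump_mass + 4 * (C * r)) * d"
proof -
  note W1 = profile_good[OF \<delta> a(1)] and W2 = profile_good[OF \<delta> a(2)] and W00 = profile_good[OF \<delta> admissible_0]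
  have r0: "0 \<le> r" "0 \<le> d" using r(1)[of 0] d[of 0] by linarith+
  let ?V = "\<lambda>q. profile \<delta> \<phi>1 q - profile \<delta> \<phi>2 q"
  have V: "\<bar>?V q\<bar> \<le> profile_deriv \<delta> (snd q) * d + (C * r * d) * indicator {-2*\<delta>..2*\<delta>} (snd q)" for q
    using profile_lipschitz[where p = q and ?\<phi>1.0 = \<phi>1 and ?\<phi>2.0 = \<phi>2, OF lip C \<delta> r(1) r(2) r(3) d]
    by (simp add: algebra_simps)
  have b: "\<bar>conv cosk ?V 0\<bar> \<le> \<delta> * (2 * pi * (bump_mass * d + 4 * (C * r * d)))"
    using C r0 by (intro conv_profile_bound(2)[OF \<delta> _ _ V]) auto
  have "conv cosk (\<lambda>q. profile \<delta> \<phi>1 q - W0 \<delta> q) 0 - conv cosk (\<lambda>q. profile \<delta> \<phi>2 q - W0 \<delta> q) 0 = conv cosk ?V 0"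
    using good_conv_diff[OF lker_cosk W1 W00, of 0] good_conv_diff[OF lker_cosk W2 W00, of 0] good_conv_diff[OF lker_cosk W1 W2, of 0]
    by linarith
  then have "resonant \<delta> \<phi>1 - resonant \<delta> \<phi>2 = 2 / \<delta> * conv cosk ?V 0"
    unfolding resonant_def by (simp only: right_diff_distrib[symmetric])
  also have "\<bar>\<dots>\<bar> = 2 / \<delta> * \<bar>conv cosk ?V 0\<bar>" using \<delta> by (simp add: abs_mult)
  also have "\<dots> \<le> 2 / \<delta> * (\<delta> * (2 * pi * (bump_mass * d + 4 * (C * r * d))))" using \<delta> by (intro mult_left_mono b) auto
  also have "\<dots> = 4 * pi * (bump_mass + 4 * (C * r)) * d" using \<delta> by (simp add: algebra_simps)
  finally show ?thesis .
qed

text \<open>The fixed point is sought on the strip \<open>\<bar>y\<bar> \<le> 2 \<delta>\<close>, since the stream function is unbounded in \<open>y\<close>.\<close>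

definition clamp_y :: "real \<Rightarrow> real \<times> real \<Rightarrow> real \<times> real" where
  "clamp_y \<delta> p = (fst p, max (- 2 * \<delta>) (min (2 * \<delta>) (snd p)))"

lemma clamp_y_snd: "0 < \<delta> \<Longrightarrow> \<bar>snd (clamp_y \<delta> p)\<bar> \<le> 2 * \<delta>" by (auto simp: clamp_y_def)
lemma clamp_y_id: "\<bar>snd p\<bar> \<le> 2 * \<delta> \<Longrightarrow> clamp_y \<delta> p = p" by (cases p) (auto simp: clamp_y_def)
lemma clamp_y_minus: "0 < \<delta> \<Longrightarrow> clamp_y \<delta> (- p) = - clamp_y \<delta> p" by (auto simp: clamp_y_def max_def min_def)

lemma nonresonant_continuous: assumes "0 < \<delta>" "admissible \<phi>" shows "continuous_on UNIV (nonresonant \<delta> \<phi>)"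
  unfolding nonresonant_def using assms(1)
  by (intro continuous_intros good_conv_continuous[OF lker_ellk good_diff[OF profile_good[OF assms] profile_good[OF assms(1) admissible_0]]]
      good_conv_continuous[OF lker_dk profile_good[OF assms]]) auto

lemma nonresonant_per: assumes "0 < \<delta>" "admissible \<phi>" shows "per (nonresonant \<delta> \<phi>)"
proof -
  have "per (profile \<delta> \<phi>)" "per (\<lambda>q. profile \<delta> \<phi> q - W0 \<delta> q)"
    using good_diff[OF profile_good[OF assms] profile_good[OF assms(1) admissible_0]] profile_good[OF assms] by (simp_all add: good_def)
  then have "per (conv dk (profile \<delta> \<phi>))" "per (conv ellk (\<lambda>q. profile \<delta> \<phi> q - W0 \<delta> q))" by (simp_all add: conv_per)
  then show ?thesis by (simp add: per_def nonresonant_def)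
qed

lemma nonresonant_sym: assumes \<delta>: "0 < \<delta>" and \<phi>: "admissible \<phi>" shows "nonresonant \<delta> \<phi> (- p) = nonresonant \<delta> \<phi> p"
proof -
  have s: "profile \<delta> \<phi> (- q) = profile \<delta> \<phi> q" "W0 \<delta> (- q) = W0 \<delta> q" for q using admissible_sym[OF \<phi>] by (simp_all add: profile_def)
  have "conv ellk (\<lambda>q. profile \<delta> \<phi> q - W0 \<delta> q) (- p) = conv ellk (\<lambda>q. profile \<delta> \<phi> q - W0 \<delta> q) p"
    by (rule conv_symmetric[OF _ _ lker_ellk good_diff[OF profile_good[OF \<delta> \<phi>] profile_good[OF \<delta> admissible_0]]]) (simp_all add: s ellk_def ell_def)
  moreover have "conv dk (profile \<delta> \<phi>) (- p) = conv dk (profile \<delta> \<phi>) p"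
    by (rule conv_symmetric[OF _ _ lker_dk profile_good[OF \<delta> \<phi>]]) (simp_all add: s dk_def KL_def)
  ultimately show ?thesis by (simp add: nonresonant_def)
qed

lemma quotient_contraction:
  fixes A a w1 w2 b1 b2 d :: real
  assumes "0 < A" "A = k * a" "0 < a" "0 < k" "(97/100) * A \<le> b1" "(97/100) * A \<le> b2"
    and w: "\<bar>w1 - w2\<bar> \<le> (91/100) * k * d" "\<bar>w2\<bar> \<le> (92/10000) * A" and b: "\<bar>b1 - b2\<bar> \<le> (21/10) * k * d"
  shows "\<bar>a / b1 * w1 - a / b2 * w2\<bar> \<le> (96/100) * d"
proof -
  have d: "0 \<le> d"
  proof -
    have "0 \<le> (21/10) * k * d" using b abs_ge_zero order_trans by blast
    then show ?thesis using assms(4) by (simp add: zero_le_mult_iff)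
  qed
  have b0: "0 < b1" "0 < b2" using assms by (auto intro: less_le_trans[of 0 "(97/100) * A"])
  have "a / b1 * w1 - a / b2 * w2 = a * ((w1 - w2) * b2 + w2 * (b2 - b1)) / (b1 * b2)"
    using b0 by (simp add: field_simps)
  also have "\<bar>\<dots>\<bar> = a * \<bar>(w1 - w2) * b2 + w2 * (b2 - b1)\<bar> / (b1 * b2)"
    using b0 assms(3) by (simp add: abs_mult)
  also have "\<dots> \<le> (96/100) * d"
  proof -
    have "\<bar>(w1 - w2) * b2 + w2 * (b2 - b1)\<bar> \<le> \<bar>w1 - w2\<bar> * b2 + \<bar>w2\<bar> * \<bar>b1 - b2\<bar>"
      using abs_triangle_ineq[of "(w1 - w2) * b2" "w2 * (b2 - b1)"] b0 by (simp add: abs_mult abs_minus_commute)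
    also have "\<dots> \<le> (91/100) * k * d * b2 + (92/10000) * A * ((21/10) * k * d)"
      using w b b0 assms(1,4) d by (intro add_mono mult_mono) auto
    finally have "a * \<bar>(w1 - w2) * b2 + w2 * (b2 - b1)\<bar> \<le> a * ((91/100) * k * d * b2 + (92/10000) * A * ((21/10) * k * d))"
      using assms(3) by (intro mult_left_mono) auto
    also have "\<dots> = (91/100) * d * (A * b2) + (1932/100000) * d * (A * A)" using assms(2) by (simp add: algebra_simps)
    also have "\<dots> \<le> (91/100) * d * (b1 * b2 / (97/100)) + (1932/100000) * d * (b1 * b2 / ((97/100) * (97/100)))"
    proof (intro add_mono mult_left_mono)
      have A1: "A \<le> b1 / (97/100)" "A \<le> b2 / (97/100)" using assms by auto
      show "A * b2 \<le> b1 * b2 / (97/100)" using mult_right_mono[OF A1(1), of b2] b0 by simp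
      show "A * A \<le> b1 * b2 / ((97/100) * (97/100))" using mult_mono[OF A1] b0 assms(1) by simp
    qed (use d in auto)
    also have "\<dots> = ((91/100) / (97/100) + (1932/100000) / ((97/100) * (97/100))) * d * (b1 * b2)" by (simp add: algebra_simps)
    \<comment> \<open>Numerically 0.91/0.97 is about 0.938 and 0.0092 * 2.1 / 0.97^2 about
      0.021.\<close>
    also have "\<dots> \<le> (96/100) * d * (b1 * b2)" using d b0 by (intro mult_right_mono) auto
    finally show ?thesis using b0 by (simp add: pos_divide_le_eq)
  qed
  finally show ?thesis .
qed

text \<open>The constant c is harmless since only the gradient of \<phi> enters the velocity. The
  one-percent closeness to a cos x will show nontriviality, and the bound on \<nu> makes the later
  derivative estimates uniform.\<close>

lemma exists_profile:
  obtains a \<delta>0 :: real where "0 < a" "a \<le> 1/8" "0 < \<delta>0" "\<delta>0 \<le> 1/4"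
    "\<And>\<delta>. 0 < \<delta> \<Longrightarrow> \<delta> < \<delta>0 \<Longrightarrow> \<exists>\<phi> \<nu> c. admissible \<phi> \<and> (\<forall>p. \<bar>\<phi> p - a * cos (fst p)\<bar> \<le> a / 100) \<and>
        0 < \<nu> \<and> \<nu> \<le> 1 / bump_mass \<and> (\<forall>p. \<bar>snd p\<bar> \<le> 2 * \<delta> \<longrightarrow> \<phi> p = - (\<nu> / \<delta>) * conv KL (profile \<delta> \<phi>) p + c)"
proof -
  obtain C where C: "0 < C" "\<And>s t. \<bar>bump' s - bump' t\<bar> \<le> C * \<bar>s - t\<bar>" using bump'_lipschitz by blast
  obtain C1 where C1: "0 < C1" "\<And>t. \<bar>bump' t\<bar> \<le> C1" using expinv_bounded by blast
  define k where "k = 2 * pi * bump_mass"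
  have k: "0 < k" unfolding k_def using bump_mass_pos by simp
  \<comment> \<open>The first bound makes 2 a <= 1/2, so functions within a/100 of a cos x are small
    enough to be admissible. The second makes C a at most \<open>bump_mass\<close> / 100000, so that
    quadratic terms are negligible against the linear ones.\<close>
  define a where "a = min (1/8) (bump_mass / (100000 * C))"
  have a: "0 < a" "a \<le> 1/8" unfolding a_def using bump_mass_pos C by auto
  have Ca: "100000 * (C * a) \<le> bump_mass"
  proof -
    have "a \<le> bump_mass / (100000 * C)" by (simp add: a_def)
    then show ?thesis using C by (simp add: field_simps)
  qed
  have Ca0: "0 \<le> C * a" using C a by simp
  define A where "A = k * a"
  have A: "0 < A" unfolding A_def using k a by simp
  \<comment> \<open>With sqrt \<delta> <= \<epsilon> both thin-layer errors together, 512 sqrt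
    \<delta> (C1 + 1), are at most A/20000.\<close>
  define \<epsilon> where "\<epsilon> = A / (20000 * 512 * (C1 + 1))"
  have \<epsilon>: "0 < \<epsilon>" unfolding \<epsilon>_def using A C1 by simp
  define \<delta>0 where "\<delta>0 = min (1/4) (\<epsilon>\<^sup>2)"
  have main: "\<exists>\<phi> \<nu> c. admissible \<phi> \<and> (\<forall>p. \<bar>\<phi> p - a * cos (fst p)\<bar> \<le> a / 100) \<and>
        0 < \<nu> \<and> \<nu> \<le> 1 / bump_mass \<and> (\<forall>p. \<bar>snd p\<bar> \<le> 2 * \<delta> \<longrightarrow> \<phi> p = - (\<nu> / \<delta>) * conv KL (profile \<delta> \<phi>) p + c)"
    if \<delta>: "0 < \<delta>" and "\<delta> < \<delta>0" for \<delta>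
  proof -
    have \<delta>1: "\<delta> \<le> 1/4" using that by (simp add: \<delta>0_def)
    have "sqrt \<delta> \<le> \<epsilon>" using that \<epsilon> by (intro real_le_lsqrt) (auto simp: \<delta>0_def)
    then have "512 * sqrt \<delta> * (C1 + 1) \<le> 512 * \<epsilon> * (C1 + 1)" using C1 by (intro mult_right_mono) auto
    also have "\<dots> = A / 20000" unfolding \<epsilon>_def using C1 by (simp add: field_simps)
    finally have e: "512 * sqrt \<delta> * C1 + 512 * sqrt \<delta> \<le> A / 20000" by (simp add: algebra_simps)
    have e0: "0 \<le> 512 * sqrt \<delta>" "0 \<le> 512 * sqrt \<delta> * C1" using C1 \<delta> by auto
    have kC: "9/5 * pi * (bump_mass + 4 * (C * (2 * a))) \<le> (9001/10000) * k"
    proof -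
      have "9/5 * pi * (bump_mass + 4 * (C * (2 * a))) \<le> 9/5 * pi * ((10001/10000) * bump_mass)"
      proof (intro mult_left_mono)
        show "bump_mass + 4 * (C * (2 * a)) \<le> (10001/10000) * bump_mass" using Ca Ca0 by simp
      qed simp
      also have "\<dots> \<le> (9001/10000) * k" unfolding k_def using bump_mass_pos by simp
      finally show ?thesis .
    qed
    define cf :: "real \<times> real \<Rightarrow> real" where "cf = (\<lambda>p. a * cos (fst p))"
    define P where "P \<phi> \<longleftrightarrow> per \<phi> \<and> (\<forall>p. \<phi> (- p) = \<phi> p) \<and> (\<forall>p. \<bar>\<phi> p - cf p\<bar> \<le> a / 100)" for \<phi>
    have P2a: "\<bar>\<phi> p\<bar> \<le> 2 * a" if "P \<phi>" for \<phi> p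
    proof -
      have "\<bar>\<phi> p - cf p\<bar> \<le> a / 100" using that unfolding P_def by blast
      moreover have "\<bar>cf p\<bar> \<le> a" unfolding cf_def using a by (intro abs_a_cos_le) auto
      ultimately show ?thesis using a by linarith
    qed
    have Padm: "admissible \<phi>" if "P \<phi>" "continuous_on UNIV \<phi>" for \<phi>
    proof -
      have "\<bar>\<phi> p\<bar> \<le> 1/2" for p using P2a[OF that(1), of p] a by linarith
      then show ?thesis using that unfolding P_def admissible_def by blast
    qed
    have Pcf: "P cf" unfolding P_def cf_def per_def using a by auto
    have cfc: "continuous_on UNIV cf" unfolding cf_def by (intro continuous_intros)
    have w_lip: "\<bar>nonresonant \<delta> \<phi> (clamp_y \<delta> p) - nonresonant \<delta> \<psi> (clamp_y \<delta> p)\<bar> \<le> (91/100) * k * d"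
      if "P \<phi>" "P \<psi>" "continuous_on UNIV \<phi>" "continuous_on UNIV \<psi>" "\<And>p. \<bar>\<phi> p - \<psi> p\<bar> \<le> d" for \<phi> \<psi> d p
    proof -
      have d: "0 \<le> d" using that(5)[of 0] by linarith
      have "\<bar>nonresonant \<delta> \<phi> (clamp_y \<delta> p) - nonresonant \<delta> \<psi> (clamp_y \<delta> p)\<bar> \<le> (9/5 * pi * (bump_mass + 4 * (C * (2 * a))) + 512 * sqrt \<delta> * C1) * d"
        by (rule nonresonant_lipschitz[OF C(2) _ C1(2) \<delta> \<delta>1 Padm[OF that(1,3)] Padm[OF that(2,4)]])
           (use C a P2a that clamp_y_snd[OF \<delta>] in auto)
      also have "\<dots> \<le> ((91/100) * k) * d"
      proof (rule mult_right_mono[OF _ d])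
        have "A \<le> k" unfolding A_def using a k by simp
        then show "9/5 * pi * (bump_mass + 4 * (C * (2 * a))) + 512 * sqrt \<delta> * C1 \<le> (91/100) * k" using kC e e0 by linarith
      qed
      finally show ?thesis .
    qed
    have w_cf: "\<bar>nonresonant \<delta> cf (clamp_y \<delta> p)\<bar> \<le> (1/10000) * A" for p
    proof -
      have "\<bar>nonresonant \<delta> cf (clamp_y \<delta> p)\<bar> \<le> 9/5 * pi * (4 * (C * a * a)) + 512 * sqrt \<delta>"
        unfolding cf_def by (rule nonresonant_cos_bound[OF C(2) _ \<delta> \<delta>1]) (use C a clamp_y_snd[OF \<delta>] in auto)
      also have "9/5 * pi * (4 * (C * a * a)) \<le> 9/5 * pi * (4 * ((1/100000) * bump_mass * a))"
        using Ca a by (intro mult_left_mono mult_right_mono) auto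
      also have "\<dots> = (36/1000000) * A" unfolding A_def k_def by simp
      finally show ?thesis using e e0 A by linarith
    qed
    have w_bd: "\<bar>nonresonant \<delta> \<phi> (clamp_y \<delta> p)\<bar> \<le> (92/10000) * A" if "P \<phi>" "continuous_on UNIV \<phi>" for \<phi> p
    proof -
      have "\<bar>nonresonant \<delta> \<phi> (clamp_y \<delta> p) - nonresonant \<delta> cf (clamp_y \<delta> p)\<bar> \<le> (91/100) * k * (a / 100)"
        by (rule w_lip[OF that(1) Pcf that(2) cfc]) (use that in \<open>auto simp: P_def simp del: split_paired_All\<close>)
      also have "\<dots> = (91/10000) * A" by (simp add: A_def)
      finally show ?thesis using w_cf[of p] by linarith
    qed
    \<comment> \<open>The deviation from A is at most 2 (1/100 + 16/100000) A.\<close>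
    have b_lo: "(97/100) * A \<le> resonant \<delta> \<phi>" if "P \<phi>" "continuous_on UNIV \<phi>" for \<phi>
    proof -
      have "\<bar>resonant \<delta> \<phi> - 2 * pi * bump_mass * a\<bar> \<le> 4 * pi * (bump_mass * (a / 100) + 4 * (C * (2 * a) * (2 * a)))"
        by (rule resonant_approx[OF C(2) _ \<delta> Padm[OF that]])
           (use C a P2a[OF that(1)] that(1) in \<open>auto simp: P_def cf_def simp del: split_paired_All\<close>)
      also have "\<dots> \<le> 4 * pi * (bump_mass * (a / 100) + 4 * ((4/100000) * bump_mass * a))"
      proof (intro mult_left_mono add_left_mono)
        have "C * (2 * a) * (2 * a) = 4 * (C * a) * a" by simp
        also have "\<dots> \<le> (4/100000) * bump_mass * a" using Ca a by (intro mult_right_mono) auto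
        finally show "C * (2 * a) * (2 * a) \<le> (4/100000) * bump_mass * a" .
      qed auto
      also have "\<dots> = (2032/100000) * A" unfolding A_def k_def by simp
      finally have "\<bar>resonant \<delta> \<phi> - A\<bar> \<le> (2032/100000) * A" by (simp add: A_def k_def)
      then show ?thesis using A by linarith
    qed
    have b_lip: "\<bar>resonant \<delta> \<phi> - resonant \<delta> \<psi>\<bar> \<le> (21/10) * k * d"
      if "P \<phi>" "P \<psi>" "continuous_on UNIV \<phi>" "continuous_on UNIV \<psi>" "\<And>p. \<bar>\<phi> p - \<psi> p\<bar> \<le> d" for \<phi> \<psi> d
    proof -
      have d: "0 \<le> d" using that(5)[of 0] by linarith
      have "\<bar>resonant \<delta> \<phi> - resonant \<delta> \<psi>\<bar> \<le> 4 * pi * (bump_mass + 4 * (C * (2 * a))) * d"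
        by (rule resonant_lipschitz[OF C(2) _ \<delta> Padm[OF that(1,3)] Padm[OF that(2,4)]]) (use C a P2a that in auto)
      also have "\<dots> \<le> 4 * pi * ((10001/10000) * bump_mass) * d"
      proof (intro mult_left_mono mult_right_mono d)
        show "bump_mass + 4 * (C * (2 * a)) \<le> (10001/10000) * bump_mass" using Ca Ca0 by simp
      qed simp
      also have "\<dots> \<le> (21/10) * k * d" unfolding k_def using bump_mass_pos d by (intro mult_right_mono) auto
      finally show ?thesis .
    qed
    \<comment> \<open>With strength \<nu> = a / \<open>resonant\<close>, the resonant term \<nu> *
      \<open>resonant\<close> * cos x is exactly a cos x, whatever \<phi> is; only the nonresonant
      part is iterated.\<close>
    define N where "N \<phi> p = cf p + a / resonant \<delta> \<phi> * nonresonant \<delta> \<phi> (clamp_y \<delta> p)" for \<phi> p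
    have N_cont: "continuous_on UNIV (N \<phi>)" if "P \<phi>" "continuous_on UNIV \<phi>" for \<phi>
    proof -
      have "continuous_on UNIV (clamp_y \<delta>)" unfolding clamp_y_def by (intro continuous_intros)
      then have "continuous_on UNIV (\<lambda>p. nonresonant \<delta> \<phi> (clamp_y \<delta> p))"
        using continuous_on_compose2[OF nonresonant_continuous[OF \<delta> Padm[OF that]]] by blast
      then show ?thesis unfolding N_def using cfc by (intro continuous_intros)
    qed
    have N_P: "P (N \<phi>)" if "P \<phi>" "continuous_on UNIV \<phi>" for \<phi>
      unfolding P_def
    proof (intro conjI allI)
      show "per (N \<phi>)" using nonresonant_per[OF \<delta> Padm[OF that]] Pcf by (simp add: per_def N_def P_def clamp_y_def)
      fix p :: "real \<times> real"
      show "N \<phi> (- p) = N \<phi> p" unfolding N_def clamp_y_minus[OF \<delta>] nonresonant_sym[OF \<delta> Padm[OF that]] by (simp add: cf_def)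
      have b: "(97/100) * A \<le> resonant \<delta> \<phi>" by (rule b_lo[OF that])
      then have b0: "0 < resonant \<delta> \<phi>" using A by linarith
      \<comment> \<open>The comparison is 0.92 A against 0.97 A.\<close>
      have "100 * \<bar>nonresonant \<delta> \<phi> (clamp_y \<delta> p)\<bar> \<le> resonant \<delta> \<phi>" using w_bd[OF that, of p] b A by linarith
      then show "\<bar>N \<phi> p - cf p\<bar> \<le> a / 100" unfolding N_def using b0 a by (simp add: abs_mult field_simps)
    qed
    \<comment> \<open>\<open>P\<close> consists of pointwise conditions stable under limits and
      continuity is part of the type, so \<open>S\<close> is closed in a complete space.\<close>
    define S where "S = {f :: (real \<times> real) \<Rightarrow>\<^sub>C real. P (apply_bcontfun f)}"
    have N_bcont: "N \<phi> \<in> bcontfun" if "P \<phi>" "continuous_on UNIV \<phi>" for \<phi>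
      by (rule bcontfun_normI[OF N_cont[OF that], of "2 * a"]) (use P2a[OF N_P[OF that]] in auto)
    define T where "T f = Bcontfun (N (apply_bcontfun f))" for f :: "(real \<times> real) \<Rightarrow>\<^sub>C real"
    have T_apply: "apply_bcontfun (T f) = N (apply_bcontfun f)" if "f \<in> S" for f
      unfolding T_def using that N_bcont[of "apply_bcontfun f"] by (intro Bcontfun_inverse) (auto simp: S_def)
    have "\<exists>!f\<in>S. T f = f"
    proof (rule Banach_fix[where c = "(96/100)"])
      have "closed S" unfolding closed_sequential_limits
      proof (intro allI impI; elim conjE)
        fix f l assume f: "\<forall>n. f n \<in> S" and lim: "f \<longlonglongrightarrow> l"
        have pt: "(\<lambda>n. apply_bcontfun (f n) p) \<longlonglongrightarrow> apply_bcontfun l p" for p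
        proof (rule tendstoI)
          fix e :: real assume "0 < e"
          from tendstoD[OF lim this] show "\<forall>\<^sub>F n in sequentially. dist (apply_bcontfun (f n) p) (apply_bcontfun l p) < e"
            by eventually_elim (rule dist_fun_lt_imp_dist_val_lt)
        qed
        have fP: "P (apply_bcontfun (f n))" for n using f by (auto simp: S_def)
        have "P (apply_bcontfun l)" unfolding P_def per_def
        proof (intro conjI allI)
          fix x y :: real
          have "(\<lambda>n. apply_bcontfun (f n) (x + 2 * pi, y)) = (\<lambda>n. apply_bcontfun (f n) (x, y))"
            using fP by (auto simp: P_def per_def)
          with pt[of "(x + 2 * pi, y)"] pt[of "(x, y)"] show "apply_bcontfun l (x + 2 * pi, y) = apply_bcontfun l (x, y)"
            using LIMSEQ_unique by metis
        next
          fix p :: "real \<times> real"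
          have "(\<lambda>n. apply_bcontfun (f n) (- p)) = (\<lambda>n. apply_bcontfun (f n) p)"
            using fP unfolding P_def by blast
          with pt[of "- p"] pt[of p] show "apply_bcontfun l (- p) = apply_bcontfun l p"
            using LIMSEQ_unique by metis
          have "(\<lambda>n. \<bar>apply_bcontfun (f n) p - cf p\<bar>) \<longlonglongrightarrow> \<bar>apply_bcontfun l p - cf p\<bar>"
            by (intro tendsto_intros pt)
          then show "\<bar>apply_bcontfun l p - cf p\<bar> \<le> a / 100"
            by (rule LIMSEQ_le_const2) (use fP in \<open>auto simp: P_def simp del: split_paired_All\<close>)
        qed
        then show "l \<in> S" by (simp add: S_def)
      qed
      then show "complete S" by (simp add: complete_eq_closed)
      have "cf \<in> bcontfun" by (rule bcontfun_normI[OF cfc, of "2 * a"]) (use P2a[OF Pcf] in auto)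
      then have "apply_bcontfun (Bcontfun cf) = cf" by (rule Bcontfun_inverse)
      then have "Bcontfun cf \<in> S" using Pcf by (simp add: S_def)
      then show "S \<noteq> {}" by blast
      show "T ` S \<subseteq> S"
      proof
        fix g assume "g \<in> T ` S"
        then obtain f where f: "f \<in> S" "g = T f" by blast
        have "P (N (apply_bcontfun f))" using f by (intro N_P) (auto simp: S_def)
        then show "g \<in> S" using T_apply[OF f(1)] f by (simp add: S_def)
      qed
      fix f g assume fg: "f \<in> S" "g \<in> S"
      then have Pf: "P (apply_bcontfun f)" "P (apply_bcontfun g)" by (auto simp: S_def)
      have d: "\<bar>apply_bcontfun f p - apply_bcontfun g p\<bar> \<le> dist f g" for p
        using dist_bounded[of f p g] by (simp add: dist_real_def)
      show "dist (T f) (T g) \<le> (96/100) * dist f g"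
      proof (rule dist_bound)
        fix p
        let ?f = "apply_bcontfun f" and ?g = "apply_bcontfun g"
        have "\<bar>a / resonant \<delta> ?f * nonresonant \<delta> ?f (clamp_y \<delta> p) - a / resonant \<delta> ?g * nonresonant \<delta> ?g (clamp_y \<delta> p)\<bar> \<le> (96/100) * dist f g"
          by (rule quotient_contraction[OF A A_def a(1) k])
             (use b_lo[OF Pf(1)] b_lo[OF Pf(2)] w_lip[OF Pf _ _ d] w_bd[OF Pf(2)] b_lip[OF Pf _ _ d] in auto)
        then show "dist (apply_bcontfun (T f) p) (apply_bcontfun (T g) p) \<le> (96/100) * dist f g"
          by (simp add: T_apply[OF fg(1)] T_apply[OF fg(2)] N_def dist_real_def)
      qed
    qed auto
    then obtain f where f: "f \<in> S" "T f = f" by blast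
    define \<phi> where "\<phi> = apply_bcontfun f"
    have \<phi>: "P \<phi>" "continuous_on UNIV \<phi>" using f(1) by (auto simp: S_def \<phi>_def)
    have fix_eq: "\<phi> = N \<phi>" using T_apply[OF f(1)] f(2) by (simp add: \<phi>_def)
    define \<nu> where "\<nu> = a / resonant \<delta> \<phi>"
    have b: "(97/100) * A \<le> resonant \<delta> \<phi>" by (rule b_lo[OF \<phi>])
    then have b0: "0 < resonant \<delta> \<phi>" using A by linarith
    obtain c where c: "\<And>p. - conv KL (profile \<delta> \<phi>) p / \<delta> = nonresonant \<delta> \<phi> p + resonant \<delta> \<phi> * cos (fst p) + c"
      using conv_KL_decomposition[OF \<delta> Padm[OF \<phi>]] by blast
    show ?thesis
    proof (intro exI conjI allI impI)
      show "admissible \<phi>" by (rule Padm[OF \<phi>])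
      show "\<bar>\<phi> p - a * cos (fst p)\<bar> \<le> a / 100" for p using \<phi>(1) unfolding P_def cf_def by blast
      show "0 < \<nu>" unfolding \<nu>_def using a b0 by simp
      show "\<nu> \<le> 1 / bump_mass"
      proof -
        have "bump_mass * a \<le> (97/100) * A"
        proof -
          have "1 * (bump_mass * a) \<le> ((97/100) * (2 * pi)) * (bump_mass * a)" using pi_gt3 bump_mass_pos a by (intro mult_right_mono) auto
          then show ?thesis by (simp add: A_def k_def mult_ac)
        qed
        then have "bump_mass * a \<le> resonant \<delta> \<phi>" using b by linarith
        then show ?thesis unfolding \<nu>_def using b0 bump_mass_pos by (simp add: field_simps)
      qed
      fix p :: "real \<times> real" assume p: "\<bar>snd p\<bar> \<le> 2 * \<delta>"
      have "\<phi> p = a * cos (fst p) + \<nu> * nonresonant \<delta> \<phi> p"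
        using fun_cong[OF fix_eq, of p] clamp_y_id[OF p] by (simp add: N_def cf_def \<nu>_def)
      also have "\<dots> = \<nu> * (- conv KL (profile \<delta> \<phi>) p / \<delta>) + (- \<nu> * c)"
        unfolding c \<nu>_def using b0 by (simp add: field_simps)
      finally show "\<phi> p = - (\<nu> / \<delta>) * conv KL (profile \<delta> \<phi>) p + (- \<nu> * c)" by simp
    qed
  qed
  show thesis
  proof (rule that[of a \<delta>0])
    show "0 < \<delta>0" using \<epsilon> by (simp add: \<delta>0_def)
    show "\<delta>0 \<le> 1/4" by (simp add: \<delta>0_def)
  qed (use a main in auto)
qed

section \<open>Derivative bounds\<close>

text \<open>Derivatives along a fixed vector let one chain of estimates serve both coordinate
  directions.\<close>

definition line_deriv :: "real \<times> real \<Rightarrow> (real \<times> real \<Rightarrow> real) \<Rightarrow> (real \<times> real \<Rightarrow> real) \<Rightarrow> bool" where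
  "line_deriv e f f' \<longleftrightarrow> (\<forall>p. ((\<lambda>s. f (p + s *\<^sub>R e)) has_real_derivative f' p) (at 0))"

lemma line_derivD: "line_deriv e f f' \<Longrightarrow> ((\<lambda>s. f (p + s *\<^sub>R e)) has_real_derivative f' p) (at 0)"
  unfolding line_deriv_def by blast

lemma line_deriv_add: "line_deriv e f f' \<Longrightarrow> line_deriv e g g' \<Longrightarrow> line_deriv e (\<lambda>p. f p + g p) (\<lambda>p. f' p + g' p)"
  unfolding line_deriv_def by (intro allI DERIV_add) blast+

lemma line_deriv_mult: "line_deriv e f f' \<Longrightarrow> line_deriv e g g' \<Longrightarrow> line_deriv e (\<lambda>p. f p * g p) (\<lambda>p. f' p * g p + f p * g' p)"
  unfolding line_deriv_def
proof (intro allI)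
  fix p assume *: "\<forall>p. ((\<lambda>s. f (p + s *\<^sub>R e)) has_real_derivative f' p) (at 0)" "\<forall>p. ((\<lambda>s. g (p + s *\<^sub>R e)) has_real_derivative g' p) (at 0)"
  show "((\<lambda>s. f (p + s *\<^sub>R e) * g (p + s *\<^sub>R e)) has_real_derivative f' p * g p + f p * g' p) (at 0)"
    using DERIV_mult[OF *(1)[rule_format, of p] *(2)[rule_format, of p]] by (simp add: mult.commute)
qed

lemma line_deriv_cmult: "line_deriv e f f' \<Longrightarrow> line_deriv e (\<lambda>p. c * f p) (\<lambda>p. c * f' p)"
  unfolding line_deriv_def by (intro allI DERIV_cmult) blast

lemma line_deriv_conv: "lker k \<Longrightarrow> good r w \<Longrightarrow> good r w' \<Longrightarrow> line_deriv e w w' \<Longrightarrow> line_deriv e (conv k w) (conv k w')"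
  unfolding line_deriv_def by (intro allI conv_has_partial) blast+

lemma line_deriv_of_has_derivative:
  assumes "\<And>p. (f has_derivative (\<lambda>h. fst h * fx p + snd h * fy p)) (at p)"
  shows "line_deriv e f (\<lambda>p. fst e * fx p + snd e * fy p)"
  unfolding line_deriv_def
proof
  fix p
  have "((\<lambda>s. f (p + s *\<^sub>R e)) has_derivative (\<lambda>t. fst (t *\<^sub>R e) * fx p + snd (t *\<^sub>R e) * fy p)) (at 0)"
    by (rule has_derivative_compose[of "\<lambda>s. p + s *\<^sub>R e" "\<lambda>t. t *\<^sub>R e"]) (use assms in \<open>auto intro!: derivative_eq_intros\<close>)
  moreover have "(\<lambda>t. fst (t *\<^sub>R e) * fx p + snd (t *\<^sub>R e) * fy p) = (*) (fst e * fx p + snd e * fy p)"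
    by (auto simp: algebra_simps)
  ultimately show "((\<lambda>s. f (p + s *\<^sub>R e)) has_real_derivative fst e * fx p + snd e * fy p) (at 0)"
    by (simp add: has_field_derivative_def)
qed

lemma line_deriv_trunc:
  assumes "a < b" and E0: "\<And>p. a \<le> \<bar>snd p\<bar> \<Longrightarrow> \<bar>snd p\<bar> < b \<Longrightarrow> E p \<le> 0"
    and G: "line_deriv e G G1" and E: "line_deriv e E E1"
  shows "line_deriv e (trunc b (\<lambda>p. G p * expinv P (E p)))
     (\<lambda>p. trunc b (\<lambda>p. G1 p * expinv P (E p)) p + trunc b (\<lambda>p. (G p * E1 p) * expinv (expinv_deriv P) (E p)) p)"
  unfolding line_deriv_def
proof
  fix p :: "real \<times> real"
  show "((\<lambda>s. trunc b (\<lambda>p. G p * expinv P (E p)) (p + s *\<^sub>R e)) has_real_derivative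
     trunc b (\<lambda>p. G1 p * expinv P (E p)) p + trunc b (\<lambda>p. (G p * E1 p) * expinv (expinv_deriv P) (E p)) p) (at 0)"
  proof (cases "\<bar>snd p\<bar> < b")
    case True
    have "((\<lambda>s. expinv P (E (p + s *\<^sub>R e))) has_real_derivative expinv (expinv_deriv P) (E (p + 0 *\<^sub>R e)) * E1 p) (at 0)"
      by (rule DERIV_chain2[OF DERIV_expinv line_derivD[OF E]])
    from DERIV_mult[OF line_derivD[OF G, of p] this]
    have "((\<lambda>s. G (p + s *\<^sub>R e) * expinv P (E (p + s *\<^sub>R e))) has_real_derivative
       G1 p * expinv P (E p) + (G p * E1 p) * expinv (expinv_deriv P) (E p)) (at 0)"
      by (simp add: algebra_simps)
    then have "((\<lambda>s. trunc b (\<lambda>p. G p * expinv P (E p)) (p + s *\<^sub>R e)) has_real_derivative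
       G1 p * expinv P (E p) + (G p * E1 p) * expinv (expinv_deriv P) (E p)) (at 0)"
    proof (rule has_field_derivative_transform_within_open[where S = "{s. \<bar>snd p + s * snd e\<bar> < b}"])
      show "open {s. \<bar>snd p + s * snd e\<bar> < b}" by (intro open_Collect_less continuous_intros)
    qed (use True in \<open>auto simp: trunc_def\<close>)
    then show ?thesis using True by (simp add: trunc_def)
  next
    case False
    have "((\<lambda>s. 0) has_real_derivative 0) (at 0)" by simp
    then have "((\<lambda>s. trunc b (\<lambda>p. G p * expinv P (E p)) (p + s *\<^sub>R e)) has_real_derivative 0) (at 0)"
    proof (rule has_field_derivative_transform_within_open[where S = "{s. a < \<bar>snd p + s * snd e\<bar>}"])
      show "open {s. a < \<bar>snd p + s * snd e\<bar>}" by (intro open_Collect_less continuous_intros)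
    qed (use False \<open>a < b\<close> E0 in \<open>auto simp: trunc_def\<close>)
    then show ?thesis using False by (simp add: trunc_def)
  qed
qed

lemma good_trunc:
  assumes "a < b" and E0: "\<And>p. a \<le> \<bar>snd p\<bar> \<Longrightarrow> \<bar>snd p\<bar> < b \<Longrightarrow> E p \<le> 0"
    and "continuous_on UNIV G" "per G" "continuous_on UNIV E" "per E"
  shows "good b (trunc b (\<lambda>p. G p * expinv P (E p)))"
proof -
  have "per (trunc b (\<lambda>p. G p * expinv P (E p)))" using assms(4,6) by (simp add: per_def trunc_def)
  moreover have "strip b (trunc b (\<lambda>p. G p * expinv P (E p)))" by (simp add: strip_def trunc_def)
  ultimately show ?thesis using trunc_continuous[OF assms(1) E0 assms(3,5)] by (simp add: good_def)
qed

lemma good_add: "good r w1 \<Longrightarrow> good r w2 \<Longrightarrow> good r (\<lambda>q. w1 q + w2 q)"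
  unfolding good_def per_def strip_def by (auto intro!: continuous_intros)

text \<open>One differentiation of the profile costs a factor \<open>\<Theta>\<close>: the gradient of the stream function is a
  convolution of the profile with the integrable kernel \<open>D\<close>.\<close>

lemma derivative_chain:
  assumes a: "a < b" and E0: "\<And>p. a \<le> \<bar>snd p\<bar> \<Longrightarrow> \<bar>snd p\<bar> < b \<Longrightarrow> E p \<le> 0"
    and D: "lker D" and KLD: "\<And>w r. good r w \<Longrightarrow> line_deriv e (conv KL w) (conv D w)"
    and W: "W = trunc b (\<lambda>p. 1 * expinv 1 (E p))" and E: "E = (\<lambda>p. Q p + \<mu> * conv KL W p)"
    and Qc: "continuous_on UNIV Q" "continuous_on UNIV Q1" "continuous_on UNIV Q2"
    and Qp: "per Q" "per Q1" "per Q2"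
    and Q: "line_deriv e Q Q1" "line_deriv e Q1 Q2" "line_deriv e Q2 (\<lambda>_. 0)"
    and Qb: "\<And>p. \<bar>snd p\<bar> < b \<Longrightarrow> \<bar>Q1 p\<bar> \<le> 2 * \<Theta>" "\<And>p. \<bar>snd p\<bar> < b \<Longrightarrow> \<bar>Q2 p\<bar> \<le> 2 * \<Theta>\<^sup>2"
    and cb: "\<And>V B p. good b V \<Longrightarrow> (\<And>q. \<bar>V q\<bar> \<le> B) \<Longrightarrow> \<bar>snd p\<bar> < b \<Longrightarrow> \<bar>\<mu> * conv D V p\<bar> \<le> G * \<Theta> * B"
    and H: "\<And>t. \<bar>expinv (expinv_deriv 1) t\<bar> \<le> H" "\<And>t. \<bar>expinv (expinv_deriv (expinv_deriv 1)) t\<bar> \<le> H"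
      "\<And>t. \<bar>expinv (expinv_deriv (expinv_deriv (expinv_deriv 1))) t\<bar> \<le> H"
    and pos: "0 \<le> G" "0 \<le> \<Theta>" "0 \<le> H" and Wg: "good b W" and W1: "\<And>p. \<bar>W p\<bar> \<le> 1"
    and Kdef: "K1 = 2 + G" "K3 = 2 + G * (H * K1)" "K5 = G * (H * (K3 + K1 * K1))"
  shows "\<exists>Wa Wb Wc. good b Wa \<and> good b Wb \<and> good b Wc \<and> line_deriv e W Wa \<and> line_deriv e Wa Wb \<and> line_deriv e Wb Wc \<and>
     (\<forall>p. \<bar>Wc p\<bar> \<le> H * (K5 + 3 * K1 * K3 + K1 * K1 * K1) * \<Theta> ^ 3)"
proof -
  let ?P1 = "expinv_deriv 1" let ?P2 = "expinv_deriv ?P1" let ?P3 = "expinv_deriv ?P2"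
  have K: "0 \<le> K1" "0 \<le> K3" "0 \<le> K5" unfolding Kdef using pos by simp_all
  have Ec: "continuous_on UNIV E" unfolding E using Qc(1) good_conv_continuous[OF lker_KL Wg] by (intro continuous_intros)
  have Ep: "per E" unfolding E using Qp(1) conv_per[of W KL] Wg by (simp add: per_def good_def)
  define E1 where "E1 = (\<lambda>p. Q1 p + \<mu> * conv D W p)"
  have E1: "line_deriv e E E1" unfolding E E1_def by (intro line_deriv_add line_deriv_cmult Q KLD[OF Wg])
  have E1c: "continuous_on UNIV E1" unfolding E1_def using Qc(2) good_conv_continuous[OF D Wg] by (intro continuous_intros)
  have E1p: "per E1" unfolding E1_def using Qp(2) conv_per[of W D] Wg by (simp add: per_def good_def)
  have E1b: "\<bar>E1 p\<bar> \<le> K1 * \<Theta>" if "\<bar>snd p\<bar> < b" for p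
    using Qb(1)[OF that] cb[OF Wg W1 that] unfolding E1_def Kdef by (simp add: algebra_simps)
  define Wa where "Wa = trunc b (\<lambda>p. E1 p * expinv ?P1 (E p))"
  have gt: "good b (trunc b (\<lambda>p. F p * expinv P (E p)))" if "continuous_on UNIV F" "per F" for F P
    by (rule good_trunc[OF a E0 that Ec Ep])
  have Wa: "good b Wa" unfolding Wa_def by (rule gt[OF E1c E1p])
  have z: "trunc b (\<lambda>p. 0 * f p) = (\<lambda>p. 0)" for f by (auto simp: trunc_def)
  have dWa: "line_deriv e W Wa"
  proof -
    have "line_deriv e (\<lambda>_. 1) (\<lambda>_. 0)" by (simp add: line_deriv_def)
    from line_deriv_trunc[OF a E0 this E1, where P = 1] show ?thesis unfolding W Wa_def z by simp
  qed
  have Wab: "\<bar>Wa p\<bar> \<le> H * K1 * \<Theta>" for p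
  proof (cases "\<bar>snd p\<bar> < b")
    case True
    have "\<bar>E1 p\<bar> * \<bar>expinv ?P1 (E p)\<bar> \<le> (K1 * \<Theta>) * H" using E1b[OF True] H(1) pos K by (intro mult_mono) auto
    then show ?thesis using True by (simp add: Wa_def trunc_def abs_mult mult_ac)
  qed (use pos K in \<open>simp add: Wa_def trunc_def\<close>)
  \<comment> \<open>The kernel is differentiated only once, in passing from \<open>E\<close> to
    \<open>E1\<close>. Further derivatives fall on the profile, so the bound \<open>cb\<close> for
    convolution with \<open>D\<close> applies again at each order.\<close>
  define E2 where "E2 = (\<lambda>p. Q2 p + \<mu> * conv D Wa p)"
  have E2: "line_deriv e E1 E2" unfolding E1_def E2_def by (intro line_deriv_add line_deriv_cmult Q line_deriv_conv[OF D Wg Wa dWa])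
  have E2c: "continuous_on UNIV E2" unfolding E2_def using Qc(3) good_conv_continuous[OF D Wa] by (intro continuous_intros)
  have E2p: "per E2" unfolding E2_def using Qp(3) conv_per[of Wa D] Wa by (simp add: per_def good_def)
  have E2b: "\<bar>E2 p\<bar> \<le> K3 * \<Theta>\<^sup>2" if "\<bar>snd p\<bar> < b" for p
    using Qb(2)[OF that] cb[OF Wa Wab that] unfolding E2_def Kdef by (simp add: algebra_simps power2_eq_square)
  define Wb where "Wb = (\<lambda>p. trunc b (\<lambda>p. E2 p * expinv ?P1 (E p)) p + trunc b (\<lambda>p. (E1 p * E1 p) * expinv ?P2 (E p)) p)"
  have E11: "continuous_on UNIV (\<lambda>p. E1 p * E1 p)" "per (\<lambda>p. E1 p * E1 p)"
    using E1c E1p by (auto intro!: continuous_intros simp: per_def)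
  have Wb: "good b Wb" unfolding Wb_def
    by (intro good_add gt[OF E2c E2p] gt[OF E11])
  have dWb: "line_deriv e Wa Wb" unfolding Wa_def Wb_def by (rule line_deriv_trunc[OF a E0 E2 E1])
  have Wbb: "\<bar>Wb p\<bar> \<le> H * (K3 + K1 * K1) * \<Theta>\<^sup>2" for p
  proof (cases "\<bar>snd p\<bar> < b")
    case True
    have "\<bar>E2 p\<bar> * \<bar>expinv ?P1 (E p)\<bar> \<le> (K3 * \<Theta>\<^sup>2) * H" using E2b[OF True] H(1) pos K by (intro mult_mono) auto
    moreover have "(\<bar>E1 p\<bar> * \<bar>E1 p\<bar>) * \<bar>expinv ?P2 (E p)\<bar> \<le> ((K1 * \<Theta>) * (K1 * \<Theta>)) * H"
      using E1b[OF True] H(2) pos K by (intro mult_mono) auto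
    ultimately have "\<bar>E2 p * expinv ?P1 (E p) + E1 p * E1 p * expinv ?P2 (E p)\<bar> \<le> (K3 * \<Theta>\<^sup>2) * H + ((K1 * \<Theta>) * (K1 * \<Theta>)) * H"
      by (intro order_trans[OF abs_triangle_ineq] add_mono) (simp_all add: abs_mult)
    then show ?thesis using True by (simp add: Wb_def trunc_def algebra_simps power2_eq_square)
  qed (use pos K in \<open>simp add: Wb_def trunc_def\<close>)
  define E3 where "E3 = (\<lambda>p. 0 + \<mu> * conv D Wb p)"
  have E3: "line_deriv e E2 E3" unfolding E2_def E3_def by (intro line_deriv_add line_deriv_cmult Q line_deriv_conv[OF D Wa Wb dWb])
  have E3c: "continuous_on UNIV E3" unfolding E3_def using good_conv_continuous[OF D Wb] by (intro continuous_intros)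
  have E3p: "per E3" unfolding E3_def using conv_per[of Wb D] Wb by (simp add: per_def good_def)
  have E3b: "\<bar>E3 p\<bar> \<le> K5 * \<Theta> ^ 3" if "\<bar>snd p\<bar> < b" for p
    using cb[OF Wb Wbb that] unfolding E3_def Kdef(3) by (simp add: algebra_simps power2_eq_square power3_eq_cube)
  define Wc where "Wc = (\<lambda>p. (trunc b (\<lambda>p. E3 p * expinv ?P1 (E p)) p + trunc b (\<lambda>p. (E2 p * E1 p) * expinv ?P2 (E p)) p)
     + (trunc b (\<lambda>p. (E2 p * E1 p + E1 p * E2 p) * expinv ?P2 (E p)) p + trunc b (\<lambda>p. ((E1 p * E1 p) * E1 p) * expinv ?P3 (E p)) p))"
  have e21: "continuous_on UNIV (\<lambda>p. E2 p * E1 p)" "per (\<lambda>p. E2 p * E1 p)"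
    and e212: "continuous_on UNIV (\<lambda>p. E2 p * E1 p + E1 p * E2 p)" "per (\<lambda>p. E2 p * E1 p + E1 p * E2 p)"
    and e111: "continuous_on UNIV (\<lambda>p. (E1 p * E1 p) * E1 p)" "per (\<lambda>p. (E1 p * E1 p) * E1 p)"
    using E1c E1p E2c E2p by (auto intro!: continuous_intros simp: per_def)
  have Wc: "good b Wc" unfolding Wc_def
    by (intro good_add gt[OF E3c E3p] gt[OF e21] gt[OF e212] gt[OF e111])
  have dWc: "line_deriv e Wb Wc" unfolding Wb_def Wc_def
    by (intro line_deriv_add line_deriv_trunc[OF a E0 E3 E1] line_deriv_trunc[OF a E0 line_deriv_mult[OF E2 E2] E1])
  have Wcb: "\<bar>Wc p\<bar> \<le> H * (K5 + 3 * K1 * K3 + K1 * K1 * K1) * \<Theta> ^ 3" for p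
  proof (cases "\<bar>snd p\<bar> < b")
    case True
    have 1: "\<bar>E3 p * expinv ?P1 (E p)\<bar> \<le> (K5 * \<Theta> ^ 3) * H" unfolding abs_mult using E3b[OF True] H(1) pos K by (intro mult_mono) auto
    have 2: "\<bar>(E2 p * E1 p) * expinv ?P2 (E p)\<bar> \<le> ((K3 * \<Theta>\<^sup>2) * (K1 * \<Theta>)) * H"
      unfolding abs_mult using E1b[OF True] E2b[OF True] H(2) pos K by (intro mult_mono) auto
    have 3: "\<bar>((E1 p * E1 p) * E1 p) * expinv ?P3 (E p)\<bar> \<le> (((K1 * \<Theta>) * (K1 * \<Theta>)) * (K1 * \<Theta>)) * H"
      unfolding abs_mult using E1b[OF True] H(3) pos K by (intro mult_mono) auto
    have "Wc p = E3 p * expinv ?P1 (E p) + 3 * ((E2 p * E1 p) * expinv ?P2 (E p)) + ((E1 p * E1 p) * E1 p) * expinv ?P3 (E p)"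
      using True by (simp add: Wc_def trunc_def algebra_simps)
    then have "\<bar>Wc p\<bar> \<le> (K5 * \<Theta> ^ 3) * H + 3 * (((K3 * \<Theta>\<^sup>2) * (K1 * \<Theta>)) * H) + (((K1 * \<Theta>) * (K1 * \<Theta>)) * (K1 * \<Theta>)) * H"
      using 1 2 3 by linarith
    then show ?thesis by (simp add: algebra_simps power2_eq_square power3_eq_cube)
  qed (use pos K in \<open>simp add: Wc_def trunc_def\<close>)
  show ?thesis using Wa Wb Wc dWa dWb dWc Wcb by blast
qed

text \<open>Both p and the support of V lie in the layer, so |v| <= 4 \<delta> and the integral of
  |v| powr (-\<eta>) is of order \<delta> powr (1 - \<eta>). The prefactor \<nu>/\<delta> turns this
  into the cost \<delta> powr (-\<eta>) of an x-derivative.\<close>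

lemma conv_KX_bound:
  assumes \<delta>: "0 < \<delta>" and \<eta>: "0 < \<eta>" "\<eta> < 1" and V: "strip (2 * \<delta>) V" "\<And>q. \<bar>V q\<bar> \<le> B" and p: "\<bar>snd p\<bar> < 2 * \<delta>"
  shows "\<bar>conv KX V p\<bar> \<le> (16 * (2 * pi powr \<eta> / \<eta>)) * (2 * (4 * \<delta>) powr (1 - \<eta>) / (1 - \<eta>) * B)"
proof -
  have B: "0 \<le> B" using V(2)[of 0] by linarith
  have k: "has_bochner_integral lborel (\<lambda>u::real. 16 * (indicator {-pi..pi} u * \<bar>u\<bar> powr (\<eta> - 1))) (16 * (2 * pi powr \<eta> / \<eta>))"
    using has_bochner_integral_mult_right[OF integrable_powr_symmetric[of "\<eta> - 1" pi], of 16] \<eta> by simp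
  have m: "has_bochner_integral lborel (\<lambda>v::real. (indicator {-(4*\<delta>)..4*\<delta>} v * \<bar>v\<bar> powr (- \<eta>)) * B) (2 * (4 * \<delta>) powr (1 - \<eta>) / (1 - \<eta>) * B)"
    using has_bochner_integral_mult_left[OF integrable_powr_symmetric[of "- \<eta>" "4 * \<delta>"], of B] \<eta> \<delta> by simp
  have "\<bar>conv KX V p\<bar> \<le> (LINT u|lborel. 16 * (indicator {-pi..pi} u * \<bar>u\<bar> powr (\<eta> - 1))) *
      (LINT v|lborel. (indicator {-(4*\<delta>)..4*\<delta>} v * \<bar>v\<bar> powr (- \<eta>)) * B)"
  proof (rule conv_bound)
    show "AE q in lborel. fst q \<in> {-pi..<pi} \<longrightarrow> \<bar>KX q * V (p - q)\<bar> \<le>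
      16 * (indicator {-pi..pi} (fst q) * \<bar>fst q\<bar> powr (\<eta> - 1)) * ((indicator {-(4*\<delta>)..4*\<delta>} (snd q) * \<bar>snd q\<bar> powr (- \<eta>)) * B)"
      using AE_lborel_snd_neq[of 0]
    proof eventually_elim
      case (elim q)
      show ?case
      proof
        assume q: "fst q \<in> {-pi..<pi}"
        then have q': "\<bar>fst q\<bar> \<le> pi" by auto
        show "\<bar>KX q * V (p - q)\<bar> \<le>
           16 * (indicator {-pi..pi} (fst q) * \<bar>fst q\<bar> powr (\<eta> - 1)) * ((indicator {-(4*\<delta>)..4*\<delta>} (snd q) * \<bar>snd q\<bar> powr (- \<eta>)) * B)"
        proof (cases "\<bar>snd q\<bar> \<le> 4 * \<delta>")
          case True
          have "\<bar>KX q\<bar> * \<bar>V (p - q)\<bar> \<le> (16 * (\<bar>fst q\<bar> powr (\<eta> - 1) * \<bar>snd q\<bar> powr (- \<eta>))) * B"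
            using kernel_x_le[OF q' elim \<eta>] V(2) unfolding KX_def by (intro mult_mono) auto
          moreover have "snd q \<in> {-(4*\<delta>)..4*\<delta>}" using True by auto
          ultimately show ?thesis using q by (simp add: abs_mult)
        next
          case False
          then have "2 * \<delta> < \<bar>snd (p - q)\<bar>" using p by auto
          then have "V (p - q) = 0" using V(1) unfolding strip_def by blast
          then show ?thesis using B by simp
        qed
      qed
    qed
  qed (use k m B in \<open>auto simp: has_bochner_integral_iff\<close>)
  then show ?thesis using k m by (simp add: has_bochner_integral_iff)
qed

text \<open>The symmetric exponent 1/2 is good enough: the term y^2 / (2 \<delta>^2) already makes a
  y-derivative cost 1/\<delta>, more than the stream function contributes.\<close>

lemma conv_KY_bound:
  assumes \<delta>: "0 < \<delta>" "\<delta> \<le> 1/4" and V: "strip (2 * \<delta>) V" "\<And>q. \<bar>V q\<bar> \<le> B" and p: "\<bar>snd p\<bar> < 2 * \<delta>"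
  shows "\<bar>conv KY V p\<bar> \<le> 1024 * cosh 1 * sqrt \<delta> * B"
proof -
  have B: "0 \<le> B" using V(2)[of 0] by linarith
  have k: "has_bochner_integral lborel (\<lambda>u::real. 16 * cosh 1 * (indicator {-pi..pi} u * \<bar>u\<bar> powr (- (1/2)))) (16 * cosh 1 * (4 * sqrt pi))"
    using has_bochner_integral_mult_right[OF integrable_powr_symmetric[of "- (1/2)" pi], of "16 * cosh 1"] by (simp add: powr_half_sqrt)
  have m: "has_bochner_integral lborel (\<lambda>v::real. (indicator {-(4*\<delta>)..4*\<delta>} v * \<bar>v\<bar> powr (- (1/2))) * B) (8 * sqrt \<delta> * B)"
    using has_bochner_integral_mult_left[OF integrable_powr_symmetric[of "- (1/2)" "4 * \<delta>"], of B] \<delta>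
    by (simp add: powr_half_sqrt real_sqrt_mult)
  have "\<bar>conv KY V p\<bar> \<le> (LINT u|lborel. 16 * cosh 1 * (indicator {-pi..pi} u * \<bar>u\<bar> powr (- (1/2)))) *
      (LINT v|lborel. (indicator {-(4*\<delta>)..4*\<delta>} v * \<bar>v\<bar> powr (- (1/2))) * B)"
  proof (rule conv_bound)
    show "AE q in lborel. fst q \<in> {-pi..<pi} \<longrightarrow> \<bar>KY q * V (p - q)\<bar> \<le>
      16 * cosh 1 * (indicator {-pi..pi} (fst q) * \<bar>fst q\<bar> powr (- (1/2))) * ((indicator {-(4*\<delta>)..4*\<delta>} (snd q) * \<bar>snd q\<bar> powr (- (1/2))) * B)"
      using AE_fst_neq[of 0]
    proof eventually_elim
      case (elim q)
      show ?case
      proof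
        assume q: "fst q \<in> {-pi..<pi}"
        then have q': "\<bar>fst q\<bar> \<le> pi" by auto
        show "\<bar>KY q * V (p - q)\<bar> \<le>
           16 * cosh 1 * (indicator {-pi..pi} (fst q) * \<bar>fst q\<bar> powr (- (1/2))) * ((indicator {-(4*\<delta>)..4*\<delta>} (snd q) * \<bar>snd q\<bar> powr (- (1/2))) * B)"
        proof (cases "\<bar>snd q\<bar> \<le> 4 * \<delta>")
          case True
          then have "\<bar>snd q\<bar> \<le> 1" using \<delta> by linarith
          from kernel_y_le[OF q' elim this, of "1/2"]
          have "\<bar>KY q\<bar> \<le> 16 * cosh 1 * (\<bar>fst q\<bar> powr (- (1/2)) * \<bar>snd q\<bar> powr (- (1/2)))" by (simp add: KY_def)
          then have "\<bar>KY q\<bar> * \<bar>V (p - q)\<bar> \<le> (16 * cosh 1 * (\<bar>fst q\<bar> powr (- (1/2)) * \<bar>snd q\<bar> powr (- (1/2)))) * B"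
            using V(2) by (intro mult_mono) auto
          moreover have "snd q \<in> {-(4*\<delta>)..4*\<delta>}" using True by auto
          ultimately show ?thesis using q by (simp add: abs_mult mult_ac)
        next
          case False
          then have "2 * \<delta> < \<bar>snd (p - q)\<bar>" using p by auto
          then have "V (p - q) = 0" using V(1) unfolding strip_def by blast
          then show ?thesis using B by simp
        qed
      qed
    qed
  qed (use k m B in \<open>auto simp: has_bochner_integral_iff\<close>)
  also have "\<dots> = 16 * cosh 1 * (4 * sqrt pi) * (8 * sqrt \<delta> * B)" using k m by (simp add: has_bochner_integral_iff)
  also have "\<dots> \<le> 16 * cosh 1 * (4 * 2) * (8 * sqrt \<delta> * B)"
  proof -
    have "sqrt pi \<le> 2" using pi_less_4 by (intro real_le_lsqrt) auto
    then show ?thesis using \<delta> B by (intro mult_right_mono mult_left_mono) auto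
  qed
  finally show ?thesis by (simp add: mult_ac)
qed

lemma line_deriv_conv_KL_x: assumes "good r w" shows "line_deriv (1, 0) (conv KL w) (conv KX w)"
  using line_deriv_of_has_derivative[OF conv_KL_has_derivative[OF assms], of "(1, 0)"] by simp

lemma line_deriv_conv_KL_y: assumes "good r w" shows "line_deriv (0, 1) (conv KL w) (conv KY w)"
  using line_deriv_of_has_derivative[OF conv_KL_has_derivative[OF assms], of "(0, 1)"] by simp

text \<open>\<phi> equals the stream function only inside the layer and is merely continuous
  outside. \<open>E\<close> uses the stream function everywhere, and truncation restores equality
  with the profile. For |y| >= 9/5 \<delta> one has y^2 / (2 \<delta>^2) >= 81/50 > 3/2 >= 1 +
  \<phi>, so \<open>E\<close> is nonpositive before the edge.\<close>

lemma profile_eq_trunc: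
  assumes \<delta>: "0 < \<delta>" and \<phi>: "admissible \<phi>" and eq: "\<And>p. \<bar>snd p\<bar> \<le> 2 * \<delta> \<Longrightarrow> \<phi> p = \<mu> * conv KL (profile \<delta> \<phi>) p + c"
    and E: "E = (\<lambda>p. (1 - (snd p)\<^sup>2 / (2 * \<delta>\<^sup>2) + c) + \<mu> * conv KL (profile \<delta> \<phi>) p)"
  shows "profile \<delta> \<phi> = trunc (2 * \<delta>) (\<lambda>p. 1 * expinv 1 (E p))"
    and "\<And>p. 9/5 * \<delta> \<le> \<bar>snd p\<bar> \<Longrightarrow> \<bar>snd p\<bar> < 2 * \<delta> \<Longrightarrow> E p \<le> 0"
proof -
  have Eq: "E p = 1 - (snd p)\<^sup>2 / (2 * \<delta>\<^sup>2) + \<phi> p" if "\<bar>snd p\<bar> \<le> 2 * \<delta>" for p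
    unfolding E using eq[OF that] by simp
  have b: "\<bar>\<phi> p\<bar> \<le> 1/2" for p using \<phi> unfolding admissible_def by blast
  have big: "E' \<le> 0" if "9/5 * \<delta> \<le> \<bar>snd p\<bar>" "E' = 1 - (snd p)\<^sup>2 / (2 * \<delta>\<^sup>2) + \<phi> p" for E' p
  proof -
    have "(9/5 * \<delta>)\<^sup>2 \<le> \<bar>snd p\<bar>\<^sup>2" using that \<delta> by (intro power_mono) auto
    then have "81/50 \<le> (snd p)\<^sup>2 / (2 * \<delta>\<^sup>2)" using \<delta> by (subst pos_le_divide_eq) (auto simp: power_mult_distrib power_divide)
    then show ?thesis using b[of p] that(2) by linarith
  qed
  show "\<And>p. 9/5 * \<delta> \<le> \<bar>snd p\<bar> \<Longrightarrow> \<bar>snd p\<bar> < 2 * \<delta> \<Longrightarrow> E p \<le> 0" using big Eq by simp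
  show "profile \<delta> \<phi> = trunc (2 * \<delta>) (\<lambda>p. 1 * expinv 1 (E p))"
  proof
    fix p
    show "profile \<delta> \<phi> p = trunc (2 * \<delta>) (\<lambda>p. 1 * expinv 1 (E p)) p"
    proof (cases "\<bar>snd p\<bar> < 2 * \<delta>")
      case True then show ?thesis using Eq[of p] by (simp add: trunc_def profile_def)
    next
      case False
      then have "9/5 * \<delta> \<le> \<bar>snd p\<bar>" using \<delta> by linarith
      then have "profile \<delta> \<phi> p = 0" unfolding profile_def using big by (intro expinv_nonpos) blast
      then show ?thesis using False by (simp add: trunc_def)
    qed
  qed
qed

text \<open>Bootstrap: if the profile has n derivatives, its logarithmic potential has n + 1, and
  the profile is a smooth function of that potential and of y.\<close>

lemma profile_Ck:
  assumes \<delta>: "0 < \<delta>" and \<phi>: "admissible \<phi>" and eq: "\<And>p. \<bar>snd p\<bar> \<le> 2 * \<delta> \<Longrightarrow> \<phi> p = \<mu> * conv KL (profile \<delta> \<phi>) p + c"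
  shows "Ck n (profile \<delta> \<phi>)"
proof (induction n)
  case 0
  then show ?case using profile_good[OF \<delta> \<phi>] by (simp add: good_def)
next
  case (Suc n)
  define E where "E = (\<lambda>p. (1 - (snd p)\<^sup>2 / (2 * \<delta>\<^sup>2) + c) + \<mu> * conv KL (profile \<delta> \<phi>) p)"
  note t = profile_eq_trunc[OF \<delta> \<phi> eq E_def]
  have "Ck (Suc n) (\<lambda>p. ((1 + c) + (- 1 / (2 * \<delta>\<^sup>2)) * (snd p * snd p)) + \<mu> * conv KL (profile \<delta> \<phi>) p)"
    by (intro Ck_add Ck_mult Ck_const Ck_snd Ck_Suc_conv_KL[OF profile_good[OF \<delta> \<phi>] Suc])
  then have "Ck (Suc n) E" by (simp add: E_def power2_eq_square algebra_simps)
  then have "Ck (Suc n) (trunc (2 * \<delta>) (\<lambda>p. 1 * expinv 1 (E p)))"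
    by (intro Ck_trunc[where a = "9/5 * \<delta>", OF _ t(2) Ck_const]) (use \<delta> in \<open>simp_all del: Ck.simps\<close>)
  then show ?case using t(1) by simp
qed

text \<open>One constant K serves all \<delta>, \<phi> and \<nu>. In the x direction the quadratic
  term drops out of \<open>E\<close>, which leaves \<Theta> = \<delta> powr (-\<eta>); in the y
  direction it dictates \<Theta> = 1/\<delta>.\<close>

lemma profile_derivative_bounds:
  assumes \<eta>: "0 < \<eta>" "\<eta> < 1"
  obtains K where "0 < K"
    "\<And>\<delta> \<phi> \<nu> c. 0 < \<delta> \<Longrightarrow> \<delta> \<le> 1/4 \<Longrightarrow> admissible \<phi> \<Longrightarrow> 0 < \<nu> \<Longrightarrow> \<nu> \<le> 1 / bump_mass \<Longrightarrow>
       (\<And>p. \<bar>snd p\<bar> \<le> 2 * \<delta> \<Longrightarrow> \<phi> p = - (\<nu> / \<delta>) * conv KL (profile \<delta> \<phi>) p + c) \<Longrightarrow>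
       (\<exists>Wa Wb Wc. good (2 * \<delta>) Wa \<and> good (2 * \<delta>) Wb \<and> good (2 * \<delta>) Wc \<and> line_deriv (1, 0) (profile \<delta> \<phi>) Wa \<and> line_deriv (1, 0) Wa Wb \<and> line_deriv (1, 0) Wb Wc \<and>
          (\<forall>p. \<bar>Wc p\<bar> \<le> K * (\<delta> powr (- \<eta>)) ^ 3)) \<and>
       (\<exists>Wa Wb Wc. good (2 * \<delta>) Wa \<and> good (2 * \<delta>) Wb \<and> good (2 * \<delta>) Wc \<and> line_deriv (0, 1) (profile \<delta> \<phi>) Wa \<and> line_deriv (0, 1) Wa Wb \<and> line_deriv (0, 1) Wb Wc \<and>
          (\<forall>p. \<bar>Wc p\<bar> \<le> K * (1 / \<delta>) ^ 3))"
proof -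
  let ?P1 = "expinv_deriv 1" let ?P2 = "expinv_deriv ?P1" let ?P3 = "expinv_deriv ?P2"
  obtain H1 where H1: "H1 > 0" "\<And>t. \<bar>expinv ?P1 t\<bar> \<le> H1" using expinv_bounded[of ?P1] by auto
  obtain H2 where H2: "H2 > 0" "\<And>t. \<bar>expinv ?P2 t\<bar> \<le> H2" using expinv_bounded[of ?P2] by auto
  obtain H3 where H3: "H3 > 0" "\<And>t. \<bar>expinv ?P3 t\<bar> \<le> H3" using expinv_bounded[of ?P3] by auto
  define H where "H = H1 + H2 + H3"
  have H: "\<And>t. \<bar>expinv ?P1 t\<bar> \<le> H" "\<And>t. \<bar>expinv ?P2 t\<bar> \<le> H" "\<And>t. \<bar>expinv ?P3 t\<bar> \<le> H" "0 < H"
  proof -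
    show "\<bar>expinv ?P1 t\<bar> \<le> H" for t using H1(2)[of t] H2(1) H3(1) by (simp add: H_def)
    show "\<bar>expinv ?P2 t\<bar> \<le> H" for t using H2(2)[of t] H1(1) H3(1) by (simp add: H_def)
    show "\<bar>expinv ?P3 t\<bar> \<le> H" for t using H3(2)[of t] H2(1) H1(1) by (simp add: H_def)
    show "0 < H" using H1(1) H2(1) H3(1) by (simp add: H_def)
  qed
  define Gx where "Gx = (1 / bump_mass) * ((16 * (2 * pi powr \<eta> / \<eta>)) * (8 / (1 - \<eta>)))"
  define Gy where "Gy = (1 / bump_mass) * (1024 * cosh 1)"
  define G where "G = Gx + Gy"
  have G: "0 \<le> Gx" "0 \<le> Gy" unfolding Gx_def Gy_def using bump_mass_pos \<eta> by auto
  then have G0: "0 \<le> G" by (simp add: G_def)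
  define K1 where "K1 = 2 + G"
  define K3 where "K3 = 2 + G * (H * K1)"
  define K5 where "K5 = G * (H * (K3 + K1 * K1))"
  have Kp: "0 < K1" "0 < K3" "0 \<le> K5" unfolding K1_def K3_def K5_def using G0 H(4) by (auto intro!: add_pos_nonneg mult_nonneg_nonneg add_nonneg_nonneg)
  define K where "K = H * (K5 + 3 * K1 * K3 + K1 * K1 * K1)"
  show thesis
  proof (rule that[of K])
    show "0 < K" unfolding K_def using Kp H(4) by (intro mult_pos_pos add_nonneg_pos add_nonneg_nonneg) auto
    fix \<delta> \<phi> \<nu> c
    assume \<delta>: "0 < \<delta>" "\<delta> \<le> 1/4" and \<phi>: "admissible \<phi>" and \<nu>: "0 < \<nu>" "\<nu> \<le> 1 / bump_mass"
      and eq: "\<And>p. \<bar>snd p\<bar> \<le> 2 * \<delta> \<Longrightarrow> \<phi> p = - (\<nu> / \<delta>) * conv KL (profile \<delta> \<phi>) p + c"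
    define Q where "Q = (\<lambda>p::real\<times>real. 1 - (snd p)\<^sup>2 / (2 * \<delta>\<^sup>2) + c)"
    define E where "E = (\<lambda>p. (1 - (snd p)\<^sup>2 / (2 * \<delta>\<^sup>2) + c) + (- (\<nu> / \<delta>)) * conv KL (profile \<delta> \<phi>) p)"
    have EQ: "E = (\<lambda>p. Q p + (- (\<nu> / \<delta>)) * conv KL (profile \<delta> \<phi>) p)" by (simp add: E_def Q_def)
    note t = profile_eq_trunc[OF \<delta>(1) \<phi> eq E_def]
    have ab: "9/5 * \<delta> < 2 * \<delta>" using \<delta> by simp
    note Wg = profile_good[OF \<delta>(1) \<phi>]
    have Qc: "continuous_on UNIV Q" unfolding Q_def using \<delta> by (intro continuous_intros) auto
    have Qp: "per Q" by (simp add: per_def Q_def)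
    have \<nu>\<delta>: "0 \<le> \<nu> / \<delta>" "\<nu> / \<delta> \<le> (1 / bump_mass) / \<delta>" using \<nu>(1) \<delta> divide_right_mono[OF \<nu>(2), of \<delta>] by simp_all
    have x: "\<exists>Wa Wb Wc. good (2 * \<delta>) Wa \<and> good (2 * \<delta>) Wb \<and> good (2 * \<delta>) Wc \<and> line_deriv (1, 0) (profile \<delta> \<phi>) Wa \<and> line_deriv (1, 0) Wa Wb \<and> line_deriv (1, 0) Wb Wc \<and>
          (\<forall>p. \<bar>Wc p\<bar> \<le> H * (K5 + 3 * K1 * K3 + K1 * K1 * K1) * (\<delta> powr (- \<eta>)) ^ 3)"
    proof (rule derivative_chain[where D = KX and Q = Q and ?Q1.0 = "\<lambda>_. 0" and ?Q2.0 = "\<lambda>_. 0" and \<mu> = "- (\<nu> / \<delta>)",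
          OF ab t(2) lker_KX line_deriv_conv_KL_x t(1) EQ Qc _ _ Qp])
      show "line_deriv (1, 0) Q (\<lambda>_. 0)" by (simp add: line_deriv_def Q_def)
      fix V and B :: real and p :: "real \<times> real" assume V: "good (2 * \<delta>) V" "\<And>q. \<bar>V q\<bar> \<le> B" "\<bar>snd p\<bar> < 2 * \<delta>"
      have B: "0 \<le> B" using V(2)[of 0] by linarith
      have pw: "(4 * \<delta>) powr (1 - \<eta>) \<le> 4 * (\<delta> * \<delta> powr (- \<eta>))"
      proof -
        have "(4 * \<delta>) powr (1 - \<eta>) = 4 powr (1 - \<eta>) * \<delta> powr (1 - \<eta>)" using \<delta> by (simp add: powr_mult)
        also have "\<dots> \<le> 4 powr 1 * \<delta> powr (1 - \<eta>)"
        proof (rule mult_right_mono)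
          show "(4::real) powr (1 - \<eta>) \<le> 4 powr 1" using \<eta> by (intro powr_mono) auto
        qed simp
        also have "1 - \<eta> = 1 + - \<eta>" by simp
        also have "\<delta> powr (1 + - \<eta>) = \<delta> * \<delta> powr (- \<eta>)" using \<delta> by (subst powr_add) simp
        finally show ?thesis by simp
      qed
      have "\<bar>conv KX V p\<bar> \<le> (16 * (2 * pi powr \<eta> / \<eta>)) * (2 * (4 * \<delta>) powr (1 - \<eta>) / (1 - \<eta>) * B)"
        by (rule conv_KX_bound[OF \<delta>(1) \<eta> _ V(2,3)]) (use V(1) in \<open>simp add: good_def\<close>)
      also have "\<dots> \<le> (16 * (2 * pi powr \<eta> / \<eta>)) * (2 * (4 * (\<delta> * \<delta> powr (- \<eta>))) / (1 - \<eta>) * B)"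
        using \<eta> B by (intro mult_left_mono mult_right_mono divide_right_mono pw) auto
      finally have cKX: "\<bar>conv KX V p\<bar> \<le> (16 * (2 * pi powr \<eta> / \<eta>)) * (2 * (4 * (\<delta> * \<delta> powr (- \<eta>))) / (1 - \<eta>) * B)" .
      have "\<bar>- (\<nu> / \<delta>) * conv KX V p\<bar> = (\<nu> / \<delta>) * \<bar>conv KX V p\<bar>" using \<nu>(1) \<delta>(1) by (simp add: abs_mult)
      also have "\<dots> \<le> ((1 / bump_mass) / \<delta>) * ((16 * (2 * pi powr \<eta> / \<eta>)) * (2 * (4 * (\<delta> * \<delta> powr (- \<eta>))) / (1 - \<eta>) * B))"
        using \<nu>\<delta> bump_mass_pos \<delta> by (intro mult_mono cKX) auto
      also have "\<dots> = Gx * \<delta> powr (- \<eta>) * B" unfolding Gx_def using \<delta> by (simp add: field_simps)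
      also have "\<dots> \<le> G * \<delta> powr (- \<eta>) * B" unfolding G_def using G B by (intro mult_right_mono) auto
      finally show "\<bar>- (\<nu> / \<delta>) * conv KX V p\<bar> \<le> G * \<delta> powr (- \<eta>) * B" .
    qed (use H G0 Wg profile_bounds K1_def K3_def K5_def in \<open>auto simp: per_def line_deriv_def\<close>)
    have y: "\<exists>Wa Wb Wc. good (2 * \<delta>) Wa \<and> good (2 * \<delta>) Wb \<and> good (2 * \<delta>) Wc \<and> line_deriv (0, 1) (profile \<delta> \<phi>) Wa \<and> line_deriv (0, 1) Wa Wb \<and> line_deriv (0, 1) Wb Wc \<and>
          (\<forall>p. \<bar>Wc p\<bar> \<le> H * (K5 + 3 * K1 * K3 + K1 * K1 * K1) * (1 / \<delta>) ^ 3)"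
    proof (rule derivative_chain[where D = KY and Q = Q and ?Q1.0 = "\<lambda>p. - snd p / \<delta>\<^sup>2" and ?Q2.0 = "\<lambda>_. - 1 / \<delta>\<^sup>2" and \<mu> = "- (\<nu> / \<delta>)",
          OF ab t(2) lker_KY line_deriv_conv_KL_y t(1) EQ Qc _ _ Qp])
      show "continuous_on UNIV (\<lambda>p::real\<times>real. - snd p / \<delta>\<^sup>2)" using \<delta> by (intro continuous_intros) auto
      show "line_deriv (0, 1) Q (\<lambda>p. - snd p / \<delta>\<^sup>2)" unfolding line_deriv_def Q_def using \<delta>
        by (auto intro!: derivative_eq_intros simp: field_simps)
      show "line_deriv (0, 1) (\<lambda>p. - snd p / \<delta>\<^sup>2) (\<lambda>_. - 1 / \<delta>\<^sup>2)" unfolding line_deriv_def using \<delta>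
        by (auto intro!: derivative_eq_intros simp: field_simps)
      show "\<bar>- snd p / \<delta>\<^sup>2\<bar> \<le> 2 * (1 / \<delta>)" if "\<bar>snd p\<bar> < 2 * \<delta>" for p :: "real \<times> real"
      proof -
        have "\<bar>- snd p / \<delta>\<^sup>2\<bar> = \<bar>snd p\<bar> / \<delta>\<^sup>2" by simp
        also have "\<dots> \<le> (2 * \<delta>) / \<delta>\<^sup>2" using that by (intro divide_right_mono) auto
        also have "\<dots> = 2 * (1 / \<delta>)" using \<delta> by (simp add: power2_eq_square)
        finally show ?thesis .
      qed
      show "\<bar>- 1 / \<delta>\<^sup>2\<bar> \<le> 2 * (1 / \<delta>)\<^sup>2" using \<delta> by (simp add: power_divide divide_right_mono)
      fix V and B :: real and p :: "real \<times> real" assume V: "good (2 * \<delta>) V" "\<And>q. \<bar>V q\<bar> \<le> B" "\<bar>snd p\<bar> < 2 * \<delta>"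
      have B: "0 \<le> B" using V(2)[of 0] by linarith
      have "\<bar>conv KY V p\<bar> \<le> 1024 * cosh 1 * sqrt \<delta> * B"
        by (rule conv_KY_bound[OF \<delta> _ V(2,3)]) (use V(1) in \<open>simp add: good_def\<close>)
      also have "\<dots> \<le> 1024 * cosh 1 * 1 * B" using \<delta> B by (intro mult_right_mono mult_left_mono) auto
      finally have cKY: "\<bar>conv KY V p\<bar> \<le> 1024 * cosh 1 * B" by simp
      have "\<bar>- (\<nu> / \<delta>) * conv KY V p\<bar> = (\<nu> / \<delta>) * \<bar>conv KY V p\<bar>" using \<nu>(1) \<delta>(1) by (simp add: abs_mult)
      also have "\<dots> \<le> ((1 / bump_mass) / \<delta>) * (1024 * cosh 1 * B)"
        using \<nu>\<delta> bump_mass_pos \<delta> by (intro mult_mono cKY) auto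
      also have "\<dots> = Gy * (1 / \<delta>) * B" unfolding Gy_def by simp
      also have "\<dots> \<le> G * (1 / \<delta>) * B" unfolding G_def using G B \<delta> by (intro mult_right_mono) auto
      finally show "\<bar>- (\<nu> / \<delta>) * conv KY V p\<bar> \<le> G * (1 / \<delta>) * B" .
    qed (use H G0 Wg profile_bounds K1_def K3_def K5_def \<delta> in \<open>auto simp: per_def line_deriv_def\<close>)
    show "(\<exists>Wa Wb Wc. good (2 * \<delta>) Wa \<and> good (2 * \<delta>) Wb \<and> good (2 * \<delta>) Wc \<and> line_deriv (1, 0) (profile \<delta> \<phi>) Wa \<and> line_deriv (1, 0) Wa Wb \<and> line_deriv (1, 0) Wb Wc \<and>
          (\<forall>p. \<bar>Wc p\<bar> \<le> K * (\<delta> powr (- \<eta>)) ^ 3)) \<and>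
       (\<exists>Wa Wb Wc. good (2 * \<delta>) Wa \<and> good (2 * \<delta>) Wb \<and> good (2 * \<delta>) Wc \<and> line_deriv (0, 1) (profile \<delta> \<phi>) Wa \<and> line_deriv (0, 1) Wa Wb \<and> line_deriv (0, 1) Wb Wc \<and>
          (\<forall>p. \<bar>Wc p\<bar> \<le> K * (1 / \<delta>) ^ 3))" using x y unfolding K_def by blast
  qed
qed

section \<open>Fourier transform and Sobolev norm\<close>

text \<open>The travelling wave lives around height -1. Recording the centre m keeps the half-width
  of the strip at 2 \<delta>, and that width supplies a power of \<delta> in the Fourier
  bounds.\<close>

definition good_at :: "real \<Rightarrow> real \<Rightarrow> (real \<times> real \<Rightarrow> real) \<Rightarrow> bool" where
  "good_at m r F \<longleftrightarrow> per F \<and> (\<forall>p. r < \<bar>snd p - m\<bar> \<longrightarrow> F p = 0) \<and> continuous_on UNIV F"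

abbreviation fint :: "(real \<times> real \<Rightarrow> real) \<Rightarrow> int \<Rightarrow> real \<Rightarrow> real \<times> real \<Rightarrow> complex" where
  "fint F k \<xi> p \<equiv> complex_of_real (F p) * cis (- (real_of_int k * fst p + \<xi> * snd p))"

lemma fint_continuous: "continuous_on UNIV F \<Longrightarrow> continuous_on A (fint F k \<xi>)"
  by (intro continuous_intros continuous_on_subset[of UNIV F A]) auto

lemma fourier_box:
  assumes F: "good_at m r F" and "r \<le> R"
  shows "fourier_Txr (\<lambda>x y. F (x, y)) k \<xi> = integral (cbox (0, m - R) (2 * pi, m + R)) (fint F k \<xi>)"
proof -
  have "fourier_Txr (\<lambda>x y. F (x, y)) k \<xi> = integral ({0..2*pi} \<times> UNIV) (fint F k \<xi>)"
    unfolding fourier_Txr_def by (simp add: case_prod_beta')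
  also have "\<dots> = integral UNIV (\<lambda>p. if p \<in> {0..2*pi} \<times> UNIV then fint F k \<xi> p else 0)"
    by (simp only: integral_restrict_UNIV)
  also have "(\<lambda>p. if p \<in> {0..2*pi} \<times> UNIV then fint F k \<xi> p else 0) =
      (\<lambda>p. if p \<in> cbox (0, m - R) (2 * pi, m + R) then fint F k \<xi> p else 0)"
  proof
    fix p :: "real \<times> real"
    show "(if p \<in> {0..2*pi} \<times> UNIV then fint F k \<xi> p else 0) = (if p \<in> cbox (0, m - R) (2 * pi, m + R) then fint F k \<xi> p else 0)"
    proof (cases "\<bar>snd p - m\<bar> \<le> R")
      case True then show ?thesis by (cases p) (auto simp: cbox_Pair_eq abs_le_iff)
    next
      case False
      then have "r < \<bar>snd p - m\<bar>" using assms(2) by linarith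
      then have "F p = 0" using F unfolding good_at_def by blast
      then show ?thesis by simp
    qed
  qed
  finally show ?thesis by (simp only: integral_restrict_UNIV)
qed

lemma fourier_bound:
  assumes F: "good_at m r F" and r: "0 \<le> r" and B: "\<And>p. \<bar>F p\<bar> \<le> B"
  shows "cmod (fourier_Txr (\<lambda>x y. F (x, y)) k \<xi>) \<le> 4 * pi * r * B"
proof -
  have B0: "0 \<le> B" using B[of 0] by linarith
  have "norm (integral (cbox (0, m - r) (2 * pi, m + r)) (fint F k \<xi>)) \<le> B * Henstock_Kurzweil_Integration.content (cbox (0::real, m - r) (2 * pi, m + r))"
    by (rule Henstock_Kurzweil_Integration.integrable_bound[OF B0 integrable_continuous[OF fint_continuous]])
       (use F B in \<open>auto simp: good_at_def norm_mult simp del: split_paired_All\<close>)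
  also have "Henstock_Kurzweil_Integration.content (cbox (0::real, m - r) (2 * pi, m + r)) = 2 * pi * (2 * r)" using r by (simp add: content_Pair)
  finally show ?thesis unfolding fourier_box[OF F order_refl] by (simp add: mult_ac)
qed

lemma line_deriv_x_imp: "line_deriv (1, 0) F F' \<Longrightarrow> ((\<lambda>x. F (x, y)) has_real_derivative F' (x, y)) (at x)"
  using line_derivD[of "(1, 0)" F F' "(x, y)"] DERIV_shift[of "\<lambda>x. F (x, y)" "F' (x, y)" 0 x] by (simp add: add.commute)

lemma line_deriv_y_imp: "line_deriv (0, 1) F F' \<Longrightarrow> ((\<lambda>y. F (x, y)) has_real_derivative F' (x, y)) (at y)"
  using line_derivD[of "(0, 1)" F F' "(x, y)"] DERIV_shift[of "\<lambda>y. F (x, y)" "F' (x, y)" 0 y] by (simp add: add.commute)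

lemma has_vector_derivative_times_cis:
  assumes "(f has_real_derivative f') (at x)"
  shows "((\<lambda>x. complex_of_real (f x) * cis (- (a * x + b))) has_vector_derivative
    (complex_of_real f' * cis (- (a * x + b)) - \<i> * a * (complex_of_real (f x) * cis (- (a * x + b))))) (at x)"
proof -
  let ?e = "\<lambda>z. exp (- (\<i> * (complex_of_real a * z + complex_of_real b)))"
  have "(?e has_field_derivative - (\<i> * complex_of_real a) * ?e (complex_of_real x)) (at (complex_of_real x))"
    by (auto intro!: derivative_eq_intros)
  then have "((\<lambda>x. ?e (complex_of_real x)) has_vector_derivative - (\<i> * complex_of_real a) * ?e (complex_of_real x)) (at x)"
    by (rule has_vector_derivative_real_field)
  then have 1: "((\<lambda>x. cis (- (a * x + b))) has_vector_derivative (- a) *\<^sub>R (\<i> * cis (- (a * x + b)))) (at x)"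
    by (simp add: cis_conv_exp scaleR_conv_of_real algebra_simps)
  have 2: "((\<lambda>x. complex_of_real (f x)) has_vector_derivative complex_of_real f') (at x)"
    using assms by (intro has_vector_derivative_of_real) (simp add: has_real_derivative_iff_has_vector_derivative)
  show ?thesis using has_vector_derivative_mult[OF 2 1] by (simp add: scaleR_conv_of_real algebra_simps)
qed

text \<open>Integration by parts over one period in x, after exchanging the order of integration;
  the boundary terms cancel because k is an integer.\<close>

lemma fourier_line_deriv_x:
  assumes F: "good_at m r F" and F': "good_at m r F'" and d: "line_deriv (1, 0) F F'"
  shows "fourier_Txr (\<lambda>x y. F' (x, y)) k \<xi> = \<i> * of_int k * fourier_Txr (\<lambda>x y. F (x, y)) k \<xi>"
proof -
  let ?B = "cbox (0::real, m - r) (2 * pi, m + r)"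
  have c: "continuous_on UNIV F" "continuous_on UNIV F'" using F F' by (auto simp: good_at_def)
  have swap: "integral ?B (fint H k \<xi>) = integral (cbox (m - r) (m + r)) (\<lambda>y. integral (cbox 0 (2 * pi)) (\<lambda>x. fint H k \<xi> (x, y)))"
    if "continuous_on UNIV H" for H
  proof -
    have "integral ?B (fint H k \<xi>) = integral (cbox 0 (2 * pi)) (\<lambda>x. integral (cbox (m - r) (m + r)) (\<lambda>y. fint H k \<xi> (x, y)))"
      by (rule integral_prod_continuous[OF fint_continuous[OF that]])
    also have "\<dots> = integral (cbox (m - r) (m + r)) (\<lambda>y. integral (cbox 0 (2 * pi)) (\<lambda>x. fint H k \<xi> (x, y)))"
      by (rule integral_swap_continuous) (use fint_continuous[OF that] in \<open>simp only: case_prod_beta' prod.collapse\<close>)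
    finally show ?thesis .
  qed
  have inner: "integral (cbox 0 (2 * pi)) (\<lambda>x. fint F' k \<xi> (x, y)) = \<i> * of_int k * integral (cbox 0 (2 * pi)) (\<lambda>x. fint F k \<xi> (x, y))" for y
  proof -
    let ?h = "\<lambda>x. fint F k \<xi> (x, y)"
    have "((\<lambda>x. fint F' k \<xi> (x, y) - \<i> * of_int k * fint F k \<xi> (x, y)) has_integral (?h (2 * pi) - ?h 0)) {0..2*pi}"
    proof (rule fundamental_theorem_of_calculus)
      fix x :: real
      show "(?h has_vector_derivative (fint F' k \<xi> (x, y) - \<i> * of_int k * fint F k \<xi> (x, y))) (at x within {0..2*pi})"
        using has_vector_derivative_at_within[OF has_vector_derivative_times_cis[OF line_deriv_x_imp[OF d, where x = x and y = y], where a = "real_of_int k" and b = "\<xi> * y"], of "{0..2*pi}"]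
        by (simp only: fst_conv snd_conv of_real_of_int_eq)
    qed simp
    moreover have "?h (2 * pi) = ?h 0"
    proof -
      have "F (2 * pi, y) = F (0, y)" using F perD[of F 0 y] by (simp add: good_at_def)
      moreover have "cis (- (real_of_int k * (2 * pi) + \<xi> * y)) = cis (- (real_of_int k * 0 + \<xi> * y))"
      proof -
        have "cis (2 * pi * real_of_int (- k)) = 1" by (rule cis_multiple_2pi) (rule Ints_of_int)
        moreover have "- (real_of_int k * (2 * pi) + \<xi> * y) = - (real_of_int k * 0 + \<xi> * y) + 2 * pi * real_of_int (- k)"
          by (simp add: algebra_simps)
        ultimately show ?thesis by (simp only: cis_mult[symmetric] mult_1_right)
      qed
      ultimately show ?thesis by (simp only: fst_conv snd_conv)
    qed
    ultimately have 0: "integral {0..2*pi} (\<lambda>x. fint F' k \<xi> (x, y) - \<i> * of_int k * fint F k \<xi> (x, y)) = 0"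
      by (simp add: integral_unique)
    have ci: "(\<lambda>x. fint H k \<xi> (x, y)) integrable_on {0..2*pi}" if "continuous_on UNIV H" for H
      by (intro integrable_continuous_real continuous_on_compose2[OF fint_continuous[OF that, of UNIV]]) (auto intro!: continuous_intros)
    have "integral {0..2*pi} (\<lambda>x. fint F' k \<xi> (x, y) - \<i> * of_int k * fint F k \<xi> (x, y))
        = integral {0..2*pi} (\<lambda>x. fint F' k \<xi> (x, y)) - integral {0..2*pi} (\<lambda>x. \<i> * of_int k * fint F k \<xi> (x, y))"
      by (rule integral_diff[OF ci[OF c(2)] integrable_on_mult_right[OF ci[OF c(1)]]])
    also have "integral {0..2*pi} (\<lambda>x. \<i> * of_int k * fint F k \<xi> (x, y)) = \<i> * of_int k * integral {0..2*pi} (\<lambda>x. fint F k \<xi> (x, y))"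
      by (rule integral_mult_right)
    finally have "integral {0..2*pi} (\<lambda>x. fint F' k \<xi> (x, y)) - \<i> * of_int k * integral {0..2*pi} (\<lambda>x. fint F k \<xi> (x, y)) = 0"
      using 0 by (simp only:)
    then show ?thesis unfolding cbox_interval by (simp only: right_minus_eq)
  qed
  show ?thesis unfolding fourier_box[OF F order_refl] fourier_box[OF F' order_refl] swap[OF c(1)] swap[OF c(2)] inner by (rule integral_mult_right)
qed

lemma fourier_line_deriv_y:
  assumes F: "good_at m r F" and F': "good_at m r F'" and d: "line_deriv (0, 1) F F'" and r: "0 \<le> r"
  shows "fourier_Txr (\<lambda>x y. F' (x, y)) k \<xi> = \<i> * \<xi> * fourier_Txr (\<lambda>x y. F (x, y)) k \<xi>"
proof -
  \<comment> \<open>\<open>good_at\<close> says nothing at distance exactly r, so the box is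
    enlarged until both boundary values are 0.\<close>
  define R where "R = r + 1"
  have R: "r \<le> R" "r < R" "0 \<le> R" using r by (auto simp: R_def)
  let ?B = "cbox (0::real, m - R) (2 * pi, m + R)"
  have c: "continuous_on UNIV F" "continuous_on UNIV F'" using F F' by (auto simp: good_at_def)
  have prod: "integral ?B (fint H k \<xi>) = integral (cbox 0 (2 * pi)) (\<lambda>x. integral (cbox (m - R) (m + R)) (\<lambda>y. fint H k \<xi> (x, y)))"
    if "continuous_on UNIV H" for H
    by (rule integral_prod_continuous[OF fint_continuous[OF that]])
  have inner: "integral (cbox (m - R) (m + R)) (\<lambda>y. fint F' k \<xi> (x, y)) = \<i> * \<xi> * integral (cbox (m - R) (m + R)) (\<lambda>y. fint F k \<xi> (x, y))" for x
  proof -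
    let ?h = "\<lambda>y. fint F k \<xi> (x, y)"
    have "((\<lambda>y. fint F' k \<xi> (x, y) - \<i> * \<xi> * fint F k \<xi> (x, y)) has_integral (?h (m + R) - ?h (m - R))) {m - R..m + R}"
    proof (rule fundamental_theorem_of_calculus)
      fix y :: real
      show "(?h has_vector_derivative (fint F' k \<xi> (x, y) - \<i> * \<xi> * fint F k \<xi> (x, y))) (at y within {m - R..m + R})"
        using has_vector_derivative_at_within[OF has_vector_derivative_times_cis[OF line_deriv_y_imp[OF d, where x = x and y = y], where a = \<xi> and b = "real_of_int k * x"], of "{m - R..m + R}"]
        by (simp only: fst_conv snd_conv add.commute[of "\<xi> * _"])
    qed (use R in simp)
    moreover have "F (x, m + R) = 0" "F (x, m - R) = 0" using F R by (auto simp: good_at_def)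
    ultimately have 0: "integral {m - R..m + R} (\<lambda>y. fint F' k \<xi> (x, y) - \<i> * \<xi> * fint F k \<xi> (x, y)) = 0"
      by (simp add: integral_unique)
    have ci: "(\<lambda>y. fint H k \<xi> (x, y)) integrable_on {m - R..m + R}" if "continuous_on UNIV H" for H
      by (intro integrable_continuous_real continuous_on_compose2[OF fint_continuous[OF that, of UNIV]]) (auto intro!: continuous_intros)
    have "integral {m - R..m + R} (\<lambda>y. fint F' k \<xi> (x, y) - \<i> * \<xi> * fint F k \<xi> (x, y))
        = integral {m - R..m + R} (\<lambda>y. fint F' k \<xi> (x, y)) - integral {m - R..m + R} (\<lambda>y. \<i> * \<xi> * fint F k \<xi> (x, y))"
      by (rule integral_diff[OF ci[OF c(2)] integrable_on_mult_right[OF ci[OF c(1)]]])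
    also have "integral {m - R..m + R} (\<lambda>y. \<i> * \<xi> * fint F k \<xi> (x, y)) = \<i> * \<xi> * integral {m - R..m + R} (\<lambda>y. fint F k \<xi> (x, y))"
      by (rule integral_mult_right)
    finally have "integral {m - R..m + R} (\<lambda>y. fint F' k \<xi> (x, y)) - \<i> * \<xi> * integral {m - R..m + R} (\<lambda>y. fint F k \<xi> (x, y)) = 0"
      using 0 by (simp only:)
    then show ?thesis unfolding cbox_interval by (simp only: right_minus_eq)
  qed
  show ?thesis unfolding fourier_box[OF F R(1)] fourier_box[OF F' R(1)] prod[OF c(1)] prod[OF c(2)] inner by (rule integral_mult_right)
qed

section \<open>From Fourier decay to the Sobolev norm\<close>

lemma summable_on_int_powr: "(\<lambda>k::int. (1 + (real_of_int k)\<^sup>2) powr (- (3/4))) summable_on UNIV"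
proof -
  let ?f = "\<lambda>k::int. (1 + (real_of_int k)\<^sup>2) powr (- (3/4))"
  have nat: "(\<lambda>n::nat. ?f (int n)) summable_on UNIV"
  proof (rule norm_summable_imp_summable_on, rule summable_comparison_test[OF exI[of _ 1]], intro allI impI)
    show "summable (\<lambda>n. real n powr (- (3/2)))" by (subst summable_real_powr_iff) simp
    fix n :: nat assume "1 \<le> n"
    then have "(1 + (real n)\<^sup>2) powr (- (3/4)) \<le> ((real n)\<^sup>2) powr (- (3/4))" by (intro powr_mono2') auto
    also have "\<dots> = real n powr (- (3/2))" using square_powr[of "real n" "- (3/4)"] by simp
    finally show "norm (norm (?f (int n))) \<le> real n powr (- (3/2))" by simp
  qed
  have "?f summable_on range int" using nat by (subst summable_on_reindex) (auto simp: comp_def)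
  moreover have "?f summable_on range (\<lambda>n. - int (Suc n))"
  proof (subst summable_on_reindex)
    show "(?f \<circ> (\<lambda>n. - int (Suc n))) summable_on UNIV"
    proof (rule summable_on_comparison_test[OF nat])
      fix n :: nat
      have "(real n)\<^sup>2 \<le> (real (Suc n))\<^sup>2" by (intro power_mono) auto
      then have "(1 + (real (Suc n))\<^sup>2) powr (- (3/4)) \<le> (1 + (real n)\<^sup>2) powr (- (3/4))"
        by (intro powr_mono2') (auto intro: add_pos_nonneg)
      then show "(?f \<circ> (\<lambda>n. - int (Suc n))) n \<le> ?f (int n)" by (simp add: power2_eq_square algebra_simps)
    qed auto
  qed (auto simp: inj_on_def)
  ultimately have "?f summable_on (range int \<union> range (\<lambda>n. - int (Suc n)))"
    by (rule summable_on_Un_disjoint) auto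
  moreover have "range int \<union> range (\<lambda>n. - int (Suc n)) = UNIV"
  proof -
    have "k \<in> range int \<union> range (\<lambda>n. - int (Suc n))" for k by (cases k rule: int_cases) auto
    then show ?thesis by blast
  qed
  ultimately show ?thesis by simp
qed

lemma integrable_real_powr: "integrable lborel (\<lambda>z::real. (1 + z\<^sup>2) powr (- (3/4)))"
proof -
  have "(\<integral>\<^sup>+x. ennreal (indicat_real {1..} x * (x::real) powr (- (3/2))) \<partial>lborel) = ennreal (- (1 powr (- (3/2) + 1)) / (- (3/2) + 1))"
    by (rule nn_integral_has_integral_lebesgue) (use has_integral_powr_to_inf[of "- (3/2)" 1] in auto)
  then have i: "has_bochner_integral lborel (\<lambda>x::real. indicat_real {1..} x * x powr (- (3/2))) 2"
    by (intro has_bochner_integral_nn_integral) auto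
  from has_bochner_integral_lborel_reflect[OF this, of 0]
  have i': "integrable lborel (\<lambda>x::real. indicat_real {1..} (- x) * (- x) powr (- (3/2)))" by (simp add: has_bochner_integral_iff)
  have "integrable lborel (\<lambda>x::real. indicator {-1..1} x * 1 + (indicat_real {1..} x * x powr (- (3/2)) + indicat_real {1..} (- x) * (- x) powr (- (3/2))))"
    using i by (intro Bochner_Integration.integrable_add i' integrable_on_window_continuous continuous_intros) (simp add: has_bochner_integral_iff)
  then show ?thesis
  proof (rule Bochner_Integration.integrable_bound)
    show "AE z in lborel. norm ((1 + z\<^sup>2) powr (- (3/4)))
      \<le> norm (indicator {-1..1} z * 1 + (indicat_real {1..} z * z powr (- (3/2)) + indicat_real {1..} (- z) * (- z) powr (- (3/2))))"
    proof (intro AE_I2)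
      fix z :: real
      have pos: "0 < 1 + z\<^sup>2" by (simp add: add_pos_nonneg)
      have a: "(1 + z\<^sup>2) powr (- (3/4)) \<le> 1" using powr_mono2'[of "- (3/4)" 1 "1 + z\<^sup>2"] by simp
      have b: "(1 + z\<^sup>2) powr (- (3/4)) \<le> \<bar>z\<bar> powr (- (3/2))" if "z \<noteq> 0"
      proof -
        have "(1 + z\<^sup>2) powr (- (3/4)) \<le> (\<bar>z\<bar>\<^sup>2) powr (- (3/4))" using that by (intro powr_mono2') auto
        also have "\<dots> = \<bar>z\<bar> powr (- (3/2))" using square_powr[of "\<bar>z\<bar>" "- (3/4)"] by simp
        finally show ?thesis .
      qed
      consider "\<bar>z\<bar> \<le> 1" | "1 < z" | "z < -1" by linarith
      then show "norm ((1 + z\<^sup>2) powr (- (3/4)))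
        \<le> norm (indicator {-1..1} z * 1 + (indicat_real {1..} z * z powr (- (3/2)) + indicat_real {1..} (- z) * (- z) powr (- (3/2))))"
      proof cases
        case 1
        then have "z \<in> {-1..1}" by auto
        then show ?thesis using a by (auto simp: indicator_def)
      next
        case 2 then show ?thesis using b by auto
      next
        case 3 then show ?thesis using b by auto
      qed
    qed
  qed measurable
qed

text \<open>In the rescaled variable \<delta> \<xi> let Z = 1 + k^2 + (\<delta> \<xi>)^2. The weight
  is at most Z powr s times \<delta> powr (-2 s), and three derivatives give Z^3 c^2 <= 27 Q^2.
  Since s - 3 <= -3/2, what remains is Z powr (-3/2), which splits into a factor summable in k and
  one integrable in \<xi>, both decaying with exponent 3/2.\<close>

lemma Hs_integrand_le:
  fixes k :: int and \<xi> s \<delta> Q c :: real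
  assumes s: "0 \<le> s" "s \<le> 3/2" and \<delta>: "0 < \<delta>" "\<delta> \<le> 1" and c: "0 \<le> c" "c \<le> Q" "\<bar>real_of_int k\<bar> ^ 3 * c \<le> Q" "\<bar>\<delta> * \<xi>\<bar> ^ 3 * c \<le> Q"
  shows "(1 + (real_of_int k)\<^sup>2 + \<xi>\<^sup>2) powr s * c\<^sup>2
    \<le> 27 * Q\<^sup>2 * \<delta> powr (- 2 * s) * (1 + (real_of_int k)\<^sup>2) powr (- (3/4)) * (1 + (0 + \<delta> * \<xi>)\<^sup>2) powr (- (3/4))"
proof -
  define K where "K = (real_of_int k)\<^sup>2"
  define z where "z = (\<delta> * \<xi>)\<^sup>2"
  define Z where "Z = 1 + K + z"
  have nn: "0 \<le> K" "0 \<le> z" "1 \<le> Z" by (auto simp: K_def z_def Z_def)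
  have d2: "0 < \<delta>\<^sup>2" "\<delta>\<^sup>2 \<le> 1" using \<delta> by (auto simp: power_le_one)
  have 1: "(1 + K + \<xi>\<^sup>2) powr s \<le> Z powr s * \<delta> powr (- 2 * s)"
  proof -
    have "(1 + K) * \<delta>\<^sup>2 \<le> (1 + K) * 1" using nn d2 by (intro mult_left_mono) auto
    then have "(1 + K + \<xi>\<^sup>2) * \<delta>\<^sup>2 \<le> Z" by (simp add: Z_def z_def algebra_simps power_mult_distrib)
    then have "1 + K + \<xi>\<^sup>2 \<le> Z / \<delta>\<^sup>2" using d2 by (simp add: pos_le_divide_eq)
    then have "(1 + K + \<xi>\<^sup>2) powr s \<le> (Z / \<delta>\<^sup>2) powr s" using nn s by (intro powr_mono2) auto
    also have "\<dots> = Z powr s / (\<delta>\<^sup>2) powr s" using nn by (simp add: powr_divide)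
    also have "(\<delta>\<^sup>2) powr s = \<delta> powr (2 * s)" using \<delta> by (intro square_powr) auto
    finally show ?thesis by (simp add: powr_minus_divide)
  qed
  have Q: "0 \<le> Q" using c by linarith
  have 2: "Z ^ 3 * c\<^sup>2 \<le> 27 * Q\<^sup>2"
  proof -
    \<comment> \<open>Z has three summands, each with its own hypothesis on c; the factor 27 is the
      cube of 3.\<close>
    define m where "m = max 1 (max K z)"
    have "Z \<le> 3 * m" by (auto simp: Z_def m_def)
    then have "Z ^ 3 \<le> (3 * m) ^ 3" using nn by (intro power_mono) auto
    then have "Z ^ 3 * c\<^sup>2 \<le> 27 * (m ^ 3 * c\<^sup>2)"
      using mult_right_mono[of "Z ^ 3" "(3 * m) ^ 3" "c\<^sup>2"] by (simp add: power_mult_distrib)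
    moreover have "m ^ 3 * c\<^sup>2 \<le> Q\<^sup>2"
    proof -
      have a: "c\<^sup>2 \<le> Q\<^sup>2" using c by (intro power_mono) auto
      have b: "K ^ 3 * c\<^sup>2 \<le> Q\<^sup>2"
      proof -
        have "(\<bar>real_of_int k\<bar> ^ 3 * c)\<^sup>2 \<le> Q\<^sup>2" using c by (intro power_mono) auto
        moreover have "(\<bar>real_of_int k\<bar> ^ 3)\<^sup>2 = (\<bar>real_of_int k\<bar>\<^sup>2) ^ 3" by (simp only: power_mult[symmetric] mult.commute)
        ultimately show ?thesis by (simp add: power_mult_distrib K_def)
      qed
      have d: "z ^ 3 * c\<^sup>2 \<le> Q\<^sup>2"
      proof -
        have "(\<bar>\<delta> * \<xi>\<bar> ^ 3 * c)\<^sup>2 \<le> Q\<^sup>2" using c by (intro power_mono) auto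
        moreover have "(\<bar>\<delta> * \<xi>\<bar> ^ 3)\<^sup>2 = (\<bar>\<delta> * \<xi>\<bar>\<^sup>2) ^ 3" by (simp only: power_mult[symmetric] mult.commute)
        ultimately have "(\<bar>\<delta> * \<xi>\<bar>\<^sup>2) ^ 3 * c\<^sup>2 \<le> Q\<^sup>2" by (simp only: power_mult_distrib[of _ c])
        then show ?thesis by (simp only: z_def power2_abs)
      qed
      show ?thesis using a b d by (auto simp: m_def max_def)
    qed
    ultimately show ?thesis by linarith
  qed
  have 3: "Z powr s * c\<^sup>2 \<le> 27 * Q\<^sup>2 * Z powr (- (3/2))"
  proof -
    have "Z powr s = Z powr (s - 3) * Z ^ 3"
    proof -
      have "Z powr s = Z powr ((s - 3) + 3)" by simp
      also have "\<dots> = Z powr (s - 3) * Z powr 3" by (rule powr_add)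
      also have "Z powr 3 = Z ^ 3" using nn by (simp add: powr_numeral)
      finally show ?thesis .
    qed
    then have "Z powr s * c\<^sup>2 = Z powr (s - 3) * (Z ^ 3 * c\<^sup>2)" by simp
    also have "\<dots> \<le> Z powr (- (3/2)) * (27 * Q\<^sup>2)"
      using s nn by (intro mult_mono[OF powr_mono 2]) auto
    finally show ?thesis by (simp add: mult_ac)
  qed
  have 4: "Z powr (- (3/2)) \<le> (1 + K) powr (- (3/4)) * (1 + z) powr (- (3/4))"
  proof -
    have "(1 + K) * (1 + z) \<le> Z * Z" using nn by (intro mult_mono) (auto simp: Z_def)
    then have "(Z\<^sup>2) powr (- (3/4)) \<le> ((1 + K) * (1 + z)) powr (- (3/4))"
      using nn by (intro powr_mono2') (auto simp: power2_eq_square intro!: mult_pos_pos)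
    also have "\<dots> = (1 + K) powr (- (3/4)) * (1 + z) powr (- (3/4))" using nn by (simp add: powr_mult)
    also have "(Z\<^sup>2) powr (- (3/4)) = Z powr (- (3/2))" using square_powr[of Z "- (3/4)"] nn by simp
    finally show ?thesis .
  qed
  have "(1 + K + \<xi>\<^sup>2) powr s * c\<^sup>2 \<le> (Z powr s * \<delta> powr (- 2 * s)) * c\<^sup>2"
    using 1 by (intro mult_right_mono) auto
  also have "\<dots> = (Z powr s * c\<^sup>2) * \<delta> powr (- 2 * s)" by simp
  also have "\<dots> \<le> (27 * Q\<^sup>2 * ((1 + K) powr (- (3/4)) * (1 + z) powr (- (3/4)))) * \<delta> powr (- 2 * s)"
    using order_trans[OF 3 mult_left_mono[OF 4]] by (intro mult_right_mono) auto
  finally show ?thesis by (simp add: K_def z_def mult_ac)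
qed

text \<open>The weight contributes \<delta> powr (-2 s) and the substitution \<delta> \<xi> a
  further 1/\<delta>; the square root gives the exponent -(s + 1/2).\<close>

lemma Hs_norm_bound:
  obtains C0 where "0 < C0"
    "\<And>s \<delta> Q f. 0 \<le> s \<Longrightarrow> s \<le> 3/2 \<Longrightarrow> 0 < \<delta> \<Longrightarrow> \<delta> \<le> 1 \<Longrightarrow>
      (\<And>k \<xi>. cmod (fourier_Txr f k \<xi>) \<le> Q) \<Longrightarrow> (\<And>k \<xi>. \<bar>real_of_int k\<bar> ^ 3 * cmod (fourier_Txr f k \<xi>) \<le> Q) \<Longrightarrow>
      (\<And>k \<xi>. \<bar>\<delta> * \<xi>\<bar> ^ 3 * cmod (fourier_Txr f k \<xi>) \<le> Q) \<Longrightarrow> Hs_norm s f \<le> C0 * Q * \<delta> powr (- (s + 1/2))"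
proof -
  define J where "J = (LINT z|lborel. (1 + z\<^sup>2) powr (- (3/4) :: real))"
  define S where "S = (\<Sum>\<^sub>\<infinity>k::int. (1 + (real_of_int k)\<^sup>2) powr (- (3/4)))"
  have J0: "0 \<le> J" unfolding J_def by (intro Bochner_Integration.integral_nonneg) auto
  have S0: "0 \<le> S" unfolding S_def by (intro infsum_nonneg) auto
  define C0 where "C0 = sqrt (27 * J * S) + 1"
  show thesis
  proof (rule that[of C0])
    show "0 < C0" unfolding C0_def using J0 S0 by (intro add_nonneg_pos) auto
    fix s \<delta> Q :: real and f
    assume s: "0 \<le> s" "s \<le> 3/2" and \<delta>: "0 < \<delta>" "\<delta> \<le> 1"
      and b: "\<And>k \<xi>. cmod (fourier_Txr f k \<xi>) \<le> Q" "\<And>k \<xi>. \<bar>real_of_int k\<bar> ^ 3 * cmod (fourier_Txr f k \<xi>) \<le> Q"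
        "\<And>k \<xi>. \<bar>\<delta> * \<xi>\<bar> ^ 3 * cmod (fourier_Txr f k \<xi>) \<le> Q"
    have Q: "0 \<le> Q" using order_trans[OF norm_ge_zero b(1)] .
    let ?g = "\<lambda>k \<xi>. (1 + (real_of_int k)\<^sup>2 + \<xi>\<^sup>2) powr s * (cmod (fourier_Txr f k \<xi>))\<^sup>2"
    let ?c = "27 * Q\<^sup>2 * \<delta> powr (- 2 * s)"
    have I: "integral\<^sup>L lborel (?g k) \<le> (?c * J / \<delta>) * (1 + (real_of_int k)\<^sup>2) powr (- (3/4))" for k
    proof -
      have h: "integrable lborel (\<lambda>\<xi>. ?c * (1 + (real_of_int k)\<^sup>2) powr (- (3/4)) * (1 + (0 + \<delta> * \<xi>)\<^sup>2) powr (- (3/4)))"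
        using lborel_integrable_real_affine[OF integrable_real_powr, of \<delta> 0] \<delta> by (intro integrable_mult_right) auto
      have hJ: "(LINT \<xi>|lborel. (1 + (0 + \<delta> * \<xi>)\<^sup>2) powr (- (3/4))) = J / \<delta>"
        using lborel_integral_real_affine[of \<delta> "\<lambda>z. (1 + z\<^sup>2) powr (- (3/4))" 0] \<delta> by (simp add: J_def field_simps)
      have "integral\<^sup>L lborel (?g k) \<le> (LINT \<xi>|lborel. ?c * (1 + (real_of_int k)\<^sup>2) powr (- (3/4)) * (1 + (0 + \<delta> * \<xi>)\<^sup>2) powr (- (3/4)))"
      proof (cases "integrable lborel (?g k)")
        case True
        show ?thesis by (rule integral_mono[OF True h]) (rule Hs_integrand_le[OF s \<delta> norm_ge_zero b])
      next
        case False
        \<comment> \<open>A non-integrable slice would have integral 0, which satisfies the bound as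
          well.\<close>
        then have "integral\<^sup>L lborel (?g k) = 0" by (rule not_integrable_integral_eq)
        then show ?thesis by (simp add: Bochner_Integration.integral_nonneg)
      qed
      also have "\<dots> = ?c * (1 + (real_of_int k)\<^sup>2) powr (- (3/4)) * (J / \<delta>)"
        unfolding integral_mult_right_zero hJ ..
      finally show ?thesis by (simp add: mult_ac)
    qed
    have sm: "(\<lambda>k::int. (?c * J / \<delta>) * (1 + (real_of_int k)\<^sup>2) powr (- (3/4))) summable_on UNIV"
      by (intro summable_on_cmult_right summable_on_int_powr)
    have I0: "0 \<le> integral\<^sup>L lborel (?g k)" for k by (intro Bochner_Integration.integral_nonneg) auto
    have "(\<Sum>\<^sub>\<infinity>k::int. integral\<^sup>L lborel (?g k)) \<le> (\<Sum>\<^sub>\<infinity>k::int. (?c * J / \<delta>) * (1 + (real_of_int k)\<^sup>2) powr (- (3/4)))"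
      by (intro infsum_mono sm I summable_on_comparison_test[OF sm I I0])
    also have "\<dots> = (?c * J / \<delta>) * S" unfolding S_def by (rule infsum_cmult_right')
    finally have "(\<Sum>\<^sub>\<infinity>k::int. integral\<^sup>L lborel (?g k)) \<le> (?c * J / \<delta>) * S" .
    moreover have "1 / (4 * pi\<^sup>2) \<le> 1"
    proof -
      have "1 \<le> pi\<^sup>2" using pi_gt3 by (intro one_le_power) auto
      then show ?thesis by (simp add: divide_simps)
    qed
    moreover have "0 \<le> (\<Sum>\<^sub>\<infinity>k::int. integral\<^sup>L lborel (?g k))" by (intro infsum_nonneg I0)
    ultimately have "(1 / (4 * pi\<^sup>2)) * (\<Sum>\<^sub>\<infinity>k::int. integral\<^sup>L lborel (?g k)) \<le> 1 * ((?c * J / \<delta>) * S)"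
      by (intro mult_mono) auto
    then have "Hs_norm s f \<le> sqrt ((?c * J / \<delta>) * S)" unfolding Hs_norm_def by (simp add: real_sqrt_le_mono)
    also have "(?c * J / \<delta>) * S = (27 * J * S) * (Q * \<delta> powr (- (s + 1/2)))\<^sup>2"
    proof -
      have "(\<delta> powr (- (s + 1/2)))\<^sup>2 = \<delta> powr (- 2 * s) * \<delta> powr (- 1)"
      proof -
        have "- (s + 1/2) + - (s + 1/2) = - 2 * s + - 1" by simp
        then show ?thesis by (simp only: power2_eq_square powr_add[symmetric])
      qed
      also have "\<delta> powr (- 1) = 1 / \<delta>" using \<delta> by (simp add: powr_minus_divide)
      finally show ?thesis by (simp add: power_mult_distrib)
    qed
    also have "sqrt \<dots> = sqrt (27 * J * S) * (Q * \<delta> powr (- (s + 1/2)))"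
      using Q by (simp add: real_sqrt_mult)
    also have "\<dots> \<le> C0 * (Q * \<delta> powr (- (s + 1/2)))" unfolding C0_def using Q by (intro mult_right_mono) auto
    finally show "Hs_norm s f \<le> C0 * Q * \<delta> powr (- (s + 1/2))" by (simp add: mult_ac)
  qed
qed

text \<open>\<open>stream\<close> is a gauge integral over a closed period. The integrand is
  Lebesgue integrable and the extra line is null, so it agrees with the convolution.\<close>

lemma stream_eq_conv:
  assumes w: "good r w" shows "stream (\<lambda>x y. w (x, y)) x y = 1 / (4 * pi) * conv KL w (x, y)"
proof -
  let ?f = "\<lambda>q. KL ((x, y) - q) * w q"
  have [measurable]: "w \<in> borel_measurable borel" using w by (rule good_measurable)
  have "has_bochner_integral lborel (\<lambda>q. indicator {0..<0+2*pi} (fst q) * ?f q) (conv KL w (x, y))"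
    by (rule good_conv_window[OF lker_KL w])
  then have h: "has_bochner_integral lborel (\<lambda>q. indicator ({0..2*pi} \<times> UNIV) q * ?f q) (conv KL w (x, y))"
  proof (rule has_bochner_integral_cong_AE_real)
    have "{0..2*pi} \<times> UNIV \<in> sets (borel \<Otimes>\<^sub>M (borel :: real measure))" by (intro pair_measureI) auto
    then have [measurable]: "{0..2*pi} \<times> UNIV \<in> sets (borel :: (real \<times> real) measure)" by (simp only: borel_prod)
    show "(\<lambda>q. indicator ({0..2*pi} \<times> UNIV) q * ?f q) \<in> borel_measurable lborel" by measurable
    show "AE q in lborel. indicator {0..<0+2*pi} (fst q) * ?f q = indicator ({0..2*pi} \<times> UNIV) q * ?f q"
      using AE_fst_neq[of "2 * pi"]
    proof eventually_elim
      case (elim q) then show ?case by (cases q) (auto simp: indicator_def)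
    qed
  qed
  then have si: "set_integrable lborel ({0..2*pi} \<times> UNIV) ?f" by (simp add: set_integrable_def has_bochner_integral_iff)
  have "integral ({0..2*pi} \<times> UNIV) ?f = conv KL w (x, y)"
    using set_borel_integral_eq_integral(2)[OF si] h by (simp add: set_lebesgue_integral_def has_bochner_integral_iff)
  moreover have "(\<lambda>(xb, yb). ln (cosh (y - yb) - cos (x - xb)) * w (xb, yb)) = ?f"
    by (auto simp: KL_def)
  ultimately show ?thesis unfolding stream_def by (simp only:)
qed

lemma Ck_translate: "Ck n f \<Longrightarrow> Ck n (\<lambda>p. f (p + z))"
proof (induction n arbitrary: f)
  case 0
  then have "continuous_on UNIV f" by simp
  then have "continuous_on UNIV (\<lambda>p. f (p + z))" by (rule continuous_on_compose2) (auto intro!: continuous_intros)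
  then show ?case by simp
next
  case (Suc n)
  obtain fx fy where f: "\<And>p. (f has_derivative (\<lambda>h. fst h * fx p + snd h * fy p)) (at p)" "Ck n fx" "Ck n fy"
    using Suc.prems unfolding Ck.simps by blast
  have "((\<lambda>p. f (p + z)) has_derivative (\<lambda>h. fst h * fx (p + z) + snd h * fy (p + z))) (at p)" for p
    by (rule has_derivative_compose[of "\<lambda>p. p + z" "\<lambda>h. h", OF _ f(1)]) (auto intro!: derivative_eq_intros)
  then show ?case by (rule Ck_SucI) (intro Suc.IH f)+
qed

lemma good_at_translate: "good r w \<Longrightarrow> good_at (- m) r (\<lambda>p. c * w (p + (t, m)))"
proof -
  assume w: "good r w"
  have "per (\<lambda>p. c * w (p + (t, m)))" unfolding per_def
  proof (intro allI)
    fix x y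
    show "c * w ((x + 2 * pi, y) + (t, m)) = c * w ((x, y) + (t, m))"
    proof -
      have "per w" using w by (simp add: good_def)
      from perD[OF this, of "x + t" "y + m"] show ?thesis by (simp add: add_ac)
    qed
  qed
  moreover have "continuous_on UNIV (\<lambda>p. c * w (p + (t, m)))"
  proof -
    have "continuous_on UNIV w" using w by (simp add: good_def)
    then have "continuous_on UNIV (\<lambda>p. w (p + (t, m)))" by (rule continuous_on_compose2) (auto intro!: continuous_intros)
    then show ?thesis by (rule continuous_on_mult_left)
  qed
  moreover have "r < \<bar>snd p - (- m)\<bar> \<longrightarrow> c * w (p + (t, m)) = 0" for p
  proof
    assume "r < \<bar>snd p - (- m)\<bar>"
    then have "r < \<bar>snd (p + (t, m))\<bar>" by simp
    then have "w (p + (t, m)) = 0" using w unfolding good_def strip_def by blast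
    then show "c * w (p + (t, m)) = 0" by simp
  qed
  ultimately show ?thesis unfolding good_at_def by blast
qed

lemma line_deriv_translate: "line_deriv e w w' \<Longrightarrow> line_deriv e (\<lambda>p. c * w (p + z)) (\<lambda>p. c * w' (p + z))"
  unfolding line_deriv_def
proof (intro allI)
  fix p assume "\<forall>p. ((\<lambda>s. w (p + s *\<^sub>R e)) has_real_derivative w' p) (at 0)"
  then have "((\<lambda>s. w (p + z + s *\<^sub>R e)) has_real_derivative w' (p + z)) (at 0)" by blast
  from DERIV_cmult[OF this, of c] show "((\<lambda>s. c * w (p + s *\<^sub>R e + z)) has_real_derivative c * w' (p + z)) (at 0)"
    by (simp add: ac_simps)
qed

lemma steady_algebra:
  fixes \<delta> \<nu> A B Y h :: real assumes "\<delta> \<noteq> 0"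
  shows "Y * ((- (\<nu> / \<delta>) * A) * h) + \<delta> * \<nu> * (B * ((- (\<nu> / \<delta>) * A) * h) - A * ((- Y / \<delta>\<^sup>2 + - (\<nu> / \<delta>) * B) * h)) = 0"
  using assms by (simp add: field_simps power2_eq_square)

text \<open>In the layer the profile is a function of \<open>E\<close>, and \<delta>^2 E is, up to a
  constant, minus the total stream function y^2/2 - \<psi>. The total velocity is tangent to the
  level lines of \<open>E\<close>, so the transport term vanishes.\<close>

lemma steady_state_identity:
  assumes \<delta>: "0 < \<delta>" and \<phi>: "admissible \<phi>" and eq: "\<And>p. \<bar>snd p\<bar> \<le> 2 * \<delta> \<Longrightarrow> \<phi> p = - (\<nu> / \<delta>) * conv KL (profile \<delta> \<phi>) p + c"
  obtains Wx Wy where "\<And>p. (profile \<delta> \<phi> has_derivative (\<lambda>h. fst h * Wx p + snd h * Wy p)) (at p)"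
    "\<And>p. snd p * Wx p + \<delta> * \<nu> * (conv KY (profile \<delta> \<phi>) p * Wx p - conv KX (profile \<delta> \<phi>) p * Wy p) = 0"
proof -
  let ?W = "profile \<delta> \<phi>" and ?\<mu> = "- (\<nu> / \<delta>)"
  define E where "E = (\<lambda>p. (1 - (snd p)\<^sup>2 / (2 * \<delta>\<^sup>2) + c) + ?\<mu> * conv KL ?W p)"
  note t = profile_eq_trunc[OF \<delta> \<phi> eq E_def]
  let ?Dx = "\<lambda>p. ?\<mu> * conv KX ?W p" and ?Dy = "\<lambda>p. - snd p / \<delta>\<^sup>2 + ?\<mu> * conv KY ?W p"
  have dE: "(E has_derivative (\<lambda>h. fst h * ?Dx p + snd h * ?Dy p)) (at p)" for p
  proof -
    have "((\<lambda>p::real\<times>real. 1 - (snd p)\<^sup>2 / (2 * \<delta>\<^sup>2) + c) has_derivative (\<lambda>h. snd h * (- snd p / \<delta>\<^sup>2))) (at p)"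
      using \<delta> by (auto intro!: derivative_eq_intros simp: field_simps)
    from has_derivative_add[OF this has_derivative_mult_right[OF conv_KL_has_derivative[OF profile_good[OF \<delta> \<phi>], of p], of ?\<mu>]]
    show ?thesis unfolding E_def by (simp add: algebra_simps)
  qed
  have dG: "((\<lambda>_. 1) has_derivative (\<lambda>h. fst h * 0 + snd h * 0)) (at p)" for p :: "real \<times> real" by simp
  let ?h = "expinv (expinv_deriv 1)"
  define Wx where "Wx p = trunc (2 * \<delta>) (\<lambda>q. 0 * expinv 1 (E q) + (1 * ?Dx p) * ?h (E q)) p" for p
  define Wy where "Wy p = trunc (2 * \<delta>) (\<lambda>q. 0 * expinv 1 (E q) + (1 * ?Dy p) * ?h (E q)) p" for p
  have ab: "9/5 * \<delta> < 2 * \<delta>" using \<delta> by simp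
  show thesis
  proof (rule that)
    show "(?W has_derivative (\<lambda>h. fst h * Wx p + snd h * Wy p)) (at p)" for p
    proof -
      have "(trunc (2 * \<delta>) (\<lambda>p. 1 * expinv 1 (E p)) has_derivative (\<lambda>h. fst h * Wx p + snd h * Wy p)) (at p)"
        unfolding Wx_def Wy_def by (rule trunc_has_derivative[OF ab t(2) dG dE])
      then show ?thesis by (simp only: t(1)[symmetric])
    qed
    show "snd p * Wx p + \<delta> * \<nu> * (conv KY ?W p * Wx p - conv KX ?W p * Wy p) = 0" for p
    proof (cases "\<bar>snd p\<bar> < 2 * \<delta>")
      case True
      then have "Wx p = ?Dx p * ?h (E p)" "Wy p = ?Dy p * ?h (E p)" by (simp_all add: Wx_def Wy_def trunc_def)
      then show ?thesis using steady_algebra[of \<delta> "snd p" \<nu> "conv KX ?W p" "?h (E p)" "conv KY ?W p"] \<delta> by simp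
    qed (simp add: Wx_def Wy_def trunc_def)
  qed
qed

section \<open>Traveling waves\<close>

text \<open>Lowering the steady state by one unit replaces the shear velocity y by y + 1 in its
  equation. The extra x-derivative is exactly the time derivative of a wave with speed 1.\<close>

lemma traveling_wave_solution:
  assumes \<delta>: "0 < \<delta>" and \<phi>: "admissible \<phi>"
    and eq: "\<And>p. \<bar>snd p\<bar> \<le> 2 * \<delta> \<Longrightarrow> \<phi> p = - (\<nu> / \<delta>) * conv KL (profile \<delta> \<phi>) p + c"
    and \<Omega>: "\<Omega> = (\<lambda>x y. - (4 * pi * \<delta> * \<nu>) * profile \<delta> \<phi> (x, y + 1))"
  shows "euler_couette_sol (traveling \<Omega> 1)"
  unfolding euler_couette_sol_def
proof (intro allI)
  fix t x y :: real
  let ?W = "profile \<delta> \<phi>" and ?A = "4 * pi * \<delta> * \<nu>" and ?P = "(x + t, y + 1)"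
  note Wg = profile_good[OF \<delta> \<phi>]
  obtain Wx Wy where d: "\<And>p. (?W has_derivative (\<lambda>h. fst h * Wx p + snd h * Wy p)) (at p)"
    and id: "\<And>p. snd p * Wx p + \<delta> * \<nu> * (conv KY ?W p * Wx p - conv KX ?W p * Wy p) = 0"
    using steady_state_identity[OF \<delta> \<phi> eq] by blast
  have tr: "traveling \<Omega> 1 t' x' y' = - ?A * ?W (x' + t', y' + 1)" for t' x' y' by (simp add: traveling_def \<Omega>)
  have dx: "((\<lambda>x. ?W (x, b)) has_real_derivative Wx (a, b)) (at a)" and dy: "((\<lambda>y. ?W (a, y)) has_real_derivative Wy (a, b)) (at b)" for a b
    using has_derivative_fst_snd_imp_partials[OF d[of "(a, b)"]] by auto
  define w' where "w' = (\<lambda>p. - ?A * ?W (p + (t, 1)))"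
  \<comment> \<open>\<open>good\<close> strips are centred at height 0, so the strip must be wide
    enough to contain the lowered layer.\<close>
  have w': "good (2 * \<delta> + 1) w'"
  proof -
    have g: "good_at (- 1) (2 * \<delta>) w'" unfolding w'_def by (rule good_at_translate[OF Wg])
    have "w' p = 0" if "2 * \<delta> + 1 < \<bar>snd p\<bar>" for p
    proof -
      have "2 * \<delta> < \<bar>snd p - (- 1)\<bar>" using that by linarith
      then show ?thesis using g unfolding good_at_def by blast
    qed
    then show ?thesis using g unfolding good_at_def good_def strip_def by blast
  qed
  have st: "stream (traveling \<Omega> 1 t) x' y' = - (\<delta> * \<nu>) * conv KL ?W (x' + t, y' + 1)" for x' y'
  proof -
    have "traveling \<Omega> 1 t = (\<lambda>x y. w' (x, y))" by (simp add: fun_eq_iff tr w'_def)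
    then have "stream (traveling \<Omega> 1 t) x' y' = 1 / (4 * pi) * conv KL w' (x', y')"
      using stream_eq_conv[OF w'] by simp
    also have "conv KL w' (x', y') = - ?A * conv KL ?W (x' + t, y' + 1)"
    proof -
      have "indicator {-pi..<pi} (fst q) * (KL q * w' ((x', y') - q)) = - ?A * (indicator {-pi..<pi} (fst q) * (KL q * ?W ((x' + t, y' + 1) - q)))" for q
      proof -
        have "(x', y') - q + (t, 1) = (x' + t, y' + 1) - q" by (cases q) simp
        then have "w' ((x', y') - q) = - ?A * ?W ((x' + t, y' + 1) - q)" unfolding w'_def by (simp only:)
        then show ?thesis by simp
      qed
      then show ?thesis unfolding conv_def by (simp only: integral_mult_right_zero)
    qed
    finally show ?thesis by simp
  qed
  note dK = has_derivative_fst_snd_imp_partials[OF conv_KL_has_derivative[OF Wg, of ?P]]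
  show "\<exists>wt wx wy px py.
        ((\<lambda>t'. traveling \<Omega> 1 t' x y) has_real_derivative wt) (at t) \<and>
        ((\<lambda>x'. traveling \<Omega> 1 t x' y) has_real_derivative wx) (at x) \<and>
        ((\<lambda>y'. traveling \<Omega> 1 t x y') has_real_derivative wy) (at y) \<and>
        ((\<lambda>x'. stream (traveling \<Omega> 1 t) x' y) has_real_derivative px) (at x) \<and>
        ((\<lambda>y'. stream (traveling \<Omega> 1 t) x y') has_real_derivative py) (at y) \<and>
        wt + y * wx + ((- py) * wx + px * wy) = 0"
  proof (intro exI conjI)
    show "((\<lambda>t'. traveling \<Omega> 1 t' x y) has_real_derivative - ?A * Wx ?P) (at t)"
    proof -
      have "((\<lambda>t'. ?W (x + t', y + 1)) has_real_derivative Wx ?P) (at t)"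
        using DERIV_shift[of "\<lambda>x. ?W (x, y + 1)" "Wx ?P" t x] dx[where a = "x + t" and b = "y + 1"] by (simp add: add.commute)
      from DERIV_cmult[OF this, of "- ?A"] show ?thesis unfolding tr .
    qed
    show "((\<lambda>x'. traveling \<Omega> 1 t x' y) has_real_derivative - ?A * Wx ?P) (at x)"
    proof -
      have "((\<lambda>x'. ?W (x' + t, y + 1)) has_real_derivative Wx ?P) (at x)"
        using DERIV_shift[of "\<lambda>x. ?W (x, y + 1)" "Wx ?P" x t] dx[where a = "x + t" and b = "y + 1"] by simp
      from DERIV_cmult[OF this, of "- ?A"] show ?thesis unfolding tr .
    qed
    show "((\<lambda>y'. traveling \<Omega> 1 t x y') has_real_derivative - ?A * Wy ?P) (at y)"
    proof -
      have "((\<lambda>y'. ?W (x + t, y' + 1)) has_real_derivative Wy ?P) (at y)"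
        using DERIV_shift[of "\<lambda>y. ?W (x + t, y)" "Wy ?P" y 1] dy[where a = "x + t" and b = "y + 1"] by simp
      from DERIV_cmult[OF this, of "- ?A"] show ?thesis unfolding tr .
    qed
    show "((\<lambda>x'. stream (traveling \<Omega> 1 t) x' y) has_real_derivative - (\<delta> * \<nu>) * conv KX ?W ?P) (at x)"
    proof -
      have "((\<lambda>x'. conv KL ?W (x' + t, y + 1)) has_real_derivative conv KX ?W ?P) (at x)"
        using DERIV_shift[of "\<lambda>x. conv KL ?W (x, y + 1)" "conv KX ?W ?P" x t] dK(1) by simp
      from DERIV_cmult[OF this, of "- (\<delta> * \<nu>)"] show ?thesis unfolding st .
    qed
    show "((\<lambda>y'. stream (traveling \<Omega> 1 t) x y') has_real_derivative - (\<delta> * \<nu>) * conv KY ?W ?P) (at y)"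
    proof -
      have "((\<lambda>y'. conv KL ?W (x + t, y' + 1)) has_real_derivative conv KY ?W ?P) (at y)"
        using DERIV_shift[of "\<lambda>y. conv KL ?W (x + t, y)" "conv KY ?W ?P" y 1] dK(2) by simp
      from DERIV_cmult[OF this, of "- (\<delta> * \<nu>)"] show ?thesis unfolding st .
    qed
    have "- ?A * Wx ?P + y * (- ?A * Wx ?P) + (- (- (\<delta> * \<nu>) * conv KY ?W ?P) * (- ?A * Wx ?P) + - (\<delta> * \<nu>) * conv KX ?W ?P * (- ?A * Wy ?P))
        = - ?A * ((y + 1) * Wx ?P + \<delta> * \<nu> * (conv KY ?W ?P * Wx ?P - conv KX ?W ?P * Wy ?P))"
      by (simp add: algebra_simps)
    also have "\<dots> = 0" using id[of ?P] by simp
    finally show "- ?A * Wx ?P + y * (- ?A * Wx ?P) + (- (- (\<delta> * \<nu>) * conv KY ?W ?P) * (- ?A * Wx ?P) + - (\<delta> * \<nu>) * conv KX ?W ?P * (- ?A * Wy ?P)) = 0" .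
  qed
qed

lemma traveling_wave_fourier_bounds:
  assumes g: "good r w" "good r wa" "good r wb" "good r wc" and r: "0 \<le> r" and A: "0 \<le> A"
    and B: "\<And>p. \<bar>wc p\<bar> \<le> B"
  shows "line_deriv (1, 0) w wa \<Longrightarrow> line_deriv (1, 0) wa wb \<Longrightarrow> line_deriv (1, 0) wb wc \<Longrightarrow>
      \<bar>real_of_int k\<bar> ^ 3 * cmod (fourier_Txr (\<lambda>x y. - A * w ((x, y) + (t, m))) k \<xi>) \<le> 4 * pi * r * (A * B)"
    and "line_deriv (0, 1) w wa \<Longrightarrow> line_deriv (0, 1) wa wb \<Longrightarrow> line_deriv (0, 1) wb wc \<Longrightarrow>
      \<bar>\<xi>\<bar> ^ 3 * cmod (fourier_Txr (\<lambda>x y. - A * w ((x, y) + (t, m))) k \<xi>) \<le> 4 * pi * r * (A * B)"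
proof -
  let ?T = "\<lambda>w p. - A * w (p + (t, m))"
  note c = good_at_translate[OF g(1), of m "- A" t] good_at_translate[OF g(2), of m "- A" t]
    good_at_translate[OF g(3), of m "- A" t] good_at_translate[OF g(4), of m "- A" t]
  have b: "cmod (fourier_Txr (\<lambda>x y. ?T wc (x, y)) k \<xi>) \<le> 4 * pi * r * (A * B)"
    by (rule fourier_bound[OF c(4) r]) (use A B in \<open>auto simp: abs_mult intro!: mult_left_mono\<close>)
  {
    assume d: "line_deriv (1, 0) w wa" "line_deriv (1, 0) wa wb" "line_deriv (1, 0) wb wc"
    have "fourier_Txr (\<lambda>x y. ?T wc (x, y)) k \<xi> = (\<i> * of_int k) ^ 3 * fourier_Txr (\<lambda>x y. ?T w (x, y)) k \<xi>"
      unfolding fourier_line_deriv_x[OF c(3) c(4) line_deriv_translate[OF d(3)]] fourier_line_deriv_x[OF c(2) c(3) line_deriv_translate[OF d(2)]]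
        fourier_line_deriv_x[OF c(1) c(2) line_deriv_translate[OF d(1)]] by (simp add: power3_eq_cube)
    with b show "\<bar>real_of_int k\<bar> ^ 3 * cmod (fourier_Txr (\<lambda>x y. - A * w ((x, y) + (t, m))) k \<xi>) \<le> 4 * pi * r * (A * B)"
      by (simp add: norm_mult norm_power)
  }
  {
    assume d: "line_deriv (0, 1) w wa" "line_deriv (0, 1) wa wb" "line_deriv (0, 1) wb wc"
    have "fourier_Txr (\<lambda>x y. ?T wc (x, y)) k \<xi> = (\<i> * \<xi>) ^ 3 * fourier_Txr (\<lambda>x y. ?T w (x, y)) k \<xi>"
      unfolding fourier_line_deriv_y[OF c(3) c(4) line_deriv_translate[OF d(3)] r] fourier_line_deriv_y[OF c(2) c(3) line_deriv_translate[OF d(2)] r]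
        fourier_line_deriv_y[OF c(1) c(2) line_deriv_translate[OF d(1)] r] by (simp add: power3_eq_cube)
    with b show "\<bar>\<xi>\<bar> ^ 3 * cmod (fourier_Txr (\<lambda>x y. - A * w ((x, y) + (t, m))) k \<xi>) \<le> 4 * pi * r * (A * B)"
      by (simp add: norm_mult norm_power)
  }
qed

theorem theorem1p1:
  fixes s :: real
  assumes "0 \<le> s" and "s < 3 / 2"
  shows "\<exists>c C. 0 < c \<and> c \<le> C \<and>
    (\<forall>\<epsilon>>0. \<exists>(\<Omega> :: real \<Rightarrow> real \<Rightarrow> real) (lam :: real).
        periodic_x \<Omega> \<and> smooth_Txr \<Omega> \<and> compact_supp_Txr \<Omega> \<and>
        (\<exists>x1 x2 y. \<Omega> x1 y \<noteq> \<Omega> x2 y) \<and>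
        euler_couette_sol (traveling \<Omega> lam) \<and>
        (\<forall>t. Hs_norm s (traveling \<Omega> lam t) < \<epsilon>) \<and>
        c \<le> \<bar>lam\<bar> \<and> \<bar>lam\<bar> \<le> C)"
proof -
  \<comment> \<open>The norm will be of order \<delta> to the power 3/2 - s - 3 \<eta>. This choice
    spends half of the gap 3/2 - s on derivatives and leaves the other half as \<gamma>.\<close>
  define \<eta> where "\<eta> = (3 - 2 * s) / 12"
  define \<gamma> where "\<gamma> = (3 - 2 * s) / 4"
  have \<eta>: "0 < \<eta>" "\<eta> < 1" and \<gamma>: "0 < \<gamma>" using assms by (auto simp: \<eta>_def \<gamma>_def)
  obtain K where K: "0 < K" and bounds: "\<And>\<delta> \<phi> \<nu> c. 0 < \<delta> \<Longrightarrow> \<delta> \<le> 1/4 \<Longrightarrow> admissible \<phi> \<Longrightarrow> 0 < \<nu> \<Longrightarrow> \<nu> \<le> 1 / bump_mass \<Longrightarrow>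
       (\<And>p. \<bar>snd p\<bar> \<le> 2 * \<delta> \<Longrightarrow> \<phi> p = - (\<nu> / \<delta>) * conv KL (profile \<delta> \<phi>) p + c) \<Longrightarrow>
       (\<exists>Wa Wb Wc. good (2 * \<delta>) Wa \<and> good (2 * \<delta>) Wb \<and> good (2 * \<delta>) Wc \<and> line_deriv (1, 0) (profile \<delta> \<phi>) Wa \<and> line_deriv (1, 0) Wa Wb \<and> line_deriv (1, 0) Wb Wc \<and>
          (\<forall>p. \<bar>Wc p\<bar> \<le> K * (\<delta> powr (- \<eta>)) ^ 3)) \<and>
       (\<exists>Wa Wb Wc. good (2 * \<delta>) Wa \<and> good (2 * \<delta>) Wb \<and> good (2 * \<delta>) Wc \<and> line_deriv (0, 1) (profile \<delta> \<phi>) Wa \<and> line_deriv (0, 1) Wa Wb \<and> line_deriv (0, 1) Wb Wc \<and>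
          (\<forall>p. \<bar>Wc p\<bar> \<le> K * (1 / \<delta>) ^ 3))"
    using profile_derivative_bounds[OF \<eta>] by blast
  obtain a \<delta>0 :: real where a: "0 < a" "a \<le> 1/8" and \<delta>0: "0 < \<delta>0" "\<delta>0 \<le> 1/4"
    and ex: "\<And>\<delta>. 0 < \<delta> \<Longrightarrow> \<delta> < \<delta>0 \<Longrightarrow> \<exists>\<phi> \<nu> c. admissible \<phi> \<and> (\<forall>p. \<bar>\<phi> p - a * cos (fst p)\<bar> \<le> a / 100) \<and>
        0 < \<nu> \<and> \<nu> \<le> 1 / bump_mass \<and> (\<forall>p. \<bar>snd p\<bar> \<le> 2 * \<delta> \<longrightarrow> \<phi> p = - (\<nu> / \<delta>) * conv KL (profile \<delta> \<phi>) p + c)"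
    using exists_profile by blast
  obtain C0 where C0: "0 < C0" and Hs: "\<And>s \<delta> Q f. 0 \<le> s \<Longrightarrow> s \<le> 3/2 \<Longrightarrow> 0 < \<delta> \<Longrightarrow> \<delta> \<le> 1 \<Longrightarrow>
      (\<And>k \<xi>. cmod (fourier_Txr f k \<xi>) \<le> Q) \<Longrightarrow> (\<And>k \<xi>. \<bar>real_of_int k\<bar> ^ 3 * cmod (fourier_Txr f k \<xi>) \<le> Q) \<Longrightarrow>
      (\<And>k \<xi>. \<bar>\<delta> * \<xi>\<bar> ^ 3 * cmod (fourier_Txr f k \<xi>) \<le> Q) \<Longrightarrow> Hs_norm s f \<le> C0 * Q * \<delta> powr (- (s + 1/2))"
    using Hs_norm_bound by blast
  define C2 where "C2 = 8 * pi * (4 * pi / bump_mass) * (K + 1)"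
  have C2: "0 < C2" unfolding C2_def using bump_mass_pos K by simp
  have main: "\<exists>(\<Omega> :: real \<Rightarrow> real \<Rightarrow> real) (lam :: real).
        periodic_x \<Omega> \<and> smooth_Txr \<Omega> \<and> compact_supp_Txr \<Omega> \<and>
        (\<exists>x1 x2 y. \<Omega> x1 y \<noteq> \<Omega> x2 y) \<and>
        euler_couette_sol (traveling \<Omega> lam) \<and>
        (\<forall>t. Hs_norm s (traveling \<Omega> lam t) < \<epsilon>) \<and>
        1 \<le> \<bar>lam\<bar> \<and> \<bar>lam\<bar> \<le> 1" if \<epsilon>: "0 < \<epsilon>" for \<epsilon>
  proof -
    \<comment> \<open>The factors 2 make the inequalities strict: \<delta> < \<delta>0, and a norm
      of at most \<epsilon>/2.\<close>
    define \<delta> where "\<delta> = min (\<delta>0 / 2) ((\<epsilon> / (2 * C0 * C2)) powr (1 / \<gamma>))"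
    have \<delta>: "0 < \<delta>" "\<delta> < \<delta>0" "\<delta> \<le> 1/4" "\<delta> \<le> 1" using \<delta>0 \<epsilon> C0 C2 by (auto simp: \<delta>_def min_def)
    have \<delta>\<gamma>: "C0 * C2 * \<delta> powr \<gamma> < \<epsilon>"
    proof -
      have "\<delta> powr \<gamma> \<le> ((\<epsilon> / (2 * C0 * C2)) powr (1 / \<gamma>)) powr \<gamma>"
        using \<delta>(1) \<gamma> by (intro powr_mono2) (auto simp: \<delta>_def)
      also have "\<dots> = \<epsilon> / (2 * C0 * C2)" using \<gamma> \<epsilon> C0 C2 by (simp add: powr_powr)
      finally have "C0 * C2 * \<delta> powr \<gamma> \<le> C0 * C2 * (\<epsilon> / (2 * C0 * C2))" using C0 C2 by (intro mult_left_mono) auto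
      also have "\<dots> = \<epsilon> / 2" using C0 C2 by simp
      finally show ?thesis using \<epsilon> by simp
    qed
    obtain \<phi> \<nu> c where \<phi>: "admissible \<phi>" and \<phi>a: "\<And>p. \<bar>\<phi> p - a * cos (fst p)\<bar> \<le> a / 100" and \<nu>: "0 < \<nu>" "\<nu> \<le> 1 / bump_mass"
      and eq: "\<And>p. \<bar>snd p\<bar> \<le> 2 * \<delta> \<Longrightarrow> \<phi> p = - (\<nu> / \<delta>) * conv KL (profile \<delta> \<phi>) p + c"
      using ex[OF \<delta>(1,2)] by blast
    note Wg = profile_good[OF \<delta>(1) \<phi>]
    define A where "A = 4 * pi * \<delta> * \<nu>"
    have A: "0 < A" unfolding A_def using \<delta> \<nu> by simp
    define \<Omega> where "\<Omega> = (\<lambda>x y. - (4 * pi * \<delta> * \<nu>) * profile \<delta> \<phi> (x, y + 1))"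
    have \<Omega>A: "\<Omega> x y = - A * profile \<delta> \<phi> ((x, y) + (0, 1))" for x y by (simp add: \<Omega>_def A_def)
    have per: "per (profile \<delta> \<phi>)" using Wg by (simp add: good_def)
    have "Hs_norm s (traveling \<Omega> 1 t) < \<epsilon>" for t
    proof -
      have tr: "traveling \<Omega> 1 t = (\<lambda>x y. - A * profile \<delta> \<phi> ((x, y) + (t, 1)))"
        by (simp add: fun_eq_iff traveling_def \<Omega>_def A_def)
      \<comment> \<open>A common bound for all three Fourier estimates. One power of \<delta> is the
        area 8 \<pi> \<delta> of the layer, a second is hidden in the amplitude \<open>A\<close>;
        the + 1 covers the estimate without derivatives.\<close>
      define Q where "Q = 8 * pi * \<delta> * A * ((K + 1) * \<delta> powr (- 3 * \<eta>))"
      have d1: "1 \<le> \<delta> powr (- 3 * \<eta>)" using powr_mono2'[of "- 3 * \<eta>" \<delta> 1] \<delta> \<eta> by simp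
      have d3: "(\<delta> powr (- \<eta>)) ^ 3 = \<delta> powr (- 3 * \<eta>)" using \<delta> by (simp add: powr_power mult.commute)
      have lift: "4 * pi * (2 * \<delta>) * (A * B) \<le> Q" if "B \<le> (K + 1) * \<delta> powr (- 3 * \<eta>)" for B
        using mult_left_mono[OF that, of "8 * pi * \<delta> * A"] A \<delta> by (simp add: Q_def mult_ac)
      obtain Xa Xb Xc where X: "good (2 * \<delta>) Xa" "good (2 * \<delta>) Xb" "good (2 * \<delta>) Xc" "line_deriv (1, 0) (profile \<delta> \<phi>) Xa" "line_deriv (1, 0) Xa Xb" "line_deriv (1, 0) Xb Xc"
        "\<And>p. \<bar>Xc p\<bar> \<le> K * (\<delta> powr (- \<eta>)) ^ 3"
        using bounds[OF \<delta>(1,3) \<phi> \<nu> eq] by blast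
      obtain Ya Yb Yc where Y: "good (2 * \<delta>) Ya" "good (2 * \<delta>) Yb" "good (2 * \<delta>) Yc" "line_deriv (0, 1) (profile \<delta> \<phi>) Ya" "line_deriv (0, 1) Ya Yb" "line_deriv (0, 1) Yb Yc"
        "\<And>p. \<bar>Yc p\<bar> \<le> K * (1 / \<delta>) ^ 3"
        using bounds[OF \<delta>(1,3) \<phi> \<nu> eq] by blast
      have r0: "0 \<le> 2 * \<delta>" using \<delta> by simp
      have "Hs_norm s (traveling \<Omega> 1 t) \<le> C0 * Q * \<delta> powr (- (s + 1/2))"
      proof (rule Hs)
        fix k :: int and \<xi> :: real
        have "cmod (fourier_Txr (\<lambda>x y. - A * profile \<delta> \<phi> ((x, y) + (t, 1))) k \<xi>) \<le> 4 * pi * (2 * \<delta>) * (A * 1)"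
          by (rule fourier_bound[OF good_at_translate[OF Wg] r0]) (use A profile_bounds in \<open>simp add: abs_mult\<close>)
        also have "\<dots> \<le> Q"
        proof (rule lift)
          have "1 * 1 \<le> (K + 1) * \<delta> powr (- 3 * \<eta>)" using K d1 by (intro mult_mono) auto
          then show "1 \<le> (K + 1) * \<delta> powr (- 3 * \<eta>)" by simp
        qed
        finally show "cmod (fourier_Txr (traveling \<Omega> 1 t) k \<xi>) \<le> Q" unfolding tr .
        have "\<bar>real_of_int k\<bar> ^ 3 * cmod (fourier_Txr (\<lambda>x y. - A * profile \<delta> \<phi> ((x, y) + (t, 1))) k \<xi>) \<le> 4 * pi * (2 * \<delta>) * (A * (K * (\<delta> powr (- \<eta>)) ^ 3))"
          by (rule traveling_wave_fourier_bounds(1)[OF Wg X(1,2,3) r0 less_imp_le[OF A] X(7) X(4,5,6)])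
        also have "\<dots> \<le> Q"
          by (rule lift) (simp add: d3 mult_right_mono)
        finally show "\<bar>real_of_int k\<bar> ^ 3 * cmod (fourier_Txr (traveling \<Omega> 1 t) k \<xi>) \<le> Q" unfolding tr .
        have "\<bar>\<xi>\<bar> ^ 3 * cmod (fourier_Txr (\<lambda>x y. - A * profile \<delta> \<phi> ((x, y) + (t, 1))) k \<xi>) \<le> 4 * pi * (2 * \<delta>) * (A * (K * (1 / \<delta>) ^ 3))"
          by (rule traveling_wave_fourier_bounds(2)[OF Wg Y(1,2,3) r0 less_imp_le[OF A] Y(7) Y(4,5,6)])
        then have "\<delta> ^ 3 * (\<bar>\<xi>\<bar> ^ 3 * cmod (fourier_Txr (traveling \<Omega> 1 t) k \<xi>)) \<le> \<delta> ^ 3 * (4 * pi * (2 * \<delta>) * (A * (K * (1 / \<delta>) ^ 3)))"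
          unfolding tr using \<delta> by (intro mult_left_mono) auto
        also have "\<dots> = 4 * pi * (2 * \<delta>) * (A * K)" using \<delta> by (simp add: power_divide)
        also have "\<dots> \<le> Q"
        proof (rule lift)
          have "K * 1 \<le> (K + 1) * \<delta> powr (- 3 * \<eta>)" using K d1 by (intro mult_mono) auto
          then show "K \<le> (K + 1) * \<delta> powr (- 3 * \<eta>)" by simp
        qed
        finally show "\<bar>\<delta> * \<xi>\<bar> ^ 3 * cmod (fourier_Txr (traveling \<Omega> 1 t) k \<xi>) \<le> Q"
          using \<delta> by (simp add: abs_mult power_mult_distrib mult.assoc)
      qed (use assms \<delta> in auto)
      also have "\<dots> \<le> C0 * (C2 * (\<delta>\<^sup>2 * \<delta> powr (- 3 * \<eta>))) * \<delta> powr (- (s + 1/2))"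
      proof (intro mult_right_mono mult_left_mono)
        have "A \<le> 4 * pi * \<delta> * (1 / bump_mass)" unfolding A_def using \<nu> \<delta> by (intro mult_left_mono) auto
        then have "8 * pi * \<delta> * A * ((K + 1) * \<delta> powr (- 3 * \<eta>)) \<le> 8 * pi * \<delta> * (4 * pi * \<delta> * (1 / bump_mass)) * ((K + 1) * \<delta> powr (- 3 * \<eta>))"
          using \<delta> K by (intro mult_right_mono mult_left_mono) auto
        moreover have "8 * pi * \<delta> * (4 * pi * \<delta> * (1 / bump_mass)) * (k1 * D) = 8 * pi * (4 * pi / bump_mass) * k1 * (\<delta>\<^sup>2 * D)" for k1 D
          by (simp add: power2_eq_square mult_ac)
        ultimately show "Q \<le> C2 * (\<delta>\<^sup>2 * \<delta> powr (- 3 * \<eta>))" by (simp only: Q_def C2_def)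
      qed (use C0 in auto)
      also have "\<dots> = C0 * C2 * \<delta> powr \<gamma>"
      proof -
        have "\<delta>\<^sup>2 * \<delta> powr (- 3 * \<eta>) * \<delta> powr (- (s + 1/2)) = \<delta> powr (2 + (- 3 * \<eta>) + (- (s + 1/2)))"
          using \<delta> by (simp only: powr_add) (simp add: powr_numeral)
        also have "2 + (- 3 * \<eta>) + (- (s + 1/2)) = \<gamma>" by (simp add: \<eta>_def \<gamma>_def field_simps)
        finally show ?thesis by (simp add: mult_ac)
      qed
      also have "\<dots> < \<epsilon>" by (rule \<delta>\<gamma>)
      finally show ?thesis .
    qed
    moreover have "periodic_x \<Omega>" unfolding periodic_x_def \<Omega>_def using perD[OF per] by simp
    moreover have "smooth_Txr \<Omega>"
    proof -
      have "Ck n (\<lambda>p. - A * profile \<delta> \<phi> (p + (0, 1)))" for n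
        by (intro Ck_mult Ck_const Ck_translate profile_Ck[OF \<delta>(1) \<phi> eq])
      moreover have "(\<lambda>(x, y). \<Omega> x y) = (\<lambda>p. - A * profile \<delta> \<phi> (p + (0, 1)))" unfolding fun_eq_iff split_paired_all \<Omega>A by simp
      ultimately show ?thesis unfolding smooth_Txr_def using smooth2_if_Ck by simp
    qed
    moreover have "compact_supp_Txr \<Omega>" unfolding compact_supp_Txr_def
    proof (intro exI[of _ "2 * \<delta> + 1"] allI impI)
      fix x y :: real assume "2 * \<delta> + 1 < \<bar>y\<bar>"
      then have "2 * \<delta> < \<bar>snd (x, y + 1)\<bar>" by (simp add: abs_if split: if_splits)
      then have "profile \<delta> \<phi> (x, y + 1) = 0" using Wg unfolding good_def strip_def by blast
      then show "\<Omega> x y = 0" by (simp add: \<Omega>_def)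
    qed
    \<comment> \<open>Height -1 is the centre of the lowered layer. There \<phi> is close to a at x
      = 0 and to -a at x = \<pi>, and the bump is strictly increasing on positive arguments.\<close>
    moreover have "\<Omega> 0 (-1) \<noteq> \<Omega> pi (-1)"
    proof -
      have "\<bar>\<phi> (0, 0) - a\<bar> \<le> a / 100" "\<bar>\<phi> (pi, 0) + a\<bar> \<le> a / 100" using \<phi>a[of "(0, 0)"] \<phi>a[of "(pi, 0)"] by simp_all
      then have "\<phi> (pi, 0) < \<phi> (0, 0)" "0 < 1 + \<phi> (pi, 0)" using a by linarith+
      then have "profile \<delta> \<phi> (pi, 0) < profile \<delta> \<phi> (0, 0)" unfolding profile_def by (simp add: bump_less)
      then show ?thesis using \<delta>(1) \<nu>(1) by (simp add: \<Omega>_def)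
    qed
    moreover have "euler_couette_sol (traveling \<Omega> 1)"
      by (rule traveling_wave_solution[OF \<delta>(1) \<phi> eq \<Omega>_def])
    ultimately show ?thesis by (intro exI[of _ \<Omega>] exI[of _ 1]) auto
  qed
  \<comment> \<open>The speed is 1 for every \<epsilon>, so both constants can be 1.\<close>
  then show ?thesis by (intro exI[of _ 1]) auto
qed

end
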